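(* Let $s,r,n\in\mathbb N$ with $n\ge s$ and $r\ge2$, and let $p,q,R,R',\eta\in\mathbb R$ satisfy $$0<q<\tfrac18,\quad 0<p\le\frac q{2^{10}r^2s^2},\quad R=2^{-6}pn,\quad 0\le R'\le\frac R{16},\quad \eta=p^4\Big(\frac q2\Big)^{4s}.$$ Let $\mathcal F$ be a $(p,R')$-Janson $(s+1)$-uniform hypergraph with vertex set $U$, let $\mathcal H$ be an $s$-uniform hypergraph with vertex set $V$, $|V|=n$, and let $\pi:V\to U$ satisfy $|\pi(L)|\ge|L|/2$ for every $L\subset V$ and $|\pi(E)|=|E|$ for every $E\in\mathcal H$. Let $v$ be a vertex not in $U$. Then there is a family $\mathcal X\subset2^V$ with $|\mathcal X|\le4(2/q)^{4qn}$ such that: (1) if $I\subset V$ and $\pi_v(\mathcal H[I])\cup\mathcal F$ is not $(p,R'+\eta R)$-Janson, then $I\subset X$ for some $X\in\mathcal X$; (2) for each $X\in\mathcal X$ with $|X|\ge n/(8r)$ there exists $Y\subset X$ with $|Y|\ge|X|-2^{-8}r^{-1}n$ such that $\pi(\mathcal H[Y])$ is not $(p,R)$-Janson.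
   Context: A hypergraph is identified with its edge set; $\mathcal H[I]=\{E\in\mathcal H:E\subset I\}$. For a hypergraph $\mathcal G$ on $V$, $\pi(\mathcal G)=\{\pi(E):E\in\mathcal G\}$ and $\pi_v(\mathcal G)=\{\pi(E)\cup\{v\}:E\in\mathcal G\}$; the union of two hypergraphs is the hypergraph on the union of their vertex sets whose edge set is the union of their edge sets. For $\nu:\mathcal G\to\mathbb R_{\ge0}$: $e(\nu)=\sum_E\nu(E)$, $d_\nu(L)=\sum_{E\in\mathcal G,L\subset E}\nu(E)$, $\Lambda_p(\nu)=\sum_{L\subset V(\mathcal G),|L|\ge2}d_\nu(L)^2p^{-|L|}$. For $R>0$, $\mathcal G$ is $(p,R)$-Janson if some $\nu:\mathcal G\to\mathbb R_{\ge0}$ has $\Lambda_p(\nu)<e(\nu)^2/R$; every hypergraph is $(p,0)$-Janson. *)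

theory Defs
  imports Main "HOL-Library.Disjoint_Sets" Complex_Main
begin

text \<open>Hypergraphs are identified with their edge sets (sets of finite sets).
  A weight function nu is any real function; only its values on edges matter.\<close>

definition induced :: "'a set set \<Rightarrow> 'a set \<Rightarrow> 'a set set" where
  "induced H I = {E \<in> H. E \<subseteq> I}"

definition proj :: "('a \<Rightarrow> 'b) \<Rightarrow> 'a set set \<Rightarrow> 'b set set" where
  "proj \<pi> G = (\<lambda>E. \<pi> ` E) ` G"

definition proj_v :: "('a \<Rightarrow> 'b) \<Rightarrow> 'b \<Rightarrow> 'a set set \<Rightarrow> 'b set set" where
  "proj_v \<pi> v G = (\<lambda>E. \<pi> ` E \<union> {v}) ` G"

definition e_nu :: "'a set set \<Rightarrow> ('a set \<Rightarrow> real) \<Rightarrow> real" where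
  "e_nu G \<nu> = (\<Sum>E\<in>G. \<nu> E)"

definition d_nu :: "'a set set \<Rightarrow> ('a set \<Rightarrow> real) \<Rightarrow> 'a set \<Rightarrow> real" where
  "d_nu G \<nu> L = (\<Sum>E\<in>{E \<in> G. L \<subseteq> E}. \<nu> E)"

text \<open>Vertices outside all edges contribute zero, so summing over subsets of the
  union of the edges equals summing over subsets of the vertex set.\<close>
definition Lambda :: "real \<Rightarrow> 'a set set \<Rightarrow> ('a set \<Rightarrow> real) \<Rightarrow> real" where
  "Lambda p G \<nu> = (\<Sum>L\<in>{L. L \<subseteq> \<Union>G \<and> 2 \<le> card L}. (d_nu G \<nu> L)^2 / p ^ card L)"

definition janson :: "real \<Rightarrow> real \<Rightarrow> 'a set set \<Rightarrow> bool" where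
  "janson p R G = (R = 0 \<or> (R > 0 \<and> (\<exists>\<nu>. (\<forall>E\<in>G. \<nu> E \<ge> 0) \<and>
      Lambda p G \<nu> < (e_nu G \<nu>)^2 / R)))"

end

theory Submission
  imports Defs "HOL-Analysis.Analysis"
begin

text \<open>
  Give every vertex x a weight m x > 0 and every measure on the edges the energy
  that sums d(L)^2 / prod_{x in L} m x over all nonempty L. The maximum of 2 e - energy is attained at an
  equilibrium measure; its total mass, the capacity, is the common value of this problem and of the dual problem of
  covering the edges by weights on subsets. A mixture of the given measure on F with a projected
  equilibrium measure shows that every I for which the Janson property fails has tiny capacity at
  weight p/2.

  If X does not satisfy (2) with any Y, then many measures supplied by the Janson property of
  different Y can be averaged to one measure with small degrees, so the capacity of X is large.
  Starting from constant weights, the weights are lowered slowly while random vertices receive extra weight.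
  As long as I is dense in the large level sets of the influence of the vertices on the capacity,
  the extra weight sampled inside I makes up for the loss. For tiny capacity this must fail for a
  noticeable fraction of sample sequences, so a short list of sequences provides a short list of
  sets P such that every such I inside X is sparse in one of them. Replacing P by its small
  intersection with I and iterating gives the containers.
\<close>

section \<open>Energy and equilibrium measures\<close>

text \<open>Adding v turns the degree of a single vertex into a pair degree, so the energy has to
  start at |L| = 1, whereas the Janson property of the projected hypergraphs controls only |L| \<ge>
  2. The average over many Y closes this gap by bounding vertex degrees. The weight is p/2 because
  \<pi> may merge vertices: a set has at most 2^|L| injective lifts, and Cauchy-Schwarz moves this
  factor into the weight. The projected measure must also not correlate with the one on F; hence
  edges with a large mixed term are removed from H beforehand, and Markov's inequality keeps most of
  the mass. One budget fixes the numbers. Cutting P down to density below q/2 frees an exponent 4q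
  ln(2/q) (1 - q/2) |P|, which must pay for the choice of P and of its trace. Up to polynomial
  factors there are (2/q)^J sets P, where J is the number of samples, so J must stay below about
  3q|P|. Both J and the lower bound for |P| depend on how spread the averaged measure is, and the
  factor 2^10 r^2 s^2 between p and q makes them compatible.\<close>

definition nesub :: "'a set \<Rightarrow> 'a set set" where
  "nesub X = Pow X - {{}}"

definition wt :: "('a \<Rightarrow> real) \<Rightarrow> 'a set \<Rightarrow> real" where
  "wt m L = (\<Prod>x\<in>L. m x)"

definition energy :: "'a set \<Rightarrow> 'a set set \<Rightarrow> ('a \<Rightarrow> real) \<Rightarrow> ('a set \<Rightarrow> real) \<Rightarrow> real" where
  "energy X G m \<rho> = (\<Sum>L\<in>nesub X. (d_nu G \<rho> L)\<^sup>2 / wt m L)"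

text \<open>Half the partial derivative of \<open>energy\<close> in the coordinate
  \<open>\<rho> E\<close>. Thus \<open>equilibrium\<close> is the first-order optimality condition,
  with complementary slackness, for maximising 2 e - energy over nonnegative measures.\<close>

definition potential :: "'a set set \<Rightarrow> ('a \<Rightarrow> real) \<Rightarrow> ('a set \<Rightarrow> real) \<Rightarrow> 'a set \<Rightarrow> real" where
  "potential G m \<rho> E = (\<Sum>L\<in>nesub E. d_nu G \<rho> L / wt m L)"

definition equilibrium :: "'a set set \<Rightarrow> ('a \<Rightarrow> real) \<Rightarrow> ('a set \<Rightarrow> real) \<Rightarrow> bool" where
  "equilibrium G m \<rho> \<longleftrightarrow> (\<forall>E\<in>G. 0 \<le> \<rho> E \<and> 1 \<le> potential G m \<rho> E \<and>
      (0 < \<rho> E \<longrightarrow> potential G m \<rho> E = 1))"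

definition eqm :: "'a set set \<Rightarrow> ('a \<Rightarrow> real) \<Rightarrow> 'a set \<Rightarrow> real" where
  "eqm G m = (SOME \<rho>. equilibrium G m \<rho>)"

definition capacity :: "'a set set \<Rightarrow> ('a \<Rightarrow> real) \<Rightarrow> real" where
  "capacity G m = e_nu G (eqm G m)"

text \<open>By the envelope principle this is the derivative of the capacity in the coordinate
  \<open>m x\<close>; \<open>capacity_gain\<close> and \<open>capacity_decrease\<close> are its
  versions for finite steps.\<close>

definition influence :: "'a set \<Rightarrow> 'a set set \<Rightarrow> ('a \<Rightarrow> real) \<Rightarrow> 'a \<Rightarrow> real" where
  "influence X G m x = (\<Sum>L\<in>{L \<in> nesub X. x \<in> L}. (d_nu G (eqm G m) L)\<^sup>2 / wt m L) / m x"

text \<open>Continuity along limits in the coordinates of \<open>D\<close> replaces a topology on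
  the function space. It forces \<open>F\<close> to depend on these finitely many coordinates only,
  and a maximising sequence has a subsequence that converges in all of them.\<close>

lemma attains_max_box:
  fixes F :: "('b \<Rightarrow> real) \<Rightarrow> real"
  assumes fin: "finite D" and B: "0 \<le> B"
    and cont: "\<And>f l. (\<forall>i\<in>D. (\<lambda>n. f n i) \<longlonglongrightarrow> l i) \<Longrightarrow> (\<lambda>n. F (f n)) \<longlonglongrightarrow> F l"
    and bdd: "\<And>\<sigma>. (\<forall>i\<in>D. 0 \<le> \<sigma> i \<and> \<sigma> i \<le> B) \<Longrightarrow> F \<sigma> \<le> C"
  obtains \<rho> where "\<forall>i\<in>D. 0 \<le> \<rho> i \<and> \<rho> i \<le> B"
    and "\<And>\<sigma>. (\<forall>i\<in>D. 0 \<le> \<sigma> i \<and> \<sigma> i \<le> B) \<Longrightarrow> F \<sigma> \<le> F \<rho>"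
proof -
  define S where "S = {\<sigma>. \<forall>i\<in>D. 0 \<le> \<sigma> i \<and> \<sigma> i \<le> B}"
  define M where "M = Sup (F ` S)"
  have ne: "F ` S \<noteq> {}" using B by (auto simp: S_def intro!: exI[of _ "\<lambda>_. 0"])
  have bd: "bdd_above (F ` S)" using bdd by (auto simp: S_def bdd_above_def)
  have le: "F \<sigma> \<le> M" if "\<sigma> \<in> S" for \<sigma>
    unfolding M_def using that bd by (intro cSup_upper) auto
  have "\<exists>\<sigma>\<in>S. M - 1 / real (Suc n) < F \<sigma>" for n
  proof -
    have "M - 1 / real (Suc n) < Sup (F ` S)" by (simp add: M_def)
    then show ?thesis using less_cSup_iff[OF ne bd] by auto
  qed
  then obtain f where f: "\<And>n. f n \<in> S" "\<And>n. M - 1 / real (Suc n) < F (f n)" by metis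
  have "\<forall>\<delta>\<subseteq>D. \<exists>l. \<exists>r::nat\<Rightarrow>nat. strict_mono r \<and>
      (\<forall>\<epsilon>>0. eventually (\<lambda>n. \<forall>i\<in>\<delta>. dist (f (r n) i) (l i) < \<epsilon>) sequentially)"
  proof (rule compact_lemma_general[where unproj = "\<lambda>e. e"])
    fix k assume "k \<in> D"
    then show "bounded ((\<lambda>x. x k) ` range f)"
      using f(1) by (intro boundedI[of _ B]) (auto simp: S_def)
  qed (use fin in auto)
  then obtain l and r :: "nat \<Rightarrow> nat" where r: "strict_mono r"
    and l: "\<forall>\<epsilon>>0. eventually (\<lambda>n. \<forall>i\<in>D. dist (f (r n) i) (l i) < \<epsilon>) sequentially"
    by blast
  have lim: "(\<lambda>n. f (r n) i) \<longlonglongrightarrow> l i" if "i \<in> D" for i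
    unfolding tendsto_iff
  proof (intro allI impI)
    fix e :: real assume "0 < e"
    with l have "eventually (\<lambda>n. \<forall>i\<in>D. dist (f (r n) i) (l i) < e) sequentially" by blast
    then show "eventually (\<lambda>n. dist (f (r n) i) (l i) < e) sequentially"
      by (rule eventually_mono) (use that in auto)
  qed
  have "0 \<le> l i \<and> l i \<le> B" if "i \<in> D" for i
    using LIMSEQ_le_const[OF lim[OF that]] LIMSEQ_le_const2[OF lim[OF that]] f(1) that
    by (auto simp: S_def)
  then have lS: "l \<in> S" by (auto simp: S_def)
  have "(\<lambda>n. F (f (r n))) \<longlonglongrightarrow> F l" using cont[of "\<lambda>n. f (r n)"] lim by auto
  moreover have "(\<lambda>n. M - 1 / real (Suc (r n))) \<longlonglongrightarrow> M - 0"
    by (intro tendsto_intros LIMSEQ_subseq_LIMSEQ[OF LIMSEQ_Suc[OF lim_inverse_n'], unfolded o_def] r)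
  ultimately have "M \<le> F l"
    using f(2) by (intro LIMSEQ_le[of "\<lambda>n. M - 1 / real (Suc (r n))" M]) (auto intro: less_imp_le)
  then show ?thesis using that[of l] lS le by (force simp: S_def)
qed

locale uniform_hypergraph =
  fixes X :: "'a set" and G :: "'a set set" and s :: nat
  assumes finX: "finite X" and uniform: "G \<subseteq> {E. E \<subseteq> X \<and> card E = s}" and s_pos: "0 < s"
begin

lemma finG: "finite G"
  by (rule finite_subset[OF uniform]) (simp add: finX)

lemma edgeD: "E \<in> G \<Longrightarrow> E \<subseteq> X \<and> card E = s \<and> finite E \<and> E \<noteq> {}"
  using uniform finX s_pos by (auto intro: finite_subset)

lemma fin_nesub: "finite (nesub X)" by (simp add: nesub_def finX)

lemma nesub_edge: "E \<in> G \<Longrightarrow> nesub E = {L \<in> nesub X. L \<subseteq> E}"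
  using edgeD by (auto simp: nesub_def)

lemma d_if: "d_nu G \<rho> L = (\<Sum>E\<in>G. if L \<subseteq> E then \<rho> E else 0)"
  by (simp add: d_nu_def sum.inter_filter finG)

lemma d_nonneg: "(\<And>E. E \<in> G \<Longrightarrow> 0 \<le> \<rho> E) \<Longrightarrow> 0 \<le> d_nu G \<rho> L"
  by (auto simp: d_nu_def intro!: sum_nonneg)

lemma d_le_e: "(\<And>E. E \<in> G \<Longrightarrow> 0 \<le> \<rho> E) \<Longrightarrow> d_nu G \<rho> L \<le> e_nu G \<rho>"
  unfolding d_nu_def e_nu_def by (rule sum_mono2) (auto simp: finG)

lemma e_nonneg: "(\<And>E. E \<in> G \<Longrightarrow> 0 \<le> \<rho> E) \<Longrightarrow> 0 \<le> e_nu G \<rho>"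
  by (auto simp: e_nu_def intro!: sum_nonneg)

lemma wt_pos: "\<forall>x\<in>X. 0 < m x \<Longrightarrow> L \<subseteq> X \<Longrightarrow> 0 < wt m L"
  unfolding wt_def by (rule prod_pos) auto

lemma sum_edges_nesub:
  "(\<Sum>E\<in>G. \<rho> E * (\<Sum>L\<in>nesub E. h L)) = (\<Sum>L\<in>nesub X. h L * d_nu G \<rho> L)"
proof -
  have "(\<Sum>E\<in>G. \<rho> E * (\<Sum>L\<in>nesub E. h L)) = (\<Sum>E\<in>G. \<Sum>L\<in>nesub X. if L \<subseteq> E then \<rho> E * h L else 0)"
    by (intro sum.cong refl)
      (simp add: nesub_edge sum_distrib_left sum.inter_filter fin_nesub if_distrib cong: if_cong)
  also have "\<dots> = (\<Sum>L\<in>nesub X. \<Sum>E\<in>G. if L \<subseteq> E then \<rho> E * h L else 0)"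
    by (rule sum.swap)
  also have "\<dots> = (\<Sum>L\<in>nesub X. h L * d_nu G \<rho> L)"
    by (intro sum.cong refl) (auto simp: d_if sum_distrib_left intro!: sum.cong)
  finally show ?thesis .
qed

lemma sum_edges_nesub_at:
  assumes "x \<in> X"
  shows "(\<Sum>E\<in>{E\<in>G. x \<in> E}. \<rho> E * (\<Sum>L\<in>nesub E. h L)) = (\<Sum>L\<in>nesub X. h L * d_nu G \<rho> (insert x L))"
proof -
  have "(\<Sum>E\<in>{E\<in>G. x \<in> E}. \<rho> E * (\<Sum>L\<in>nesub E. h L))
      = (\<Sum>E\<in>G. (if x \<in> E then \<rho> E else 0) * (\<Sum>L\<in>nesub E. h L))"
    by (auto simp: sum.inter_filter finG intro!: sum.cong)
  also have "\<dots> = (\<Sum>L\<in>nesub X. h L * d_nu G (\<lambda>E. if x \<in> E then \<rho> E else 0) L)"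
    by (rule sum_edges_nesub)
  also have "\<dots> = (\<Sum>L\<in>nesub X. h L * d_nu G \<rho> (insert x L))"
    by (intro sum.cong refl arg_cong2[where f="(*)"]) (auto simp: d_if intro!: sum.cong)
  finally show ?thesis .
qed

text \<open>Cauchy-Schwarz on the vertex degrees alone. It makes the energy outgrow the mass, so
  that a maximiser exists, and it later bounds the capacity by the total weight.\<close>

lemma degree_energy_bound:
  assumes m: "\<forall>x\<in>X. 0 < m x" and nn: "\<And>E. E \<in> G \<Longrightarrow> 0 \<le> \<rho> E"
  shows "(e_nu G \<rho>)\<^sup>2 \<le> (\<Sum>x\<in>X. m x) * energy X G m \<rho>"
proof -
  have "e_nu G \<rho> \<le> (\<Sum>x\<in>X. d_nu G \<rho> {x})"
  proof -
    have "(\<Sum>x\<in>X. d_nu G \<rho> {x}) = (\<Sum>E\<in>G. \<Sum>x\<in>X. if x \<in> E then \<rho> E else 0)"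
      by (simp add: d_if sum.swap[of _ X])
    also have "\<dots> = (\<Sum>E\<in>G. real s * \<rho> E)"
    proof (intro sum.cong refl)
      fix E assume "E \<in> G"
      then have "{x\<in>X. x \<in> E} = E" "card E = s" using edgeD by auto
      then show "(\<Sum>x\<in>X. if x \<in> E then \<rho> E else 0) = real s * \<rho> E"
        by (simp add: sum.inter_filter[symmetric] finX)
    qed
    also have "\<dots> \<ge> (\<Sum>E\<in>G. 1 * \<rho> E)"
      using nn s_pos by (intro sum_mono mult_right_mono) auto
    finally show ?thesis by (simp add: e_nu_def)
  qed
  also have "(\<Sum>x\<in>X. d_nu G \<rho> {x}) = (\<Sum>x\<in>X. sqrt (m x) * (d_nu G \<rho> {x} / sqrt (m x)))"
    using m by (intro sum.cong refl) (auto simp: less_imp_neq[symmetric])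
  finally have "(e_nu G \<rho>)\<^sup>2 \<le> (\<Sum>x\<in>X. sqrt (m x) * (d_nu G \<rho> {x} / sqrt (m x)))\<^sup>2"
    using e_nonneg[OF nn] by (intro power_mono) auto
  also have "\<dots> \<le> (\<Sum>x\<in>X. (sqrt (m x))\<^sup>2) * (\<Sum>x\<in>X. (d_nu G \<rho> {x} / sqrt (m x))\<^sup>2)"
    by (rule Cauchy_Schwarz_ineq_sum)
  also have "(\<Sum>x\<in>X. (sqrt (m x))\<^sup>2) = (\<Sum>x\<in>X. m x)"
    using m by (intro sum.cong refl) (auto simp: less_imp_le)
  also have "(\<Sum>x\<in>X. (d_nu G \<rho> {x} / sqrt (m x))\<^sup>2) = (\<Sum>L\<in>(\<lambda>x. {x}) ` X. (d_nu G \<rho> L)\<^sup>2 / wt m L)"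
    using m by (subst sum.reindex) (auto simp: wt_def power_divide less_imp_le intro!: sum.cong)
  also have "(\<Sum>x\<in>X. m x) * \<dots> \<le> (\<Sum>x\<in>X. m x) * energy X G m \<rho>"
    unfolding energy_def using m
    by (intro mult_left_mono sum_mono2 fin_nesub sum_nonneg)
      (auto simp: nesub_def less_imp_le wt_def intro!: divide_nonneg_nonneg prod_nonneg)
  finally show ?thesis .
qed

lemma energy_nonneg: "\<forall>x\<in>X. 0 < m x \<Longrightarrow> 0 \<le> energy X G m \<rho>"
  unfolding energy_def nesub_def using wt_pos[of m]
  by (intro sum_nonneg divide_nonneg_nonneg) (auto simp: less_imp_le)

lemma d_nu_upd:
  assumes "E \<in> G"
  shows "d_nu G (\<rho>(E := \<rho> E + t)) L = d_nu G \<rho> L + (if L \<subseteq> E then t else 0)"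
proof -
  have "d_nu G (\<rho>(E := \<rho> E + t)) L = (\<Sum>E'\<in>G. (if L \<subseteq> E' then \<rho> E' else 0) + (if E' = E then if L \<subseteq> E then t else 0 else 0))"
    unfolding d_if by (intro sum.cong) auto
  also have "\<dots> = d_nu G \<rho> L + (if L \<subseteq> E then t else 0)"
    using assms by (simp add: sum.distrib d_if finG)
  finally show ?thesis .
qed

lemma energy_upd:
  assumes "E \<in> G"
  shows "energy X G m (\<rho>(E := \<rho> E + t))
    = energy X G m \<rho> + 2 * t * potential G m \<rho> E + t\<^sup>2 * (\<Sum>L\<in>nesub E. 1 / wt m L)"
proof -
  have "energy X G m (\<rho>(E := \<rho> E + t)) = (\<Sum>L\<in>nesub X. (d_nu G \<rho> L)\<^sup>2 / wt m L
     + (if L \<subseteq> E then 2 * t * (d_nu G \<rho> L / wt m L) + t\<^sup>2 * (1 / wt m L) else 0))"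
    unfolding energy_def d_nu_upd[OF assms]
    by (intro sum.cong refl) (auto simp: power2_eq_square algebra_simps add_divide_distrib)
  also have "\<dots> = energy X G m \<rho> + (\<Sum>L\<in>nesub E. 2 * t * (d_nu G \<rho> L / wt m L) + t\<^sup>2 * (1 / wt m L))"
    unfolding nesub_edge[OF assms] sum.inter_filter[OF fin_nesub]
    by (simp only: sum.distrib energy_def)
  finally show ?thesis by (simp add: sum.distrib potential_def sum_distrib_left)
qed

text \<open>Outside the box of side \<open>B\<close> the objective is at most 0 by
  \<open>degree_energy_bound\<close>, so a maximum over the box is global. Changing the mass of one
  edge by t then changes the objective by a quadratic in t whose linear coefficient is twice 1 minus
  the potential; both signs of t give the conditions.\<close>

lemma equilibrium_exists:
  assumes m: "\<forall>x\<in>X. 0 < m x"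
  shows "\<exists>\<rho>. equilibrium G m \<rho>"
proof -
  define F where "F \<rho> = 2 * e_nu G \<rho> - energy X G m \<rho>" for \<rho>
  define B where "B = 2 * (\<Sum>x\<in>X. m x) + 1"
  have Bp: "0 < B" unfolding B_def using m by (auto intro!: add_nonneg_pos sum_nonneg simp: less_imp_le)
  have cont: "(\<lambda>n. F (f n)) \<longlonglongrightarrow> F l" if "\<forall>i\<in>G. (\<lambda>n. f n i) \<longlonglongrightarrow> l i" for f l
    unfolding F_def e_nu_def energy_def d_nu_def divide_inverse
    by (intro tendsto_intros) (use that in auto)
  have bdd: "F \<sigma> \<le> 2 * (real (card G) * B)" if "\<forall>i\<in>G. 0 \<le> \<sigma> i \<and> \<sigma> i \<le> B" for \<sigma>
  proof -
    have "e_nu G \<sigma> \<le> real (card G) * B"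
      unfolding e_nu_def using that sum_bounded_above[of G \<sigma> B] by auto
    then show ?thesis using energy_nonneg[OF m, of \<sigma>] by (simp add: F_def)
  qed
  obtain \<rho> where \<rho>: "\<forall>i\<in>G. 0 \<le> \<rho> i \<and> \<rho> i \<le> B"
    and mx: "\<And>\<sigma>. (\<forall>i\<in>G. 0 \<le> \<sigma> i \<and> \<sigma> i \<le> B) \<Longrightarrow> F \<sigma> \<le> F \<rho>"
    using attains_max_box[where F = F, OF finG less_imp_le[OF Bp] cont bdd] by blast
  have F0: "0 \<le> F \<rho>"
    using mx[of "\<lambda>_. 0"] Bp by (simp add: F_def e_nu_def energy_def d_nu_def)
  have glob: "F \<sigma> \<le> F \<rho>" if nn: "\<forall>i\<in>G. 0 \<le> \<sigma> i" for \<sigma>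
  proof (cases "\<forall>i\<in>G. \<sigma> i \<le> B")
    case True then show ?thesis using mx nn by auto
  next
    case False
    then obtain E where E: "E \<in> G" "B < \<sigma> E" by auto
    have "\<sigma> E \<le> e_nu G \<sigma>" unfolding e_nu_def using E nn finG by (intro member_le_sum) auto
    then have e: "B \<le> e_nu G \<sigma>" using E by simp
    have "(e_nu G \<sigma>)\<^sup>2 \<le> (B / 2) * energy X G m \<sigma>"
      using degree_energy_bound[OF m, of \<sigma>] nn energy_nonneg[OF m, of \<sigma>]
        mult_right_mono[of "\<Sum>x\<in>X. m x" "B/2" "energy X G m \<sigma>"] by (auto simp: B_def)
    moreover have "B * e_nu G \<sigma> \<le> (e_nu G \<sigma>)\<^sup>2"
      using e Bp by (auto simp: power2_eq_square intro!: mult_right_mono)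
    ultimately have "B * (2 * e_nu G \<sigma>) \<le> B * energy X G m \<sigma>" by simp
    then have "F \<sigma> \<le> 0" using Bp by (simp add: F_def)
    then show ?thesis using F0 by simp
  qed
  have "0 \<le> \<rho> E \<and> 1 \<le> potential G m \<rho> E \<and> (0 < \<rho> E \<longrightarrow> potential G m \<rho> E = 1)" if E: "E \<in> G" for E
  proof -
    define c where "c = (\<Sum>L\<in>nesub E. 1 / wt m L)"
    define P where "P = potential G m \<rho> E"
    have c0: "0 \<le> c" unfolding c_def nesub_def using wt_pos[OF m] edgeD[OF E]
      by (intro sum_nonneg) (auto simp: less_imp_le)
    have ineq: "2 * t * (1 - P) \<le> t\<^sup>2 * c" if t: "- \<rho> E \<le> t" for t
    proof -
      have "F (\<rho>(E := \<rho> E + t)) \<le> F \<rho>"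
        using \<rho> t by (intro glob) auto
      moreover have "e_nu G (\<rho>(E := \<rho> E + t)) = e_nu G \<rho> + t"
      proof -
        have "e_nu G (\<rho>(E := \<rho> E + t)) = (\<Sum>E'\<in>G. \<rho> E' + (if E' = E then t else 0))"
          unfolding e_nu_def by (intro sum.cong) auto
        then show ?thesis using E by (simp add: sum.distrib finG e_nu_def)
      qed
      ultimately show ?thesis
        using energy_upd[OF E, of m \<rho> t] by (simp add: F_def P_def c_def algebra_simps)
    qed
    have "1 \<le> P"
    proof (rule ccontr)
      assume "\<not> 1 \<le> P"
      define t where "t = (1 - P) / (c + 1)"
      have t: "0 < t" using \<open>\<not> 1 \<le> P\<close> c0 by (simp add: t_def)
      have "2 * t * (1 - P) \<le> t\<^sup>2 * c" using ineq[of t] t \<rho> E by force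
      then have "2 * (1 - P) \<le> t * c" using t by (simp add: power2_eq_square)
      also have "t * c \<le> t * (c + 1)" using t by simp
      also have "\<dots> = 1 - P" using c0 by (simp add: t_def)
      finally show False using \<open>\<not> 1 \<le> P\<close> by simp
    qed
    moreover have "P = 1" if pos: "0 < \<rho> E"
    proof (rule ccontr)
      assume "P \<noteq> 1"
      then have P1: "1 < P" using \<open>1 \<le> P\<close> by simp
      define t where "t = min (\<rho> E) ((P - 1) / (c + 1))"
      have t: "0 < t" using P1 c0 pos by (simp add: t_def)
      have "2 * (-t) * (1 - P) \<le> (-t)\<^sup>2 * c" using ineq[of "-t"] by (simp add: t_def)
      then have "t * (2 * (P - 1)) \<le> t * (t * c)" by (simp add: power2_eq_square algebra_simps)
      then have "2 * (P - 1) \<le> t * c" using t by simp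
      also have "t * c \<le> t * (c + 1)" using t by simp
      also have "\<dots> \<le> (P - 1) / (c + 1) * (c + 1)" using c0 by (intro mult_right_mono) (auto simp: t_def)
      also have "\<dots> = P - 1" using c0 by simp
      finally show False using P1 by simp
    qed
    ultimately show ?thesis using \<rho> E by (auto simp: P_def)
  qed
  then show ?thesis unfolding equilibrium_def by blast
qed

end

section \<open>Duality between measures and covers\<close>

context uniform_hypergraph
begin

lemma eqm_equilibrium: "\<forall>x\<in>X. 0 < m x \<Longrightarrow> equilibrium G m (eqm G m)"
  unfolding eqm_def using equilibrium_exists by (rule someI_ex)

lemma eqm_nonneg: "\<forall>x\<in>X. 0 < m x \<Longrightarrow> E \<in> G \<Longrightarrow> 0 \<le> eqm G m E"
  using eqm_equilibrium by (auto simp: equilibrium_def)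

lemma eqm_potential: "\<forall>x\<in>X. 0 < m x \<Longrightarrow> E \<in> G \<Longrightarrow> eqm G m E * potential G m (eqm G m) E = eqm G m E"
  using eqm_equilibrium[of m] unfolding equilibrium_def by (cases "eqm G m E = 0") force+

lemma energy_eqm:
  assumes m: "\<forall>x\<in>X. 0 < m x"
  shows "energy X G m (eqm G m) = capacity G m"
proof -
  have "energy X G m (eqm G m) = (\<Sum>L\<in>nesub X. d_nu G (eqm G m) L / wt m L * d_nu G (eqm G m) L)"
    by (simp add: energy_def power2_eq_square)
  also have "\<dots> = (\<Sum>E\<in>G. eqm G m E * potential G m (eqm G m) E)"
    unfolding potential_def sum_edges_nesub ..
  also have "\<dots> = capacity G m"
    unfolding capacity_def e_nu_def using eqm_potential[OF m] by (intro sum.cong) auto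
  finally show ?thesis .
qed

lemma capacity_nonneg: "\<forall>x\<in>X. 0 < m x \<Longrightarrow> 0 \<le> capacity G m"
  unfolding capacity_def using eqm_nonneg by (intro e_nonneg)

text \<open>Weak duality: count the mass through the cover, then apply Cauchy-Schwarz with the
  weights \<open>wt m L\<close>. For the equilibrium measure and any cover this bounds the capacity
  from above; for the equilibrium potential as cover and any measure it bounds the capacity from
  below.\<close>

lemma sum_cover_le:
  assumes m: "\<forall>x\<in>X. 0 < m x" and nn: "\<And>E. E \<in> G \<Longrightarrow> 0 \<le> \<sigma> E"
    and W: "\<And>E. E \<in> G \<Longrightarrow> 1 \<le> (\<Sum>L\<in>nesub E. W L)"
  shows "(e_nu G \<sigma>)\<^sup>2 \<le> (\<Sum>L\<in>nesub X. (W L)\<^sup>2 * wt m L) * energy X G m \<sigma>"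
proof -
  have "e_nu G \<sigma> \<le> (\<Sum>E\<in>G. \<sigma> E * (\<Sum>L\<in>nesub E. W L))"
    unfolding e_nu_def using mult_left_mono[OF W nn] by (intro sum_mono) auto
  also have "\<dots> = (\<Sum>L\<in>nesub X. W L * d_nu G \<sigma> L)" by (rule sum_edges_nesub)
  also have "\<dots> = (\<Sum>L\<in>nesub X. (W L * sqrt (wt m L)) * (d_nu G \<sigma> L / sqrt (wt m L)))"
    using wt_pos[OF m] by (intro sum.cong refl) (auto simp: nesub_def less_imp_neq[symmetric])
  finally have "(e_nu G \<sigma>)\<^sup>2 \<le> (\<Sum>L\<in>nesub X. (W L * sqrt (wt m L)) * (d_nu G \<sigma> L / sqrt (wt m L)))\<^sup>2"
    using e_nonneg[OF nn] by (intro power_mono) auto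
  also have "\<dots> \<le> (\<Sum>L\<in>nesub X. (W L * sqrt (wt m L))\<^sup>2) * (\<Sum>L\<in>nesub X. (d_nu G \<sigma> L / sqrt (wt m L))\<^sup>2)"
    by (rule Cauchy_Schwarz_ineq_sum)
  also have "(\<Sum>L\<in>nesub X. (W L * sqrt (wt m L))\<^sup>2) = (\<Sum>L\<in>nesub X. (W L)\<^sup>2 * wt m L)"
    using wt_pos[OF m] by (intro sum.cong refl) (auto simp: nesub_def power_mult_distrib less_imp_le)
  also have "(\<Sum>L\<in>nesub X. (d_nu G \<sigma> L / sqrt (wt m L))\<^sup>2) = energy X G m \<sigma>"
    unfolding energy_def
    using wt_pos[OF m] by (intro sum.cong refl) (auto simp: nesub_def power_divide less_imp_le)
  finally show ?thesis .
qed

lemma capacity_le_cover: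
  assumes m: "\<forall>x\<in>X. 0 < m x" and W: "\<And>E. E \<in> G \<Longrightarrow> 1 \<le> (\<Sum>L\<in>nesub E. W L)"
  shows "capacity G m \<le> (\<Sum>L\<in>nesub X. (W L)\<^sup>2 * wt m L)" (is "_ \<le> ?C")
proof -
  have "(capacity G m)\<^sup>2 \<le> ?C * capacity G m"
    using sum_cover_le[where \<sigma> = "eqm G m", OF m eqm_nonneg[OF m] W] unfolding energy_eqm[OF m]
    by (simp add: capacity_def)
  moreover have "0 \<le> ?C"
    using wt_pos[OF m] by (intro sum_nonneg mult_nonneg_nonneg) (auto simp: nesub_def less_imp_le)
  ultimately show ?thesis
    using capacity_nonneg[OF m] by (cases "capacity G m = 0") (auto simp: power2_eq_square)
qed

lemma capacity_ge_ratio: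
  assumes m: "\<forall>x\<in>X. 0 < m x" and nn: "\<And>E. E \<in> G \<Longrightarrow> 0 \<le> \<sigma> E"
  shows "(e_nu G \<sigma>)\<^sup>2 \<le> capacity G m * energy X G m \<sigma>"
proof -
  define W where "W L = d_nu G (eqm G m) L / wt m L" for L
  have "1 \<le> (\<Sum>L\<in>nesub E. W L)" if "E \<in> G" for E
    using eqm_equilibrium[OF m] that by (auto simp: equilibrium_def potential_def W_def)
  from sum_cover_le[OF m nn this]
  have "(e_nu G \<sigma>)\<^sup>2 \<le> (\<Sum>L\<in>nesub X. (W L)\<^sup>2 * wt m L) * energy X G m \<sigma>" .
  also have "(\<Sum>L\<in>nesub X. (W L)\<^sup>2 * wt m L) = energy X G m (eqm G m)"
    unfolding energy_def W_def
    using wt_pos[OF m] by (intro sum.cong refl) (auto simp: nesub_def power2_eq_square less_imp_neq[symmetric])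
  finally show ?thesis by (simp add: energy_eqm[OF m])
qed

lemma capacity_ge:
  assumes m: "\<forall>x\<in>X. 0 < m x" and nn: "\<And>E. E \<in> G \<Longrightarrow> 0 \<le> \<sigma> E"
  shows "2 * e_nu G \<sigma> - energy X G m \<sigma> \<le> capacity G m"
proof -
  have "4 * (capacity G m * energy X G m \<sigma>) \<le> (capacity G m + energy X G m \<sigma>)\<^sup>2"
    using sum_squares_ge_zero[of "capacity G m - energy X G m \<sigma>" 0]
    by (simp add: power2_eq_square algebra_simps)
  then have "(2 * e_nu G \<sigma>)\<^sup>2 \<le> (capacity G m + energy X G m \<sigma>)\<^sup>2"
    using capacity_ge_ratio[OF m, of \<sigma>] nn by (simp add: power_mult_distrib)
  then have "2 * e_nu G \<sigma> \<le> capacity G m + energy X G m \<sigma>"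
    by (rule power2_le_imp_le) (use capacity_nonneg[OF m] energy_nonneg[OF m, of \<sigma>] in auto)
  then show ?thesis by simp
qed

lemma capacity_mono:
  assumes m: "\<forall>x\<in>X. 0 < m x" and le: "\<forall>x\<in>X. m x \<le> m' x"
  shows "capacity G m \<le> capacity G m'"
proof -
  have m': "\<forall>x\<in>X. 0 < m' x" using m le by force
  have "energy X G m' (eqm G m) \<le> energy X G m (eqm G m)"
    unfolding energy_def
  proof (rule sum_mono)
    fix L assume L: "L \<in> nesub X"
    have "wt m L \<le> wt m' L"
      unfolding wt_def using m le L by (intro prod_mono) (auto simp: nesub_def less_imp_le)
    then show "(d_nu G (eqm G m) L)\<^sup>2 / wt m' L \<le> (d_nu G (eqm G m) L)\<^sup>2 / wt m L"
      using wt_pos[OF m, of L] L by (intro divide_left_mono) (auto simp: nesub_def intro!: mult_pos_pos)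
  qed
  then show ?thesis
    using capacity_ge[OF m', of "eqm G m"] eqm_nonneg[OF m] energy_eqm[OF m] by (simp add: capacity_def)
qed

lemma capacity_le_sum: "\<forall>x\<in>X. 0 < m x \<Longrightarrow> capacity G m \<le> (\<Sum>x\<in>X. m x)"
  using degree_energy_bound[of m "eqm G m"] eqm_nonneg[of m] energy_eqm[of m] capacity_nonneg[of m]
  by (cases "capacity G m = 0") (auto simp: capacity_def[symmetric] power2_eq_square sum_nonneg less_imp_le)

section \<open>Changes of the capacity under changes of the weights\<close>

lemma influence_nonneg: "\<forall>x\<in>X. 0 < m x \<Longrightarrow> x \<in> X \<Longrightarrow> 0 \<le> influence X G m x"
  unfolding influence_def using wt_pos[of m]
  by (intro divide_nonneg_nonneg sum_nonneg) (auto simp: nesub_def less_imp_le)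

text \<open>Complementary slackness, summed over the edges through \<open>x\<close>. It evaluates
  the cross term in \<open>capacity_gain\<close>.\<close>

lemma degree_identity:
  assumes m: "\<forall>x\<in>X. 0 < m x" and x: "x \<in> X"
  shows "(\<Sum>L\<in>nesub X. d_nu G (eqm G m) L / wt m L * d_nu G (eqm G m) (insert x L)) = d_nu G (eqm G m) {x}"
proof -
  have "(\<Sum>L\<in>nesub X. d_nu G (eqm G m) L / wt m L * d_nu G (eqm G m) (insert x L))
    = (\<Sum>E\<in>{E\<in>G. x \<in> E}. eqm G m E * potential G m (eqm G m) E)"
    unfolding potential_def by (rule sum_edges_nesub_at[OF x, symmetric])
  also have "\<dots> = d_nu G (eqm G m) {x}"
    unfolding d_nu_def using eqm_potential[OF m] by (intro sum.cong) auto
  finally show ?thesis .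
qed

lemma influence_times:
  assumes m: "\<forall>x\<in>X. 0 < m x" and x: "x \<in> X"
  shows "influence X G m x * m x = (\<Sum>L\<in>{L \<in> nesub X. x \<in> L}. (d_nu G (eqm G m) L)\<^sup>2 / wt m L)"
  using bspec[OF m x] by (simp add: influence_def)

text \<open>The terms of \<open>degree_identity\<close> with \<open>x\<close> in \<open>L\<close>
  bound \<open>influence * m x\<close> by the degree of \<open>x\<close>. An edge through
  \<open>x\<close> with positive mass has potential 1, and the singleton already contributes the
  degree divided by \<open>m x\<close> to it.\<close>

lemma influence_le_1:
  assumes m: "\<forall>x\<in>X. 0 < m x" and x: "x \<in> X"
  shows "influence X G m x \<le> 1"
proof -
  define \<rho> where "\<rho> = eqm G m"
  have nn: "\<And>L. 0 \<le> d_nu G \<rho> L" using d_nonneg eqm_nonneg[OF m] by (simp add: \<rho>_def)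
  have "influence X G m x * m x = (\<Sum>L\<in>{L \<in> nesub X. x \<in> L}. d_nu G \<rho> L / wt m L * d_nu G \<rho> (insert x L))"
    unfolding influence_times[OF m x] \<rho>_def
    by (intro sum.cong) (auto simp: power2_eq_square insert_absorb)
  also have "\<dots> \<le> (\<Sum>L\<in>nesub X. d_nu G \<rho> L / wt m L * d_nu G \<rho> (insert x L))"
    using wt_pos[OF m] nn
    by (intro sum_mono2 fin_nesub mult_nonneg_nonneg divide_nonneg_nonneg) (auto simp: nesub_def less_imp_le)
  also have "\<dots> = d_nu G \<rho> {x}" unfolding \<rho>_def by (rule degree_identity[OF m x])
  also have "\<dots> \<le> m x"
  proof (cases "d_nu G \<rho> {x} = 0")
    case True then show ?thesis using m x by (simp add: less_imp_le)
  next
    case False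
    then obtain E where E: "E \<in> G" "x \<in> E" "\<rho> E \<noteq> 0"
      unfolding d_nu_def by (metis (mono_tags, lifting) insert_subset mem_Collect_eq sum.not_neutral_contains_not_neutral)
    then have "0 < \<rho> E" using eqm_nonneg[OF m E(1)] by (simp add: \<rho>_def)
    then have "potential G m \<rho> E = 1"
      using eqm_equilibrium[OF m] E by (auto simp: equilibrium_def \<rho>_def)
    moreover have "d_nu G \<rho> {x} / wt m {x} \<le> potential G m \<rho> E"
      unfolding potential_def
      using E edgeD[OF E(1)] wt_pos[OF m] nn
      by (intro member_le_sum[of "{x}" "nesub E" "\<lambda>L. d_nu G \<rho> L / wt m L"])
        (auto simp: nesub_def intro!: divide_nonneg_nonneg less_imp_le[OF wt_pos[OF m]])
    ultimately show ?thesis using m x by (simp add: wt_def)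
  qed
  finally show ?thesis using m x by auto
qed

text \<open>The test measure multiplies the mass of each edge through \<open>x\<close> by
  \<open>1 + c / m x\<close>, the factor by which the weight of \<open>x\<close> grows. The linear
  gain is \<open>c\<close> times the influence. The quadratic loss comes from sets avoiding
  \<open>x\<close>; charging each such \<open>L\<close> to \<open>insert x L\<close> bounds it by
  \<open>c^2\<close> times the influence.\<close>

lemma capacity_gain:
  assumes m: "\<forall>x\<in>X. 0 < m x" and x: "x \<in> X" and c: "0 \<le> c"
  shows "capacity G m + c * (1 - c) * influence X G m x \<le> capacity G (m(x := m x + c))"
proof -
  define \<rho> where "\<rho> = eqm G m"
  define k where "k = c / m x"
  define m' where "m' = m(x := m x + c)"
  define \<sigma> where "\<sigma> E = \<rho> E * (1 + (if x \<in> E then k else 0))" for E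
  define \<phi> where "\<phi> = influence X G m x * m x"
  have mx: "0 < m x" using m x by auto
  have k0: "0 \<le> k" using c mx by (simp add: k_def)
  have m': "\<forall>y\<in>X. 0 < m' y" using m c by (auto simp: m'_def intro: add_pos_nonneg)
  have \<sigma>0: "0 \<le> \<sigma> E" if "E \<in> G" for E
    using eqm_nonneg[OF m that] k0 by (simp add: \<sigma>_def \<rho>_def)
  have d\<sigma>: "d_nu G \<sigma> L = d_nu G \<rho> L + k * d_nu G \<rho> (insert x L)" for L
    unfolding d_if by (auto simp: \<sigma>_def sum_distrib_left sum.distrib[symmetric] algebra_simps intro!: sum.cong)
  have e\<sigma>: "e_nu G \<sigma> = capacity G m + k * d_nu G \<rho> {x}"
    using d\<sigma>[of "{}"] by (simp add: capacity_def e_nu_def d_nu_def \<rho>_def)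
  have wt': "wt m' L = (if x \<in> L then (1 + k) * wt m L else wt m L)" if L: "L \<in> nesub X" for L
  proof (cases "x \<in> L")
    case True
    have fin: "finite L" using L finX by (auto simp: nesub_def intro: finite_subset)
    have "wt m' L = m' x * wt m' (L - {x})" "wt m L = m x * wt m (L - {x})"
      unfolding wt_def using True fin by (auto simp: prod.remove)
    moreover have "wt m' (L - {x}) = wt m (L - {x})"
      unfolding wt_def by (intro prod.cong) (auto simp: m'_def)
    moreover have "m' x = (1 + k) * m x" using mx by (simp add: m'_def k_def field_simps)
    ultimately show ?thesis using True by simp
  next
    case False
    then show ?thesis unfolding wt_def by (auto simp: m'_def intro!: prod.cong)
  qed
  let ?A = "{L \<in> nesub X. x \<in> L}" and ?B = "{L \<in> nesub X. x \<notin> L}"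
  have split: "(\<Sum>L\<in>nesub X. h L) = (\<Sum>L\<in>?A. h L) + (\<Sum>L\<in>?B. h L)" for h :: "'a set \<Rightarrow> real"
    using fin_nesub by (subst sum.union_disjoint[symmetric]) (auto intro!: sum.cong)
  have \<phi>: "(\<Sum>L\<in>?A. (d_nu G \<rho> L)\<^sup>2 / wt m L) = \<phi>"
    unfolding \<phi>_def \<rho>_def influence_times[OF m x] ..
  have SB: "(\<Sum>L\<in>?B. (d_nu G \<rho> L)\<^sup>2 / wt m L) = capacity G m - \<phi>"
    using energy_eqm[OF m] \<phi> split[of "\<lambda>L. (d_nu G \<rho> L)\<^sup>2 / wt m L"] by (simp add: energy_def \<rho>_def)
  have cross: "(\<Sum>L\<in>?B. d_nu G \<rho> L * d_nu G \<rho> (insert x L) / wt m L) = d_nu G \<rho> {x} - \<phi>"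
  proof -
    have "(\<Sum>L\<in>?A. d_nu G \<rho> L * d_nu G \<rho> (insert x L) / wt m L) = \<phi>"
      unfolding \<phi>[symmetric] by (intro sum.cong) (auto simp: power2_eq_square insert_absorb)
    then show ?thesis
      using degree_identity[OF m x] split[of "\<lambda>L. d_nu G \<rho> L * d_nu G \<rho> (insert x L) / wt m L"]
      by (simp add: \<rho>_def)
  qed
  have sq: "(\<Sum>L\<in>?B. (d_nu G \<rho> (insert x L))\<^sup>2 / wt m L) \<le> m x * \<phi>"
  proof -
    have "(\<Sum>L\<in>?B. (d_nu G \<rho> (insert x L))\<^sup>2 / wt m L)
        = (\<Sum>L\<in>?B. m x * ((d_nu G \<rho> (insert x L))\<^sup>2 / wt m (insert x L)))"
    proof (intro sum.cong refl)
      fix L assume "L \<in> ?B"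
      then have "finite L" "x \<notin> L" using finX by (auto simp: nesub_def intro: finite_subset)
      then show "(d_nu G \<rho> (insert x L))\<^sup>2 / wt m L = m x * ((d_nu G \<rho> (insert x L))\<^sup>2 / wt m (insert x L))"
        using mx by (simp add: wt_def)
    qed
    also have "\<dots> = (\<Sum>L\<in>insert x ` ?B. m x * ((d_nu G \<rho> L)\<^sup>2 / wt m L))"
      by (subst sum.reindex) (auto simp: inj_on_def)
    also have "\<dots> \<le> (\<Sum>L\<in>?A. m x * ((d_nu G \<rho> L)\<^sup>2 / wt m L))"
      using fin_nesub x mx wt_pos[OF m]
      by (intro sum_mono2 mult_nonneg_nonneg divide_nonneg_nonneg) (auto simp: nesub_def less_imp_le)
    also have "\<dots> = m x * \<phi>" by (simp add: \<phi>[symmetric] sum_distrib_left)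
    finally show ?thesis .
  qed
  have "energy X G m' \<sigma> = (\<Sum>L\<in>?A. (1 + k) * ((d_nu G \<rho> L)\<^sup>2 / wt m L))
      + (\<Sum>L\<in>?B. (d_nu G \<rho> L)\<^sup>2 / wt m L + 2 * k * (d_nu G \<rho> L * d_nu G \<rho> (insert x L) / wt m L)
          + k\<^sup>2 * ((d_nu G \<rho> (insert x L))\<^sup>2 / wt m L))"
    unfolding energy_def split[of "\<lambda>L. (d_nu G \<sigma> L)\<^sup>2 / wt m' L"]
  proof (intro arg_cong2[where f="(+)"] sum.cong refl)
    fix L assume L: "L \<in> ?A"
    have "(d_nu G \<rho> L + k * d_nu G \<rho> L)\<^sup>2 = (1 + k) * ((1 + k) * (d_nu G \<rho> L)\<^sup>2)"
      by (simp add: power2_eq_square algebra_simps)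
    then show "(d_nu G \<sigma> L)\<^sup>2 / wt m' L = (1 + k) * ((d_nu G \<rho> L)\<^sup>2 / wt m L)"
      using L k0 by (simp add: d\<sigma> wt' insert_absorb)
  next
    fix L assume L: "L \<in> ?B"
    then show "(d_nu G \<sigma> L)\<^sup>2 / wt m' L = (d_nu G \<rho> L)\<^sup>2 / wt m L + 2 * k * (d_nu G \<rho> L * d_nu G \<rho> (insert x L) / wt m L)
          + k\<^sup>2 * ((d_nu G \<rho> (insert x L))\<^sup>2 / wt m L)"
      by (simp add: d\<sigma> wt' power2_eq_square algebra_simps add_divide_distrib)
  qed
  also have "\<dots> = (1 + k) * \<phi> + (capacity G m - \<phi>) + 2 * k * (d_nu G \<rho> {x} - \<phi>)
      + k\<^sup>2 * (\<Sum>L\<in>?B. (d_nu G \<rho> (insert x L))\<^sup>2 / wt m L)"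
    by (simp only: sum.distrib sum_distrib_left[symmetric] \<phi> SB cross)
  also have "\<dots> \<le> (1 + k) * \<phi> + (capacity G m - \<phi>) + 2 * k * (d_nu G \<rho> {x} - \<phi>) + k\<^sup>2 * (m x * \<phi>)"
    using sq by (intro add_left_mono mult_left_mono) auto
  finally have "2 * e_nu G \<sigma> - energy X G m' \<sigma> \<ge> capacity G m + k * \<phi> - k\<^sup>2 * (m x * \<phi>)"
    unfolding e\<sigma> by (simp add: algebra_simps)
  moreover have "k * \<phi> - k\<^sup>2 * (m x * \<phi>) = c * (1 - c) * influence X G m x"
    using mx by (simp add: k_def \<phi>_def power2_eq_square field_simps)
  ultimately show ?thesis
    using capacity_ge[where \<sigma> = \<sigma>, OF m' \<sigma>0] unfolding m'_def by linarith
qed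

lemma prod_one_plus_le:
  fixes k :: "'b \<Rightarrow> real"
  assumes "finite L" "\<forall>x\<in>L. 0 \<le> k x \<and> k x \<le> e" "card L \<le> Suc n" "0 \<le> e"
  shows "(\<Prod>x\<in>L. 1 + k x) \<le> 1 + (1 + e) ^ n * (\<Sum>x\<in>L. k x)"
  using assms
proof (induction L rule: finite_induct)
  case (insert y L)
  have "(\<Prod>x\<in>L. 1 + k x) \<le> (\<Prod>x\<in>L. 1 + e)"
    using insert.prems by (intro prod_mono) auto
  also have "\<dots> = (1 + e) ^ card L" by simp
  also have "\<dots> \<le> (1 + e) ^ n" using insert.prems insert.hyps by (intro power_increasing) auto
  finally have *: "(\<Prod>x\<in>L. 1 + k x) \<le> (1 + e) ^ n" .
  have "(\<Prod>x\<in>insert y L. 1 + k x) = (\<Prod>x\<in>L. 1 + k x) + k y * (\<Prod>x\<in>L. 1 + k x)"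
    using insert.hyps by (simp add: algebra_simps)
  also have "\<dots> \<le> (1 + (1 + e) ^ n * (\<Sum>x\<in>L. k x)) + k y * (1 + e) ^ n"
    using insert * by (intro add_mono mult_left_mono) auto
  also have "\<dots> = 1 + (1 + e) ^ n * (\<Sum>x\<in>insert y L. k x)"
    using insert.hyps by (simp add: algebra_simps)
  finally show ?case .
qed simp

text \<open>The equilibrium potential for the smaller weights is still a cover for the larger ones.
  Only sets with at most \<open>s\<close> elements have nonzero degree, so linearising the product
  of the weight ratios costs at most \<open>(1 + e) ^ (s - 1)\<close>.\<close>

lemma capacity_decrease:
  assumes m: "\<forall>x\<in>X. 0 < m x" and le: "\<forall>x\<in>X. m x \<le> m' x \<and> m' x \<le> (1 + e) * m x" and e: "0 \<le> e"
  shows "capacity G m' \<le> capacity G m + (1 + e) ^ (s - 1) * (\<Sum>x\<in>X. (m' x - m x) * influence X G m x)"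
proof -
  define d where "d = d_nu G (eqm G m)"
  define k where "k x = (m' x - m x) / m x" for x
  have m': "\<forall>x\<in>X. 0 < m' x" using m le by force
  have k: "0 \<le> k x \<and> k x \<le> e" if "x \<in> X" for x
    using that m le by (auto simp: k_def field_simps)
  have "capacity G m' \<le> (\<Sum>L\<in>nesub X. (d L / wt m L)\<^sup>2 * wt m' L)"
    using eqm_equilibrium[OF m] by (intro capacity_le_cover[OF m']) (auto simp: equilibrium_def potential_def d_def)
  also have "\<dots> \<le> (\<Sum>L\<in>nesub X. (d L)\<^sup>2 / wt m L + (1 + e) ^ (s - 1) * (\<Sum>x\<in>L. k x * ((d L)\<^sup>2 / wt m L)))"
  proof (rule sum_mono)
    fix L assume "L \<in> nesub X"
    then have L: "L \<subseteq> X" "finite L" using finX by (auto simp: nesub_def intro: finite_subset)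
    have w: "0 < wt m L" using wt_pos[OF m L(1)] .
    show "(d L / wt m L)\<^sup>2 * wt m' L \<le> (d L)\<^sup>2 / wt m L + (1 + e) ^ (s - 1) * (\<Sum>x\<in>L. k x * ((d L)\<^sup>2 / wt m L))"
    proof (cases "d L = 0")
      case False
      then obtain E where "E \<in> G" "L \<subseteq> E"
        unfolding d_def d_nu_def by (metis (mono_tags, lifting) mem_Collect_eq sum.not_neutral_contains_not_neutral)
      then have "card L \<le> s" using edgeD[of E] by (metis card_mono)
      then have "(\<Prod>x\<in>L. 1 + k x) \<le> 1 + (1 + e) ^ (s - 1) * (\<Sum>x\<in>L. k x)"
        using k L e s_pos by (intro prod_one_plus_le) auto
      moreover have "wt m' L = wt m L * (\<Prod>x\<in>L. 1 + k x)"
        unfolding wt_def prod.distrib[symmetric]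
      proof (rule prod.cong[OF refl])
        fix x assume "x \<in> L"
        then have "m x \<noteq> 0" using m L by force
        then show "m' x = m x * (1 + k x)" by (simp add: k_def distrib_left)
      qed
      moreover have "(d L / wt m L)\<^sup>2 * wt m' L = (d L)\<^sup>2 / wt m L * (wt m' L / wt m L)"
        using w by (simp add: power2_eq_square field_simps)
      ultimately have "(d L / wt m L)\<^sup>2 * wt m' L \<le> (d L)\<^sup>2 / wt m L * (1 + (1 + e) ^ (s - 1) * (\<Sum>x\<in>L. k x))"
        using w by (auto intro!: divide_right_mono mult_left_mono)
      also have "\<dots> = (d L)\<^sup>2 / wt m L + (1 + e) ^ (s - 1) * (\<Sum>x\<in>L. k x * ((d L)\<^sup>2 / wt m L))"
        by (simp add: algebra_simps sum_distrib_left sum_distrib_right sum_divide_distrib)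
      finally show ?thesis .
    qed simp
  qed
  also have "\<dots> = capacity G m + (1 + e) ^ (s - 1) * (\<Sum>L\<in>nesub X. \<Sum>x\<in>L. k x * ((d L)\<^sup>2 / wt m L))"
    using energy_eqm[OF m] by (simp add: sum.distrib energy_def d_def sum_distrib_left)
  also have "(\<Sum>L\<in>nesub X. \<Sum>x\<in>L. k x * ((d L)\<^sup>2 / wt m L))
      = (\<Sum>L\<in>nesub X. \<Sum>x\<in>{x\<in>X. x \<in> L}. k x * ((d L)\<^sup>2 / wt m L))"
    by (intro sum.cong refl) (auto simp: nesub_def)
  also have "\<dots> = (\<Sum>x\<in>X. \<Sum>L\<in>{L\<in>nesub X. x \<in> L}. k x * ((d L)\<^sup>2 / wt m L))"
    by (simp only: sum.inter_filter[OF finX] sum.inter_filter[OF fin_nesub]) (rule sum.swap)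
  also have "\<dots> = (\<Sum>x\<in>X. (m' x - m x) * influence X G m x)"
    unfolding sum_distrib_left[symmetric] by (intro sum.cong refl) (simp add: influence_def d_def k_def)
  finally show ?thesis .
qed

text \<open>Expand the product on the right: the left side consists of exactly the terms in which at
  most one vertex receives its increment.\<close>

lemma wt_average_le:
  assumes A: "finite A" and \<pi>: "\<forall>x\<in>A. 0 \<le> \<pi> x" "(\<Sum>x\<in>A. \<pi> x) = 1"
    and L: "finite L" and g: "\<forall>y\<in>L. 0 \<le> g y" and c: "0 \<le> c"
  shows "(\<Sum>x\<in>A. \<pi> x * wt (g(x := g x + c)) L) \<le> wt (\<lambda>y. g y + (if y \<in> A then c * \<pi> y else 0)) L"
  using L g
proof (induction L rule: finite_induct)
  case empty
  then show ?case using \<pi> by (simp add: wt_def)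
next
  case (insert z L)
  let ?h = "\<lambda>y. g y + (if y \<in> A then c * \<pi> y else 0)"
  have gz: "0 \<le> g z" using insert.prems by auto
  have hnn: "0 \<le> ?h y" if "y \<in> L" for y using insert.prems that c \<pi> by auto
  have wz: "wt (g(z := g z + c)) L = wt g L"
    unfolding wt_def using insert.hyps by (intro prod.cong) auto
  have wle: "wt g L \<le> wt ?h L"
    unfolding wt_def using insert.prems c \<pi> by (intro prod_mono) auto
  have "(\<Sum>x\<in>A. \<pi> x * wt (g(x := g x + c)) (insert z L))
     = (\<Sum>x\<in>A. g z * (\<pi> x * wt (g(x := g x + c)) L) + (if x = z then c * \<pi> z * wt g L else 0))"
    using insert.hyps wz by (intro sum.cong refl) (auto simp: wt_def algebra_simps)
  also have "\<dots> = g z * (\<Sum>x\<in>A. \<pi> x * wt (g(x := g x + c)) L) + (if z \<in> A then c * \<pi> z * wt g L else 0)"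
    using A by (simp add: sum.distrib sum_distrib_left)
  also have "\<dots> \<le> g z * wt ?h L + (if z \<in> A then c * \<pi> z * wt ?h L else 0)"
  proof (intro add_mono mult_left_mono gz)
    show "(\<Sum>x\<in>A. \<pi> x * wt (g(x := g x + c)) L) \<le> wt ?h L"
      by (rule insert.IH) (use insert.prems in auto)
    show "(if z \<in> A then c * \<pi> z * wt g L else 0) \<le> (if z \<in> A then c * \<pi> z * wt ?h L else 0)"
      using wle c \<pi> by (auto intro!: mult_left_mono)
  qed
  also have "\<dots> = wt ?h (insert z L)"
    using insert.hyps by (simp add: wt_def algebra_simps)
  finally show ?case .
qed

text \<open>Average the equilibrium measures. Since d^2 / w is jointly convex, the energy of the
  average is at most the average energy once the weights are averaged too, and
  \<open>wt_average_le\<close> compares these with the spread increment. A random boost of one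
  vertex thus becomes a fixed small boost of all candidates.\<close>

lemma capacity_average:
  assumes g: "\<forall>x\<in>X. 0 < g x" and A: "A \<subseteq> X" and \<pi>: "\<forall>x\<in>A. 0 \<le> \<pi> x" "(\<Sum>x\<in>A. \<pi> x) = 1" and c: "0 \<le> c"
  shows "(\<Sum>x\<in>A. \<pi> x * capacity G (g(x := g x + c))) \<le> capacity G (\<lambda>y. g y + (if y \<in> A then c * \<pi> y else 0))"
proof -
  have finA: "finite A" using A finX finite_subset by blast
  let ?g = "\<lambda>x. g(x := g x + c)"
  let ?h = "\<lambda>y. g y + (if y \<in> A then c * \<pi> y else 0)"
  have gx: "\<forall>y\<in>X. 0 < ?g x y" for x using g c by (auto intro: add_pos_nonneg)
  have h: "\<forall>y\<in>X. 0 < ?h y" using g c \<pi> by (auto intro: add_pos_nonneg)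
  define \<rho> where "\<rho> x = eqm G (?g x)" for x
  define \<sigma> where "\<sigma> E = (\<Sum>x\<in>A. \<pi> x * \<rho> x E)" for E
  have \<rho>0: "0 \<le> \<rho> x E" if "E \<in> G" for x E unfolding \<rho>_def by (rule eqm_nonneg[OF gx that])
  have \<sigma>0: "0 \<le> \<sigma> E" if "E \<in> G" for E
    unfolding \<sigma>_def using \<rho>0[OF that] \<pi> by (intro sum_nonneg mult_nonneg_nonneg) auto
  have e\<sigma>: "e_nu G \<sigma> = (\<Sum>x\<in>A. \<pi> x * capacity G (?g x))"
    unfolding e_nu_def \<sigma>_def capacity_def \<rho>_def sum_distrib_left by (rule sum.swap)
  have d\<sigma>: "d_nu G \<sigma> L = (\<Sum>x\<in>A. \<pi> x * d_nu G (\<rho> x) L)" for L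
    unfolding d_nu_def \<sigma>_def sum_distrib_left by (rule sum.swap)
  have "energy X G ?h \<sigma> \<le> (\<Sum>L\<in>nesub X. \<Sum>x\<in>A. \<pi> x * ((d_nu G (\<rho> x) L)\<^sup>2 / wt (?g x) L))"
    unfolding energy_def
  proof (rule sum_mono)
    fix L assume "L \<in> nesub X"
    then have L: "L \<subseteq> X" "finite L" using finX by (auto simp: nesub_def intro: finite_subset)
    let ?w = "\<lambda>x. wt (?g x) L"
    have w: "0 < ?w x" for x using wt_pos[OF gx L(1)] .
    have wh: "0 < wt ?h L" using wt_pos[OF h L(1)] .
    let ?S = "\<Sum>x\<in>A. \<pi> x * ((d_nu G (\<rho> x) L)\<^sup>2 / ?w x)"
    have S0: "0 \<le> ?S" using \<pi> w by (intro sum_nonneg mult_nonneg_nonneg) (auto simp: less_imp_le)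
    have "(d_nu G \<sigma> L)\<^sup>2 = (\<Sum>x\<in>A. (sqrt (\<pi> x) * sqrt (?w x)) * (sqrt (\<pi> x) * d_nu G (\<rho> x) L / sqrt (?w x)))\<^sup>2"
      unfolding d\<sigma> using \<pi> w by (intro arg_cong[where f="\<lambda>z. z\<^sup>2"] sum.cong refl)
        (auto simp: less_imp_neq[symmetric] mult.assoc[symmetric])
    also have "\<dots> \<le> (\<Sum>x\<in>A. (sqrt (\<pi> x) * sqrt (?w x))\<^sup>2) * (\<Sum>x\<in>A. (sqrt (\<pi> x) * d_nu G (\<rho> x) L / sqrt (?w x))\<^sup>2)"
      by (rule Cauchy_Schwarz_ineq_sum)
    also have "(\<Sum>x\<in>A. (sqrt (\<pi> x) * sqrt (?w x))\<^sup>2) = (\<Sum>x\<in>A. \<pi> x * ?w x)"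
      using \<pi> w by (intro sum.cong refl) (auto simp: power_mult_distrib less_imp_le)
    also have "(\<Sum>x\<in>A. (sqrt (\<pi> x) * d_nu G (\<rho> x) L / sqrt (?w x))\<^sup>2) = ?S"
      using \<pi> w by (intro sum.cong refl) (auto simp: power_mult_distrib power_divide less_imp_le)
    also have "(\<Sum>x\<in>A. \<pi> x * ?w x) * ?S \<le> wt ?h L * ?S"
      using g L S0 c \<pi> finA by (intro mult_right_mono wt_average_le) (auto simp: less_imp_le)
    finally show "(d_nu G \<sigma> L)\<^sup>2 / wt ?h L \<le> ?S" using wh by (simp add: field_simps)
  qed
  also have "\<dots> = (\<Sum>x\<in>A. \<pi> x * energy X G (?g x) (\<rho> x))"
    unfolding energy_def sum_distrib_left by (rule sum.swap)
  also have "\<dots> = (\<Sum>x\<in>A. \<pi> x * capacity G (?g x))"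
    unfolding \<rho>_def energy_eqm[OF gx] ..
  finally show ?thesis using capacity_ge[where \<sigma> = \<sigma>, OF h \<sigma>0] unfolding e\<sigma> by linarith
qed

end

section \<open>Level sets and hitting families\<close>

lemma finite_arg_min:
  fixes f :: "'a \<Rightarrow> real"
  assumes "finite S" "S \<noteq> {}"
  obtains z where "z \<in> S" "\<forall>x\<in>S. f z \<le> f x"
proof -
  have "Min (f ` S) \<in> f ` S" using assms by (intro Min_in) auto
  then obtain z where "z \<in> S" "f z = Min (f ` S)" by auto
  then show ?thesis using that assms Min_le[of "f ` S"] by force
qed

text \<open>Induction on the number of positive values: each step peels off the bottom layer, whose
  height is the smallest positive value.\<close>

lemma layer_cake:
  fixes g :: "'a \<Rightarrow> real" and \<alpha> \<beta> :: real
  assumes "finite X" "finite A" "\<forall>x\<in>X \<union> A. 0 \<le> g x"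
    and "\<forall>t>0. \<beta> * card {x\<in>X. t \<le> g x} \<le> \<alpha> * card {x\<in>A. t \<le> g x}"
  shows "\<beta> * (\<Sum>x\<in>X. g x) \<le> \<alpha> * (\<Sum>x\<in>A. g x)"
  using assms(3,4)
proof (induction "card {x\<in>X \<union> A. 0 < g x}" arbitrary: g rule: less_induct)
  case less
  let ?S = "{x\<in>X \<union> A. 0 < g x}"
  have finS: "finite ?S" using assms by auto
  show ?case
  proof (cases "?S = {}")
    case True
    then have "g x = 0" if "x \<in> X \<union> A" for x using less.prems(1) that by force
    then show ?thesis by simp
  next
    case False
    define v where "v = Min (g ` ?S)"
    have v: "v \<in> g ` ?S" "\<And>x. x \<in> ?S \<Longrightarrow> v \<le> g x"
      unfolding v_def using finS False by (auto intro!: Min_in Min_le)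
    have v0: "0 < v" using v(1) by auto
    define h where "h x = (if 0 < g x then g x - v else 0)" for x
    have h0: "0 \<le> h x" if "x \<in> X \<union> A" for x using v(2) that by (auto simp: h_def)
    have lev: "{x\<in>B. t \<le> h x} = {x\<in>B. t + v \<le> g x}" if "0 < t" "B \<subseteq> X \<union> A" for t B
      using that v0 by (auto simp: h_def)
    have lev0: "{x\<in>B. v \<le> g x} = {x\<in>B. 0 < g x}" if "B \<subseteq> X \<union> A" for B
      using v(2) v0 that by fastforce
    have sm: "(\<Sum>x\<in>B. g x) = (\<Sum>x\<in>B. h x) + v * card {x\<in>B. v \<le> g x}" if "B \<subseteq> X \<union> A" "finite B" for B
    proof -
      have "(\<Sum>x\<in>B. g x) = (\<Sum>x\<in>B. h x + (if 0 < g x then v else 0))"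
        using that less.prems(1) by (intro sum.cong) (force simp: h_def)+
      also have "\<dots> = (\<Sum>x\<in>B. h x) + v * card {x\<in>B. 0 < g x}"
        using that(2) by (simp add: sum.distrib sum.inter_filter[symmetric])
      finally show ?thesis by (simp add: lev0[OF that(1)])
    qed
    obtain x0 where x0: "x0 \<in> ?S" "g x0 = v" using v(1) by auto
    have "card {x\<in>X \<union> A. 0 < h x} < card ?S"
    proof (rule psubset_card_mono[OF finS])
      have "x0 \<notin> {x\<in>X \<union> A. 0 < h x}" using x0 by (simp add: h_def)
      then show "{x\<in>X \<union> A. 0 < h x} \<subset> ?S" using x0(1) by (auto simp: h_def)
    qed
    then have "\<beta> * (\<Sum>x\<in>X. h x) \<le> \<alpha> * (\<Sum>x\<in>A. h x)"
    proof (rule less.hyps)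
      show "\<forall>x\<in>X \<union> A. 0 \<le> h x" using h0 by blast
      show "\<forall>t>0. \<beta> * card {x\<in>X. t \<le> h x} \<le> \<alpha> * card {x\<in>A. t \<le> h x}"
      proof (intro allI impI)
        fix t :: real assume t: "0 < t"
        then have "0 < t + v" using v0 by simp
        then have "\<beta> * card {x\<in>X. t + v \<le> g x} \<le> \<alpha> * card {x\<in>A. t + v \<le> g x}"
          using less.prems(2) by blast
        then show "\<beta> * card {x\<in>X. t \<le> h x} \<le> \<alpha> * card {x\<in>A. t \<le> h x}"
          using lev[OF t, of X] lev[OF t, of A] by simp
      qed
    qed
    moreover have "\<beta> * card {x\<in>X. v \<le> g x} * v \<le> \<alpha> * card {x\<in>A. v \<le> g x} * v"
      using less.prems(2) v0 by (intro mult_right_mono) auto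
    ultimately show ?thesis
      using assms(1,2) by (simp add: sm algebra_simps)
  qed
qed

lemma top_subset:
  fixes f :: "'a \<Rightarrow> real"
  assumes "finite I" "k \<le> card I"
  obtains A where "A \<subseteq> I" "card A = k" "\<And>t. min k (card {x\<in>I. t \<le> f x}) \<le> card {x\<in>A. t \<le> f x}"
proof -
  have "\<exists>A\<subseteq>I. card A = k \<and> (\<forall>x\<in>A. \<forall>y\<in>I - A. f y \<le> f x)"
    using assms(2)
  proof (induction k)
    case 0 then show ?case by (intro exI[of _ "{}"]) auto
  next
    case (Suc k)
    then obtain A where A: "A \<subseteq> I" "card A = k" "\<forall>x\<in>A. \<forall>y\<in>I - A. f y \<le> f x" by auto
    have finA: "finite A" using A(1) assms(1) finite_subset by blast
    have ne: "I - A \<noteq> {}" using Suc.prems A(2) finA card_mono[OF finA, of I] by auto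
    obtain y where "y \<in> I - A" "\<forall>z\<in>I - A. - f y \<le> - f z"
      using finite_arg_min[of "I - A" "\<lambda>x. - f x"] ne assms(1) by blast
    then have y: "y \<in> I - A" "\<forall>z\<in>I - A. f z \<le> f y" by auto
    show ?case
      using A y finA by (intro exI[of _ "insert y A"]) auto
  qed
  then obtain A where A: "A \<subseteq> I" "card A = k" "\<forall>x\<in>A. \<forall>y\<in>I - A. f y \<le> f x" by auto
  have finA: "finite A" using A(1) assms(1) finite_subset by blast
  have "min k (card {x\<in>I. t \<le> f x}) \<le> card {x\<in>A. t \<le> f x}" for t
  proof (cases "{x\<in>I. t \<le> f x} \<subseteq> A")
    case True
    then have "{x\<in>I. t \<le> f x} = {x\<in>A. t \<le> f x}" using A(1) by auto
    then show ?thesis by simp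
  next
    case False
    then have "{x\<in>A. t \<le> f x} = A" using A(3) by force
    then show ?thesis using A(2) by simp
  qed
  then show ?thesis using that A by blast
qed

text \<open>Density is known only for level sets with at least \<open>m0\<close> elements. Hence
  \<open>f\<close> is truncated at the largest value \<open>t0\<close> having such a level set; at
  most \<open>m0\<close> vertices lie above \<open>t0\<close>, and since \<open>f\<close> is at most
  1 the truncation costs at most \<open>m0\<close>.\<close>

lemma dense_level_sets_sample:
  fixes f :: "'a \<Rightarrow> real" and m0 \<kappa> :: real
  assumes fin: "finite X" and f: "\<forall>x\<in>X. 0 \<le> f x \<and> f x \<le> 1" and m0: "0 < m0" "m0 \<le> card X"
    and I: "I \<subseteq> X" and \<kappa>: "0 < \<kappa>" and k: "\<kappa> * card X \<le> real k" "k \<le> card I"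
    and dense: "\<And>z. z \<in> X \<Longrightarrow> m0 \<le> card {x\<in>X. f z \<le> f x} \<Longrightarrow>
        \<kappa> * card {x\<in>X. f z \<le> f x} \<le> card (I \<inter> {x\<in>X. f z \<le> f x})"
  obtains A where "A \<subseteq> I" "card A = k" "\<kappa> * ((\<Sum>x\<in>X. f x) - m0) \<le> (\<Sum>x\<in>A. f x)"
proof -
  have finI: "finite I" using I fin finite_subset by blast
  obtain A where A: "A \<subseteq> I" "card A = k" "\<And>t. min k (card {x\<in>I. t \<le> f x}) \<le> card {x\<in>A. t \<le> f x}"
    using top_subset[OF finI k(2)] by metis
  have finA: "finite A" using A(1) finI finite_subset by blast
  define Z where "Z = {z\<in>X. m0 \<le> card {x\<in>X. f z \<le> f x}}"
  have Xne: "X \<noteq> {}" using m0 by auto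
  have Zne: "Z \<noteq> {}"
  proof -
    obtain z where z: "z \<in> X" "\<forall>x\<in>X. f z \<le> f x" using finite_arg_min[OF fin Xne] by blast
    then have "{x\<in>X. f z \<le> f x} = X" by auto
    then show ?thesis using z m0 by (auto simp: Z_def)
  qed
  have finZ: "finite Z" using fin by (simp add: Z_def)
  define t0 where "t0 = Max (f ` Z)"
  obtain z0 where z0: "z0 \<in> Z" "f z0 = t0"
    unfolding t0_def using Max_in[of "f ` Z"] Zne finZ by fastforce
  have t0max: "f z \<le> t0" if "z \<in> Z" for z unfolding t0_def using finZ that by auto
  have t00: "0 \<le> t0" using z0 f by (auto simp: Z_def)
  have small: "card {x\<in>X. t0 < f x} \<le> m0"
  proof (rule ccontr)
    let ?P = "{x\<in>X. t0 < f x}"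
    assume big: "\<not> card ?P \<le> m0"
    then have "?P \<noteq> {}" using m0 by (metis card.empty less_imp_le of_nat_0)
    then obtain z where z: "z \<in> ?P" "\<forall>x\<in>?P. f z \<le> f x"
      using finite_arg_min[of ?P f] fin by auto
    then have "{x\<in>X. f z \<le> f x} = ?P" by auto
    then have "z \<in> Z" using z big by (simp add: Z_def)
    then show False using t0max z by force
  qed
  define g where "g x = min (f x) t0" for x
  have g0: "0 \<le> g x" if "x \<in> X" for x using f that t00 by (simp add: g_def)
  have "\<kappa> * (\<Sum>x\<in>X. g x) \<le> 1 * (\<Sum>x\<in>A. g x)"
  proof (rule layer_cake[OF fin finA])
    show "\<forall>x\<in>X \<union> A. 0 \<le> g x" using g0 A(1) I by blast
    show "\<forall>t>0. \<kappa> * card {x\<in>X. t \<le> g x} \<le> 1 * real (card {x\<in>A. t \<le> g x})"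
    proof (intro allI impI)
      fix t :: real assume "0 < t"
      show "\<kappa> * card {x\<in>X. t \<le> g x} \<le> 1 * real (card {x\<in>A. t \<le> g x})"
      proof (cases "t \<le> t0")
        case True
        let ?P = "{x\<in>X. t \<le> f x}"
        have P: "{x\<in>B. t \<le> g x} = {x\<in>B. t \<le> f x}" for B using True by (auto simp: g_def)
        have sub: "{x\<in>X. f z0 \<le> f x} \<subseteq> ?P" using True z0 by auto
        have "z0 \<in> ?P" using z0 True by (auto simp: Z_def)
        then obtain z where z: "z \<in> ?P" "\<forall>x\<in>?P. f z \<le> f x"
          using finite_arg_min[of ?P f] fin by auto
        then have eq: "{x\<in>X. f z \<le> f x} = ?P" by auto
        have "m0 \<le> card {x\<in>X. f z0 \<le> f x}" using z0 by (simp add: Z_def)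
        also have "real (card {x\<in>X. f z0 \<le> f x}) \<le> card ?P" using sub fin by (simp add: card_mono)
        finally have "\<kappa> * card ?P \<le> card (I \<inter> ?P)" using dense[of z] eq z(1) by simp
        also have "I \<inter> ?P = {x\<in>I. t \<le> f x}" using I by auto
        finally have 1: "\<kappa> * card ?P \<le> card {x\<in>I. t \<le> f x}" .
        have "\<kappa> * card ?P \<le> \<kappa> * card X" using \<kappa> fin by (intro mult_left_mono) (auto intro: card_mono)
        then have "\<kappa> * card ?P \<le> real k" using k(1) by linarith
        with 1 have "\<kappa> * card ?P \<le> real (min k (card {x\<in>I. t \<le> f x}))" by simp
        also have "\<dots> \<le> card {x\<in>A. t \<le> f x}" using A(3)[of t] by simp
        finally show ?thesis by (simp add: P)
      next
        case False
        then have "{x\<in>X. t \<le> g x} = {}" by (auto simp: g_def)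
        then have "card {x\<in>X. t \<le> g x} = 0" by (simp only: card.empty)
        then show ?thesis by simp
      qed
    qed
  qed
  also have "1 * (\<Sum>x\<in>A. g x) \<le> (\<Sum>x\<in>A. f x)" by (simp add: g_def sum_mono)
  finally have 1: "\<kappa> * (\<Sum>x\<in>X. g x) \<le> (\<Sum>x\<in>A. f x)" .
  have "(\<Sum>x\<in>X. f x) \<le> (\<Sum>x\<in>X. g x + (if t0 < f x then 1 else 0))"
    using f t00 by (intro sum_mono) (auto simp: g_def min_def)
  also have "\<dots> = (\<Sum>x\<in>X. g x) + card {x\<in>X. t0 < f x}"
    using fin by (simp add: sum.distrib sum.inter_filter[symmetric])
  finally have "(\<Sum>x\<in>X. f x) - m0 \<le> (\<Sum>x\<in>X. g x)" using small by linarith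
  then have "\<kappa> * ((\<Sum>x\<in>X. f x) - m0) \<le> \<kappa> * (\<Sum>x\<in>X. g x)" using \<kappa> by simp
  then show ?thesis using that A 1 by force
qed

text \<open>Greedy choice: by double counting, some \<open>w\<close> hits at least a fraction
  \<delta> of the members that are still unhit.\<close>

lemma hitting_family:
  fixes hit :: "'w \<Rightarrow> 'b \<Rightarrow> bool" and \<delta> :: real
  assumes fin: "finite B" "finite W" and \<delta>: "0 < \<delta>" "\<delta> \<le> 1" and W: "W \<noteq> {}"
    and hit: "\<And>I. I \<in> B \<Longrightarrow> \<delta> * card W \<le> card {w\<in>W. hit w I}"
  obtains W' where "W' \<subseteq> W" "card W' \<le> ln (card B) / \<delta> + 1" "\<And>I. I \<in> B \<Longrightarrow> \<exists>w\<in>W'. hit w I"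
proof (cases "B = {}")
  case True then show ?thesis using that[of "{}"] by simp
next
  case Bne: False
  have step: "\<exists>w\<in>W. card {I\<in>B'. \<not> hit w I} \<le> (1 - \<delta>) * card B'" if B': "B' \<subseteq> B" for B'
  proof (rule ccontr)
    assume neg: "\<not> ?thesis"
    have finB': "finite B'" using B' fin finite_subset by blast
    have "(\<Sum>w\<in>W. (1 - \<delta>) * card B') < (\<Sum>w\<in>W. real (card {I\<in>B'. \<not> hit w I}))"
      using neg fin W by (intro sum_strict_mono) force+
    also have "\<dots> = (\<Sum>w\<in>W. \<Sum>I\<in>B'. if \<not> hit w I then 1 else 0)"
      using finB' by (simp add: sum.inter_filter[symmetric])
    also have "\<dots> = (\<Sum>I\<in>B'. \<Sum>w\<in>W. if \<not> hit w I then 1 else 0)" by (rule sum.swap)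
    also have "\<dots> = (\<Sum>I\<in>B'. real (card {w\<in>W. \<not> hit w I}))"
      using fin by (simp add: sum.inter_filter[symmetric])
    also have "\<dots> \<le> (\<Sum>I\<in>B'. (1 - \<delta>) * card W)"
    proof (rule sum_mono)
      fix I assume "I \<in> B'"
      have "card W = card {w\<in>W. hit w I} + card {w\<in>W. \<not> hit w I}"
        using fin by (subst card_Un_disjoint[symmetric]) (auto intro!: arg_cong[where f=card])
      then show "real (card {w\<in>W. \<not> hit w I}) \<le> (1 - \<delta>) * card W"
        using hit[of I] \<open>I \<in> B'\<close> B' by (auto simp: algebra_simps)
    qed
    finally show False by (simp add: mult.commute mult.left_commute)
  qed
  have it: "\<exists>W'\<subseteq>W. card W' \<le> k \<and> card {I\<in>B. \<forall>w\<in>W'. \<not> hit w I} \<le> (1 - \<delta>) ^ k * card B" for k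
  proof (induction k)
    case 0 then show ?case by (intro exI[of _ "{}"]) auto
  next
    case (Suc k)
    then obtain W' where W': "W' \<subseteq> W" "card W' \<le> k" "card {I\<in>B. \<forall>w\<in>W'. \<not> hit w I} \<le> (1 - \<delta>) ^ k * card B" by auto
    obtain w where w: "w \<in> W" "card {I\<in>{I\<in>B. \<forall>w\<in>W'. \<not> hit w I}. \<not> hit w I} \<le> (1 - \<delta>) * card {I\<in>B. \<forall>w\<in>W'. \<not> hit w I}"
      using step[of "{I\<in>B. \<forall>w\<in>W'. \<not> hit w I}"] by auto
    have "{I\<in>{I\<in>B. \<forall>w\<in>W'. \<not> hit w I}. \<not> hit w I} = {I\<in>B. \<forall>w\<in>insert w W'. \<not> hit w I}" by auto
    with w have "card {I\<in>B. \<forall>w\<in>insert w W'. \<not> hit w I} \<le> (1 - \<delta>) * card {I\<in>B. \<forall>w\<in>W'. \<not> hit w I}" by simp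
    also have "\<dots> \<le> (1 - \<delta>) * ((1 - \<delta>) ^ k * card B)" using W' \<delta> by (intro mult_left_mono) auto
    finally have "card {I\<in>B. \<forall>w\<in>insert w W'. \<not> hit w I} \<le> (1 - \<delta>) ^ Suc k * card B" by simp
    moreover have "card (insert w W') \<le> Suc k"
      using W' fin(2) finite_subset[of W' W] by (simp add: card_insert_if)
    ultimately show ?case using w W' by (intro exI[of _ "insert w W'"]) auto
  qed
  \<comment> \<open>One round beyond the floor makes (1 - \<delta>)^k |B| strictly smaller than 1,
    so the number of unhit members, an integer, is 0.\<close>
  define k where "k = nat \<lfloor>ln (card B) / \<delta>\<rfloor> + 1"
  have cB: "1 \<le> real (card B)" using Bne fin by (simp add: Suc_le_eq card_gt_0_iff)
  have k0: "0 \<le> ln (card B) / \<delta>" using cB \<delta> by simp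
  have k1: "ln (card B) / \<delta> < real k" "real k \<le> ln (card B) / \<delta> + 1"
    unfolding k_def using k0 by linarith+
  obtain W' where W': "W' \<subseteq> W" "card W' \<le> k" "card {I\<in>B. \<forall>w\<in>W'. \<not> hit w I} \<le> (1 - \<delta>) ^ k * card B"
    using it by blast
  have "(1 - \<delta>) ^ k \<le> exp (- \<delta>) ^ k"
    using \<delta> exp_ge_add_one_self[of "- \<delta>"] by (intro power_mono) auto
  also have "\<dots> = exp (- (\<delta> * k))" by (simp add: exp_of_nat_mult[symmetric] mult.commute)
  also have "\<dots> < exp (- ln (card B))" using k1 \<delta> by (simp add: field_simps)
  also have "\<dots> = 1 / card B" using cB by (simp add: exp_minus inverse_eq_divide)
  finally have "(1 - \<delta>) ^ k * card B < 1" using cB by (simp add: field_simps)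
  then have "card {I\<in>B. \<forall>w\<in>W'. \<not> hit w I} = 0" using W'(3) by linarith
  then have "{I\<in>B. \<forall>w\<in>W'. \<not> hit w I} = {}" using fin by simp
  then show ?thesis using that[of W'] W' k1 by force
qed

section \<open>The sampling process\<close>

text \<open>\<open>u\<close> is the schedule of the falling base weight, \<open>F\<close> the price
  of linearising it, and \<open>k0\<close> the number of candidates inside \<open>I\<close> that are
  averaged in one step. The last assumption keeps every increment at most 1/2, where the quadratic
  loss in \<open>capacity_gain\<close> takes at most half of the gain.\<close>

locale sampling_process = uniform_hypergraph X G s for X :: "'a set" and G s +
  fixes u :: "nat \<Rightarrow> real" and \<kappa> m0 F e :: real and k0 J :: nat
  assumes u_pos: "\<And>i. 0 < u i" and u_dec: "\<And>i. u (Suc i) \<le> u i"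
    and u_ratio: "\<And>i. u i \<le> (1 + e) * u (Suc i)" and e0: "0 \<le> e" and F: "(1 + e) ^ (s - 1) \<le> F"
    and \<kappa>: "0 < \<kappa>" "\<kappa> \<le> 1" and m0: "0 < m0" "m0 \<le> card X"
    and k0: "\<kappa> * card X \<le> real k0" "real k0 < \<kappa> * card X + 1"
    and small_step: "\<And>i. 2 * F * (u i - u (Suc i)) * k0 / \<kappa> \<le> 1 / 2"
begin

text \<open>Chosen to balance one step. The average gain over \<open>k0\<close> candidates is at
  least \<open>c i / 2\<close> times \<open>\<kappa> / k0\<close> times the total influence (up to
  \<open>m0\<close>), which equals the loss \<open>F * (u i - u (Suc i))\<close> times the same
  influence.\<close>

definition c :: "nat \<Rightarrow> real" where
  "c i = 2 * F * (u i - u (Suc i)) * k0 / \<kappa>"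

definition sampled :: "'a list \<Rightarrow> 'a \<Rightarrow> real" where
  "sampled ys y = (\<Sum>j<length ys. if ys ! j = y then c j else 0)"

definition level :: "'a list \<Rightarrow> 'a \<Rightarrow> 'a set" where
  "level ys z = {x\<in>X. influence X G (\<lambda>y. u (Suc (length ys)) + sampled ys y) z
      \<le> influence X G (\<lambda>y. u (Suc (length ys)) + sampled ys y) x}"

definition stops :: "'a set \<Rightarrow> 'a list \<Rightarrow> bool" where
  "stops I ys \<longleftrightarrow> (\<exists>z\<in>X. m0 \<le> card (level ys z) \<and> card (I \<inter> level ys z) < \<kappa> * card (level ys z))"

definition hits :: "'a set \<Rightarrow> 'a list \<Rightarrow> 'a list \<Rightarrow> bool" where
  "hits I ys zs \<longleftrightarrow> (\<exists>k<length zs. stops I (ys @ take k zs))"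

text \<open>Continuations are padded to total length \<open>J\<close>. A stopped history therefore
  counts with all its extensions, and the relative size of this set is the probability of a stop
  under uniform sampling.\<close>

definition hit_lists :: "'a set \<Rightarrow> 'a list \<Rightarrow> 'a list set" where
  "hit_lists I ys = {zs. set zs \<subseteq> X \<and> length zs = J - length ys \<and> hits I ys zs}"

lemma Xne: "X \<noteq> {}" using m0 by auto

lemma k0_pos: "0 < k0"
proof -
  have "0 < \<kappa> * card X" using \<kappa> Xne finX by (simp add: card_gt_0_iff)
  then show ?thesis using k0 by simp
qed

lemma k0_le: "k0 \<le> card X"
proof -
  have "\<kappa> * real (card X) \<le> 1 * real (card X)" using \<kappa> by (intro mult_right_mono) auto
  then show ?thesis using k0 by simp
qed

lemma F_pos: "1 \<le> F"
proof -
  have "1 \<le> (1 + e) ^ (s - 1)" using e0 by simp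
  then show ?thesis using F by simp
qed

lemma c_nonneg: "0 \<le> c i"
  unfolding c_def using u_dec[of i] \<kappa> F_pos by simp

lemma c_le: "c i \<le> 1 / 2" using small_step[of i] by (simp add: c_def)

lemma sampled_nonneg: "0 \<le> sampled ys y"
  unfolding sampled_def using c_nonneg by (intro sum_nonneg) auto

lemma sampled_snoc: "sampled (ys @ [x]) = (sampled ys)(x := sampled ys x + c (length ys))"
proof
  fix y
  have "sampled (ys @ [x]) y = (\<Sum>j<length ys. if (ys @ [x]) ! j = y then c j else 0) + (if x = y then c (length ys) else 0)"
    unfolding sampled_def by (simp add: nth_append)
  also have "(\<Sum>j<length ys. if (ys @ [x]) ! j = y then c j else 0) = sampled ys y"
    unfolding sampled_def by (intro sum.cong) (auto simp: nth_append)
  finally show "sampled (ys @ [x]) y = ((sampled ys)(x := sampled ys x + c (length ys))) y" by auto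
qed

lemma sum_sampled: "(\<Sum>x\<in>X. sampled ys x) \<le> (\<Sum>j<length ys. c j)"
proof -
  have "(\<Sum>x\<in>X. sampled ys x) = (\<Sum>j<length ys. \<Sum>x\<in>X. if ys ! j = x then c j else 0)"
    unfolding sampled_def by (rule sum.swap)
  also have "\<dots> \<le> (\<Sum>j<length ys. c j)"
    using finX c_nonneg by (intro sum_mono) auto
  finally show ?thesis .
qed

lemma u_antimono: "i \<le> j \<Longrightarrow> u j \<le> u i"
  using u_dec by (rule lift_Suc_antimono_le)

text \<open>The loss from lowering the base weight is linear in the total influence. As long as
  \<open>I\<close> is dense in the large level sets, the gain over suitable candidates in
  \<open>I\<close> cancels it, except for the contribution of the \<open>m0\<close> vertices above
  the last large level set.\<close>

lemma sample_step:
  assumes I: "I \<subseteq> X" and ns: "\<not> stops I ys"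
  obtains A where "A \<subseteq> I" "card A = k0"
    "capacity G (\<lambda>y. u (length ys) + sampled ys y)
      \<le> (\<Sum>x\<in>A. capacity G (\<lambda>y. u (Suc (length ys)) + sampled (ys @ [x]) y)) / k0
        + F * (u (length ys) - u (Suc (length ys))) * m0"
proof -
  define i where "i = length ys"
  define m where "m y = u (Suc i) + sampled ys y" for y
  define l where "l = influence X G m"
  define D where "D = u i - u (Suc i)"
  have D0: "0 \<le> D" using u_dec[of i] by (simp add: D_def)
  have m: "\<forall>x\<in>X. 0 < m x" using u_pos sampled_nonneg by (simp add: m_def add_pos_nonneg)
  have l: "\<forall>x\<in>X. 0 \<le> l x \<and> l x \<le> 1"
    using influence_nonneg[OF m] influence_le_1[OF m] by (simp add: l_def)
  have lev: "level ys z = {x\<in>X. l z \<le> l x}" for z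
    unfolding level_def l_def m_def i_def ..
  have dense: "\<kappa> * card {x\<in>X. l z \<le> l x} \<le> card (I \<inter> {x\<in>X. l z \<le> l x})"
    if "z \<in> X" "m0 \<le> card {x\<in>X. l z \<le> l x}" for z
    using ns that unfolding stops_def lev by force
  have kI: "k0 \<le> card I"
  proof -
    obtain z where z: "z \<in> X" "\<forall>x\<in>X. l z \<le> l x" using finite_arg_min[OF finX Xne] by blast
    then have eq: "{x\<in>X. l z \<le> l x} = X" by auto
    have "\<kappa> * card X \<le> card (I \<inter> X)" using dense[OF z(1)] m0 unfolding eq by simp
    also have "I \<inter> X = I" using I by auto
    finally show ?thesis using k0(2) by linarith
  qed
  obtain A where A: "A \<subseteq> I" "card A = k0" "\<kappa> * ((\<Sum>x\<in>X. l x) - m0) \<le> (\<Sum>x\<in>A. l x)"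
    using dense_level_sets_sample[OF finX l m0 I \<kappa>(1) k0(1) kI dense] by metis
  have AX: "A \<subseteq> X" using A I by auto
  have kp: "0 < real k0" using k0_pos by simp
  have sl: "0 \<le> (\<Sum>x\<in>A. l x)" using l AX by (intro sum_nonneg) auto
  have dec: "capacity G (\<lambda>y. u i + sampled ys y) \<le> capacity G m + F * D * (\<Sum>x\<in>X. l x)"
  proof -
    have "capacity G (\<lambda>y. u i + sampled ys y) \<le> capacity G m + (1 + e) ^ (s - 1) * (\<Sum>x\<in>X. (u i + sampled ys x - m x) * influence X G m x)"
    proof (rule capacity_decrease[OF m _ e0])
      show "\<forall>x\<in>X. m x \<le> u i + sampled ys x \<and> u i + sampled ys x \<le> (1 + e) * m x"
      proof
        fix x
        have "sampled ys x \<le> (1 + e) * sampled ys x" using sampled_nonneg[of ys x] e0 by (simp add: distrib_right)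
        then show "m x \<le> u i + sampled ys x \<and> u i + sampled ys x \<le> (1 + e) * m x"
          using u_dec[of i] u_ratio[of i] by (simp add: m_def distrib_left)
      qed
    qed
    also have "(\<Sum>x\<in>X. (u i + sampled ys x - m x) * influence X G m x) = D * (\<Sum>x\<in>X. l x)"
      by (simp add: m_def D_def l_def sum_distrib_left)
    also have "(1 + e) ^ (s - 1) * (D * (\<Sum>x\<in>X. l x)) \<le> F * (D * (\<Sum>x\<in>X. l x))"
      using F D0 l by (intro mult_right_mono mult_nonneg_nonneg sum_nonneg) auto
    finally show ?thesis by simp
  qed
  have "(\<Sum>x\<in>A. capacity G m + c i * (1 - c i) * l x) \<le> (\<Sum>x\<in>A. capacity G (\<lambda>y. u (Suc i) + sampled (ys @ [x]) y))"
  proof (rule sum_mono)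
    fix x assume "x \<in> A"
    have "(\<lambda>y. u (Suc i) + sampled (ys @ [x]) y) = m(x := m x + c i)"
      by (auto simp: sampled_snoc m_def i_def fun_eq_iff)
    then show "capacity G m + c i * (1 - c i) * l x \<le> capacity G (\<lambda>y. u (Suc i) + sampled (ys @ [x]) y)"
      using capacity_gain[OF m _ c_nonneg[of i], of x] \<open>x \<in> A\<close> AX by (auto simp: l_def)
  qed
  then have gain: "k0 * capacity G m + c i * (1 - c i) * (\<Sum>x\<in>A. l x) \<le> (\<Sum>x\<in>A. capacity G (\<lambda>y. u (Suc i) + sampled (ys @ [x]) y))"
    by (simp add: sum.distrib A(2) sum_distrib_left)
  have "F * D * k0 * ((\<Sum>x\<in>X. l x) - m0) = F * D * k0 / \<kappa> * (\<kappa> * ((\<Sum>x\<in>X. l x) - m0))"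
    using \<kappa> by simp
  also have "\<dots> \<le> F * D * k0 / \<kappa> * (\<Sum>x\<in>A. l x)"
    using A(3) F_pos D0 \<kappa> kp by (intro mult_left_mono) auto
  also have "\<dots> = c i * (1 / 2) * (\<Sum>x\<in>A. l x)" by (simp add: c_def D_def)
  also have "\<dots> \<le> c i * (1 - c i) * (\<Sum>x\<in>A. l x)"
    using c_le[of i] c_nonneg[of i] sl by (intro mult_right_mono mult_left_mono) auto
  finally have "k0 * (capacity G m + F * D * ((\<Sum>x\<in>X. l x) - m0)) \<le> (\<Sum>x\<in>A. capacity G (\<lambda>y. u (Suc i) + sampled (ys @ [x]) y))"
    using gain by (simp add: algebra_simps)
  then have "capacity G m + F * D * ((\<Sum>x\<in>X. l x) - m0) \<le> (\<Sum>x\<in>A. capacity G (\<lambda>y. u (Suc i) + sampled (ys @ [x]) y)) / k0"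
    using kp by (simp add: field_simps)
  with dec have "capacity G (\<lambda>y. u i + sampled ys y)
      \<le> (\<Sum>x\<in>A. capacity G (\<lambda>y. u (Suc i) + sampled (ys @ [x]) y)) / k0 + F * D * m0"
    by (simp add: algebra_simps)
  then show ?thesis using that[OF A(1,2)] by (simp add: i_def D_def)
qed

lemma finite_hit_lists: "finite (hit_lists I ys)"
  by (rule finite_subset[OF _ finite_lists_length_eq[OF finX, of "J - length ys"]]) (auto simp: hit_lists_def)

lemma hit_lists_step:
  assumes "\<not> stops I ys" "length ys < J"
  shows "card (hit_lists I ys) = (\<Sum>x\<in>X. card (hit_lists I (ys @ [x])))"
proof -
  have eq: "hit_lists I ys = (\<Union>x\<in>X. (#) x ` hit_lists I (ys @ [x]))"
  proof (intro equalityI subsetI)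
    fix zs assume "zs \<in> hit_lists I ys"
    then obtain k where zs: "set zs \<subseteq> X" "length zs = J - length ys" "k < length zs" "stops I (ys @ take k zs)"
      by (auto simp: hit_lists_def hits_def)
    then obtain x zs' where x: "zs = x # zs'" by (cases zs) auto
    obtain k' where k': "k = Suc k'" using zs assms by (cases k) auto
    have "stops I ((ys @ [x]) @ take k' zs')" using zs(4) x k' by simp
    then have "zs' \<in> hit_lists I (ys @ [x])"
      using zs x k' by (auto simp: hit_lists_def hits_def intro!: exI[of _ k'])
    then show "zs \<in> (\<Union>x\<in>X. (#) x ` hit_lists I (ys @ [x]))" using x zs by auto
  next
    fix zs assume "zs \<in> (\<Union>x\<in>X. (#) x ` hit_lists I (ys @ [x]))"
    then obtain x zs' k where x: "zs = x # zs'" "x \<in> X" "set zs' \<subseteq> X" "length zs' = J - Suc (length ys)"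
      "k < length zs'" "stops I ((ys @ [x]) @ take k zs')"
      by (auto simp: hit_lists_def hits_def)
    then show "zs \<in> hit_lists I ys"
      using assms(2) by (auto simp: hit_lists_def hits_def intro!: exI[of _ "Suc k"])
  qed
  have "card (hit_lists I ys) = (\<Sum>x\<in>X. card ((#) x ` hit_lists I (ys @ [x])))"
    unfolding eq using finX finite_hit_lists by (intro card_UN_disjoint) auto
  also have "\<dots> = (\<Sum>x\<in>X. card (hit_lists I (ys @ [x])))"
    by (intro sum.cong refl card_image) (auto simp: inj_on_def)
  finally show ?thesis .
qed

text \<open>Backward induction on the draws that remain. Averaging over the candidates turns each
  future draw into the deterministic weight \<open>c j / k0\<close> on all of \<open>I\<close>.
  Normalising by powers of \<open>k0\<close> rather than \<open>card X\<close> matches these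
  averages; the hit lists over the candidates are then bounded by those over all of
  \<open>X\<close>.\<close>

lemma process_bound:
  fixes K :: real
  assumes I: "I \<subseteq> X" and K: "card X * u 0 + (\<Sum>j<J. c j) \<le> K"
    and ys: "set ys \<subseteq> X" "length ys \<le> J"
  shows "capacity G (\<lambda>y. u (length ys) + sampled ys y)
    \<le> capacity G (\<lambda>y. u J + sampled ys y + (if y \<in> I then \<Sum>j=length ys..<J. c j / k0 else 0))
      + K * card (hit_lists I ys) / k0 ^ (J - length ys) + F * (u (length ys) - u J) * m0"
  using ys
proof (induction "J - length ys" arbitrary: ys)
  case 0
  then have J: "length ys = J" by simp
  have "hit_lists I ys = {}" by (auto simp: hit_lists_def hits_def J)
  then show ?case by (simp add: J cong: if_cong)
next
  case (Suc r)
  define i where "i = length ys"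
  have i: "i < J" "J - i = Suc r" "J - Suc i = r" using Suc by (auto simp: i_def)
  have kp: "0 < real k0" using k0_pos by simp
  have K0: "0 \<le> K"
    using K u_pos[of 0] c_nonneg by (smt (verit) mult_nonneg_nonneg of_nat_0_le_iff sum_nonneg)
  define B where "B t = (\<Sum>j=t..<J. c j / k0)" for t
  show ?case
  proof (cases "stops I ys")
    case True
    \<comment> \<open>After a stop every continuation hits. As \<open>k0 \<le> card X\<close>, the
      middle term is then at least \<open>K\<close>, which dominates every capacity that the process
      can reach.\<close>
    have "hit_lists I ys = {zs. set zs \<subseteq> X \<and> length zs = J - i}"
      using True i by (auto simp: hit_lists_def hits_def i_def intro!: exI[of _ 0])
    then have "card (hit_lists I ys) = card X ^ (J - i)" by (simp add: card_lists_length_eq finX)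
    then have "K * 1 \<le> K * (card (hit_lists I ys) / k0 ^ (J - i))"
      using K0 k0_le k0_pos by (intro mult_left_mono) (auto simp: power_mono)
    moreover have "capacity G (\<lambda>y. u i + sampled ys y) \<le> K"
    proof -
      have "capacity G (\<lambda>y. u i + sampled ys y) \<le> (\<Sum>x\<in>X. u i + sampled ys x)"
        using u_pos sampled_nonneg by (intro capacity_le_sum) (auto intro: add_pos_nonneg)
      also have "\<dots> \<le> card X * u i + (\<Sum>j<i. c j)"
        using sum_sampled[of ys] by (simp add: sum.distrib i_def)
      also have "\<dots> \<le> card X * u 0 + (\<Sum>j<J. c j)"
        using u_antimono[of 0 i] c_nonneg i by (intro add_mono mult_left_mono sum_mono2) auto
      finally show ?thesis using K by simp
    qed
    moreover have "0 \<le> capacity G (\<lambda>y. u J + sampled ys y + (if y \<in> I then B i else 0))"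
      using u_pos sampled_nonneg c_nonneg by (intro capacity_nonneg) (auto simp: B_def intro!: add_pos_nonneg sum_nonneg)
    moreover have "0 \<le> F * (u i - u J) * m0"
      using F_pos u_antimono[of i J] i m0 by simp
    ultimately show ?thesis unfolding i_def B_def by simp
  next
    case False
    obtain A where A: "A \<subseteq> I" "card A = k0"
      "capacity G (\<lambda>y. u i + sampled ys y)
      \<le> (\<Sum>x\<in>A. capacity G (\<lambda>y. u (Suc i) + sampled (ys @ [x]) y)) / k0 + F * (u i - u (Suc i)) * m0"
      using sample_step[OF I False] unfolding i_def by metis
    have AX: "A \<subseteq> X" and finA: "finite A" using A I finX by (auto intro: finite_subset)
    define g where "g y = u J + sampled ys y + (if y \<in> I then B (Suc i) else 0)" for y
    have B0: "0 \<le> B t" for t unfolding B_def using c_nonneg by (intro sum_nonneg) auto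
    have g: "\<forall>x\<in>X. 0 < g x" using u_pos sampled_nonneg B0 by (simp add: g_def add_pos_nonneg)
    have IH: "capacity G (\<lambda>y. u (Suc i) + sampled (ys @ [x]) y)
       \<le> capacity G (g(x := g x + c i)) + K * card (hit_lists I (ys @ [x])) / k0 ^ r + F * (u (Suc i) - u J) * m0"
      if "x \<in> A" for x
    proof -
      have eq: "(\<lambda>y. u J + sampled (ys @ [x]) y + (if y \<in> I then B (Suc i) else 0)) = g(x := g x + c i)"
        by (auto simp: g_def sampled_snoc i_def fun_eq_iff)
      have len: "length (ys @ [x]) = Suc i" by (simp add: i_def)
      have "r = J - length (ys @ [x])" "set (ys @ [x]) \<subseteq> X" "length (ys @ [x]) \<le> J"
        using that AX i Suc.prems by (auto simp: i_def)
      from Suc.hyps(1)[OF this] show ?thesis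
        unfolding len i B_def[symmetric] eq .
    qed
    have avg: "(\<Sum>x\<in>A. capacity G (g(x := g x + c i))) / k0 \<le> capacity G (\<lambda>y. u J + sampled ys y + (if y \<in> I then B i else 0))"
    proof -
      have "(\<Sum>x\<in>A. 1 / k0 * capacity G (g(x := g x + c i))) \<le> capacity G (\<lambda>y. g y + (if y \<in> A then c i * (1 / k0) else 0))"
        using A kp by (intro capacity_average[OF g AX _ _ c_nonneg]) auto
      also have "\<dots> \<le> capacity G (\<lambda>y. u J + sampled ys y + (if y \<in> I then B i else 0))"
      proof (rule capacity_mono)
        show "\<forall>x\<in>X. 0 < g x + (if x \<in> A then c i * (1 / k0) else 0)" using g c_nonneg[of i] by (auto intro: add_pos_nonneg)
        have "B i = c i / k0 + B (Suc i)" unfolding B_def using i by (simp add: sum.atLeast_Suc_lessThan)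
        then show "\<forall>x\<in>X. g x + (if x \<in> A then c i * (1 / k0) else 0) \<le> u J + sampled ys x + (if x \<in> I then B i else 0)"
          using A(1) c_nonneg[of i] by (auto simp: g_def)
      qed
      finally show ?thesis by (simp add: sum_divide_distrib)
    qed
    have "(\<Sum>x\<in>A. capacity G (\<lambda>y. u (Suc i) + sampled (ys @ [x]) y))
       \<le> (\<Sum>x\<in>A. capacity G (g(x := g x + c i)) + K * card (hit_lists I (ys @ [x])) / k0 ^ r + F * (u (Suc i) - u J) * m0)"
      using IH by (rule sum_mono)
    also have "\<dots> = (\<Sum>x\<in>A. capacity G (g(x := g x + c i))) + K / k0 ^ r * (\<Sum>x\<in>A. real (card (hit_lists I (ys @ [x])))) + k0 * (F * (u (Suc i) - u J) * m0)"
      by (simp add: sum.distrib A(2) sum_distrib_left)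
    also have "\<dots> \<le> (\<Sum>x\<in>A. capacity G (g(x := g x + c i))) + K / k0 ^ r * card (hit_lists I ys) + k0 * (F * (u (Suc i) - u J) * m0)"
    proof -
      have "(\<Sum>x\<in>A. real (card (hit_lists I (ys @ [x])))) \<le> (\<Sum>x\<in>X. real (card (hit_lists I (ys @ [x]))))"
        using AX finX by (intro sum_mono2) auto
      also have "\<dots> = card (hit_lists I ys)" using hit_lists_step[OF False] i by (simp add: i_def)
      finally show ?thesis using K0 kp by (intro add_right_mono add_left_mono mult_left_mono) auto
    qed
    finally have "(\<Sum>x\<in>A. capacity G (\<lambda>y. u (Suc i) + sampled (ys @ [x]) y)) / k0
       \<le> (\<Sum>x\<in>A. capacity G (g(x := g x + c i))) / k0 + K / k0 ^ r * card (hit_lists I ys) / k0 + F * (u (Suc i) - u J) * m0"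
      using kp by (simp add: field_simps)
    then have "capacity G (\<lambda>y. u i + sampled ys y) \<le> capacity G (\<lambda>y. u J + sampled ys y + (if y \<in> I then B i else 0))
       + K * card (hit_lists I ys) / k0 ^ Suc r + F * (u (Suc i) - u J) * m0 + F * (u i - u (Suc i)) * m0"
      using A(3) avg by (simp add: mult.commute)
    then show ?thesis using i unfolding B_def i_def by (simp add: algebra_simps)
  qed
qed

lemma telescoped_weights: "(\<Sum>j<J. c j / k0) = 2 * F / \<kappa> * (u 0 - u J)"
proof -
  have "(\<Sum>j<J. c j / k0) = (\<Sum>j<J. 2 * F / \<kappa> * (u j - u (Suc j)))"
    using k0_pos by (intro sum.cong) (auto simp: c_def)
  also have "\<dots> = 2 * F / \<kappa> * (\<Sum>j<J. u j - u (Suc j))" by (simp only: sum_distrib_left)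
  finally show ?thesis by (simp add: sum_lessThan_telescope')
qed

text \<open>Since the increments telescope, the schedule enters only through its end values: however
  fine the steps are, the weight on \<open>I\<close> stays below
  \<open>2 * F / \<kappa> * u 0\<close>. If \<open>I\<close> has small capacity at this weight, many
  sample lists must hit.\<close>

lemma hit_lists_bound:
  fixes K :: real
  assumes I: "I \<subseteq> X" and K: "card X * u 0 + 2 * F / \<kappa> * u 0 * k0 \<le> K"
  shows "capacity G (\<lambda>y. u 0) \<le> capacity G (\<lambda>y. u J + (if y \<in> I then 2 * F / \<kappa> * (u 0 - u J) else 0))
      + K * card (hit_lists I []) / k0 ^ J + F * (u 0 - u J) * m0"
proof -
  have "(\<Sum>j<J. c j) = k0 * (\<Sum>j<J. c j / k0)" using k0_pos by (simp add: sum_distrib_left)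
  also have "\<dots> = 2 * F / \<kappa> * (u 0 - u J) * k0" by (simp add: telescoped_weights)
  also have "\<dots> \<le> 2 * F / \<kappa> * u 0 * k0"
    using F_pos \<kappa> u_pos[of J] by (intro mult_right_mono mult_left_mono) auto
  finally have "card X * u 0 + (\<Sum>j<J. c j) \<le> K" using K by simp
  from process_bound[OF I this, of "[]"] show ?thesis
    unfolding telescoped_weights[symmetric] by (simp add: sampled_def lessThan_atLeast0 cong: if_cong)
qed

text \<open>A stop is witnessed by a level set that depends only on the sampled prefix and one
  vertex, not on \<open>I\<close>. So each list of a short hitting family contributes at most
  \<open>J * card X\<close> sets.\<close>

lemma sparse_level_family:
  fixes \<delta> :: real
  assumes fin: "finite B" and B: "\<And>I. I \<in> B \<Longrightarrow> I \<subseteq> X"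
    and \<delta>: "0 < \<delta>" "\<delta> \<le> 1"
    and hit: "\<And>I. I \<in> B \<Longrightarrow> \<delta> * card X ^ J \<le> card (hit_lists I [])"
  obtains PP where "finite PP" "\<And>P. P \<in> PP \<Longrightarrow> P \<subseteq> X \<and> m0 \<le> card P"
    "\<And>I. I \<in> B \<Longrightarrow> \<exists>P\<in>PP. card (I \<inter> P) < \<kappa> * card P"
    "card PP \<le> (ln (card B) / \<delta> + 1) * (J * card X)"
proof -
  let ?W = "{zs. set zs \<subseteq> X \<and> length zs = J}"
  have finW: "finite ?W" by (rule finite_lists_length_eq[OF finX])
  have cW: "card ?W = card X ^ J" by (rule card_lists_length_eq[OF finX])
  have Wne: "?W \<noteq> {}"
    using cW Xne finX by (metis card.empty card_eq_0_iff power_not_zero)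
  obtain W' where W': "W' \<subseteq> ?W" "card W' \<le> ln (card B) / \<delta> + 1" "\<And>I. I \<in> B \<Longrightarrow> \<exists>zs\<in>W'. hits I [] zs"
  proof (rule hitting_family[OF fin finW \<delta> Wne, of "\<lambda>zs I. hits I [] zs"])
    fix I assume "I \<in> B"
    have "{zs \<in> ?W. hits I [] zs} = hit_lists I []" by (auto simp: hit_lists_def)
    then show "\<delta> * card ?W \<le> card {zs \<in> ?W. hits I [] zs}" using hit[OF \<open>I \<in> B\<close>] cW by simp
  qed blast
  have finW': "finite W'" using W'(1) finW finite_subset by blast
  define Q where "Q = (\<lambda>(zs, k, z). level (take k zs) z) ` (W' \<times> {..<J} \<times> X)"
  define PP where "PP = {P \<in> Q. m0 \<le> card P}"
  have finQ: "finite Q" unfolding Q_def using finW' finX by auto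
  have "card PP \<le> card Q" unfolding PP_def using finQ by (intro card_mono) auto
  also have "\<dots> \<le> card (W' \<times> {..<J} \<times> X)" unfolding Q_def using finW' finX by (intro card_image_le) auto
  also have "\<dots> = card W' * (J * card X)" by (simp add: card_cartesian_product)
  finally have "real (card PP) \<le> real (card W') * real (J * card X)" by (metis of_nat_le_iff of_nat_mult)
  also have "\<dots> \<le> (ln (card B) / \<delta> + 1) * (J * card X)" using W'(2) by (intro mult_right_mono) auto
  finally have card: "real (card PP) \<le> (ln (card B) / \<delta> + 1) * (J * card X)" by simp
  have cov: "\<exists>P\<in>PP. card (I \<inter> P) < \<kappa> * card P" if IB: "I \<in> B" for I
  proof -
    obtain zs k where zs: "zs \<in> W'" "k < length zs" "stops I (take k zs)"
      using W'(3)[OF IB] by (auto simp: hits_def)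
    then obtain z where z: "z \<in> X" "m0 \<le> card (level (take k zs) z)"
      "card (I \<inter> level (take k zs) z) < \<kappa> * card (level (take k zs) z)" by (auto simp: stops_def)
    have "length zs = J" using zs W' by auto
    then have "level (take k zs) z \<in> Q" unfolding Q_def using zs z by force
    then show ?thesis using z by (auto simp: PP_def)
  qed
  show ?thesis
    by (rule that[of PP]) (use finQ card cov in \<open>auto simp: PP_def Q_def level_def\<close>)
qed

end

section \<open>Recursion and numerical estimates\<close>

text \<open>Give a subset \<open>T\<close> the weight \<tau>^|T|. Every counted subset has weight at
  least \<tau>^(\<tau>|P|), and the total weight is (1 + \<tau>)^|P|.\<close>

lemma card_small_subsets:
  fixes \<tau> :: real
  assumes fin: "finite P" and \<tau>: "0 < \<tau>" "\<tau> < 1"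
  shows "card {T. T \<subseteq> P \<and> card T < \<tau> * card P} \<le> exp (\<tau> * card P * (1 + ln (1 / \<tau>)))"
proof -
  let ?S = "{T. T \<subseteq> P \<and> card T < \<tau> * card P}"
  have "real (card ?S) * \<tau> powr (\<tau> * card P) = (\<Sum>T\<in>?S. \<tau> powr (\<tau> * card P))" by simp
  also have "\<dots> \<le> (\<Sum>T\<in>?S. \<tau> ^ card T)"
  proof (rule sum_mono)
    fix T assume "T \<in> ?S"
    then have "\<tau> powr (\<tau> * card P) \<le> \<tau> powr (card T)"
      using \<tau> by (intro powr_mono') auto
    then show "\<tau> powr (\<tau> * card P) \<le> \<tau> ^ card T" using \<tau> by (simp add: powr_realpow)
  qed
  also have "\<dots> \<le> (\<Sum>T\<in>Pow P. \<tau> ^ card T)" using fin \<tau> by (intro sum_mono2) auto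
  also have "\<dots> = (\<Prod>x\<in>P. \<tau> + 1)" using prod_add[OF fin, of "\<lambda>_. \<tau>" "\<lambda>_. 1"] by simp
  also have "\<dots> = (1 + \<tau>) ^ card P" by (simp add: add.commute)
  also have "\<dots> \<le> exp \<tau> ^ card P" using \<tau> exp_ge_add_one_self[of \<tau>] by (intro power_mono) auto
  also have "\<dots> = exp (\<tau> * card P)" by (simp add: exp_of_nat2_mult)
  finally have "real (card ?S) \<le> exp (\<tau> * card P) / \<tau> powr (\<tau> * card P)"
    using \<tau> by (simp add: field_simps)
  also have "\<dots> = exp (\<tau> * card P * (1 + ln (1 / \<tau>)))"
    using \<tau> by (simp add: powr_def ln_div exp_diff[symmetric] algebra_simps)
  finally show ?thesis .
qed

text \<open>A child guesses \<open>P\<close> and the trace \<open>T\<close> of \<open>I\<close> on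
  \<open>P\<close>, and continues with \<open>(X - P) \<union> T\<close>. It has lost at least (1 -
  \<tau>)|P| vertices, so its bound is smaller by the factor exp(-\<gamma>(1 - \<tau>)|P|); the
  inequality assumed for the sets \<open>P\<close> says that this pays for the number of
  children.\<close>

lemma container_recursion:
  fixes \<tau> \<gamma> :: real
  assumes fin: "finite V" and \<tau>: "0 < \<tau>" "\<tau> < 1" and \<gamma>: "0 \<le> \<gamma>"
    and step: "\<And>X. X \<subseteq> V \<Longrightarrow> \<not> terminal X \<Longrightarrow> \<exists>PP. finite PP \<and>
       (\<forall>P\<in>PP. P \<subseteq> X \<and> P \<noteq> {} \<and> card PP * exp (\<tau> * card P * (1 + ln (1 / \<tau>))) \<le> exp (\<gamma> * (1 - \<tau>) * card P)) \<and>
       (\<forall>I. I \<subseteq> X \<and> bad I \<longrightarrow> (\<exists>P\<in>PP. card (I \<inter> P) < \<tau> * card P))"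
  shows "X \<subseteq> V \<Longrightarrow> \<exists>\<C>. \<C> \<subseteq> Pow X \<and> (\<forall>Z\<in>\<C>. terminal Z) \<and> (\<forall>I. I \<subseteq> X \<and> bad I \<longrightarrow> (\<exists>Z\<in>\<C>. I \<subseteq> Z)) \<and>
     card \<C> \<le> exp (\<gamma> * card X)"
proof (induction "card X" arbitrary: X rule: less_induct)
  case less
  have finX: "finite X" using less.prems fin finite_subset by blast
  show ?case
  proof (cases "terminal X")
    case True
    then show ?thesis using \<gamma> by (intro exI[of _ "{X}"]) auto
  next
    case False
    obtain PP where PP: "finite PP" "\<And>P. P \<in> PP \<Longrightarrow> P \<subseteq> X" "\<And>P. P \<in> PP \<Longrightarrow> P \<noteq> {}"
      "\<And>P. P \<in> PP \<Longrightarrow> card PP * exp (\<tau> * card P * (1 + ln (1 / \<tau>))) \<le> exp (\<gamma> * (1 - \<tau>) * card P)"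
      "\<And>I. I \<subseteq> X \<Longrightarrow> bad I \<Longrightarrow> \<exists>P\<in>PP. card (I \<inter> P) < \<tau> * card P"
      using step[OF less.prems False] by (elim exE conjE) metis
    define S where "S P = {T. T \<subseteq> P \<and> card T < \<tau> * card P}" for P :: "'a set"
    define ch where "ch P T = (X - P) \<union> T" for P T :: "'a set"
    have finP: "finite P" if "P \<in> PP" for P using PP(2)[OF that] finX finite_subset by blast
    have finS: "finite (S P)" if "P \<in> PP" for P using finP[OF that] by (simp add: S_def)
    have ch_card: "card (ch P T) \<le> card X - (1 - \<tau>) * card P" "card (ch P T) < card X" "ch P T \<subseteq> X"
      if P: "P \<in> PP" and T: "T \<in> S P" for P T
    proof -
      have "card (ch P T) = card (X - P) + card T"
        unfolding ch_def using P T finP[OF P] finX by (intro card_Un_disjoint) (auto simp: S_def intro: finite_subset)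
      also have "card (X - P) = card X - card P" using PP(2)[OF P] finP[OF P] by (simp add: card_Diff_subset)
      finally have c: "card (ch P T) = card X - card P + card T" .
      have le: "card P \<le> card X" using PP(2)[OF P] finX by (simp add: card_mono)
      have cp: "0 < card P" using PP(3)[OF P] finP[OF P] by (simp add: card_gt_0_iff)
      have T': "card T < \<tau> * card P" using T by (simp add: S_def)
      have c': "real (card (ch P T)) = real (card X) - card P + card T" using c le by simp
      show "card (ch P T) \<le> card X - (1 - \<tau>) * card P" using c' T' by (simp add: algebra_simps)
      have "\<tau> * card P < 1 * real (card P)" using \<tau> cp by (intro mult_strict_right_mono) auto
      then show "card (ch P T) < card X" using c' T' by linarith
      show "ch P T \<subseteq> X" using P T PP(2) by (auto simp: ch_def S_def)
    qed
    have IH: "\<exists>\<C>. \<C> \<subseteq> Pow (ch P T) \<and> (\<forall>Z\<in>\<C>. terminal Z) \<and>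
        (\<forall>I. I \<subseteq> ch P T \<and> bad I \<longrightarrow> (\<exists>Z\<in>\<C>. I \<subseteq> Z)) \<and> card \<C> \<le> exp (\<gamma> * card (ch P T))"
      if P: "P \<in> PP" and T: "T \<in> S P" for P T
      using less.hyps[OF ch_card(2)[OF P T]] ch_card(3)[OF P T] less.prems by blast
    obtain \<C> where C: "\<And>P T. P \<in> PP \<Longrightarrow> T \<in> S P \<Longrightarrow> \<C> P T \<subseteq> Pow (ch P T) \<and> (\<forall>Z\<in>\<C> P T. terminal Z) \<and>
        (\<forall>I. I \<subseteq> ch P T \<and> bad I \<longrightarrow> (\<exists>Z\<in>\<C> P T. I \<subseteq> Z)) \<and> card (\<C> P T) \<le> exp (\<gamma> * card (ch P T))"
      by (rule that[of "\<lambda>P T. SOME \<C>. \<C> \<subseteq> Pow (ch P T) \<and> (\<forall>Z\<in>\<C>. terminal Z) \<and>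
        (\<forall>I. I \<subseteq> ch P T \<and> bad I \<longrightarrow> (\<exists>Z\<in>\<C>. I \<subseteq> Z)) \<and> card \<C> \<le> exp (\<gamma> * card (ch P T))"])
        (rule someI_ex[OF IH])
    define R where "R = (\<Union>P\<in>PP. \<Union>T\<in>S P. \<C> P T)"
    have "R \<subseteq> Pow X"
    proof
      fix Z assume "Z \<in> R"
      then obtain P T where PT: "P \<in> PP" "T \<in> S P" "Z \<in> \<C> P T" by (auto simp: R_def)
      then show "Z \<in> Pow X" using C[OF PT(1,2)] ch_card(3)[OF PT(1,2)] by blast
    qed
    moreover have "\<forall>Z\<in>R. terminal Z"
    proof
      fix Z assume "Z \<in> R"
      then obtain P T where PT: "P \<in> PP" "T \<in> S P" "Z \<in> \<C> P T" by (auto simp: R_def)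
      then show "terminal Z" using C[OF PT(1,2)] by blast
    qed
    moreover have "\<exists>Z\<in>R. I \<subseteq> Z" if I: "I \<subseteq> X" "bad I" for I
    proof -
      obtain P where P: "P \<in> PP" "card (I \<inter> P) < \<tau> * card P" using PP(5)[OF I] by blast
      have T: "I \<inter> P \<in> S P" using P by (simp add: S_def)
      have "I \<subseteq> ch P (I \<inter> P)" using I by (auto simp: ch_def)
      then obtain Z where "Z \<in> \<C> P (I \<inter> P)" "I \<subseteq> Z" using C[OF P(1) T] I by blast
      then show ?thesis using P(1) T unfolding R_def by blast
    qed
    moreover have "card R \<le> exp (\<gamma> * card X)"
    proof -
      have one: "card (\<Union>T\<in>S P. \<C> P T) \<le> exp (\<gamma> * card X) / card PP" if P: "P \<in> PP" for P
      proof -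
        have cpp: "0 < card PP" using P PP(1) card_gt_0_iff by blast
        have "real (card (\<Union>T\<in>S P. \<C> P T)) \<le> real (\<Sum>T\<in>S P. card (\<C> P T))"
          using card_UN_le[OF finS[OF P]] of_nat_mono by blast
        also have "\<dots> = (\<Sum>T\<in>S P. real (card (\<C> P T)))" by simp
        also have "\<dots> \<le> (\<Sum>T\<in>S P. exp (\<gamma> * card X) * exp (- (\<gamma> * (1 - \<tau>) * card P)))"
        proof (rule sum_mono)
          fix T assume T: "T \<in> S P"
          have "real (card (\<C> P T)) \<le> exp (\<gamma> * card (ch P T))" using C[OF P T] by blast
          also have "\<dots> \<le> exp (\<gamma> * (card X - (1 - \<tau>) * card P))"
            using ch_card(1)[OF P T] \<gamma> by (simp add: mult_left_mono)
          also have "\<dots> = exp (\<gamma> * card X) * exp (- (\<gamma> * (1 - \<tau>) * card P))"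
            by (simp add: exp_add[symmetric] algebra_simps)
          finally show "card (\<C> P T) \<le> exp (\<gamma> * card X) * exp (- (\<gamma> * (1 - \<tau>) * card P))" .
        qed
        also have "\<dots> = card (S P) * (exp (\<gamma> * card X) * exp (- (\<gamma> * (1 - \<tau>) * card P)))" by simp
        also have "\<dots> \<le> exp (\<tau> * card P * (1 + ln (1 / \<tau>))) * (exp (\<gamma> * card X) * exp (- (\<gamma> * (1 - \<tau>) * card P)))"
          using card_small_subsets[OF finP[OF P] \<tau>] by (intro mult_right_mono) (auto simp: S_def)
        also have "\<dots> \<le> exp (\<gamma> * (1 - \<tau>) * card P) / card PP * (exp (\<gamma> * card X) * exp (- (\<gamma> * (1 - \<tau>) * card P)))"
          using PP(4)[OF P] cpp by (intro mult_right_mono) (auto simp: field_simps)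
        also have "\<dots> = exp (\<gamma> * card X) / card PP"
          by (simp add: exp_minus)
        finally show ?thesis .
      qed
      have "real (card R) \<le> real (\<Sum>P\<in>PP. card (\<Union>T\<in>S P. \<C> P T))"
        unfolding R_def using card_UN_le[OF PP(1)] of_nat_mono by blast
      also have "\<dots> = (\<Sum>P\<in>PP. real (card (\<Union>T\<in>S P. \<C> P T)))" by simp
      also have "\<dots> \<le> (\<Sum>P\<in>PP. exp (\<gamma> * card X) / card PP)" using one by (rule sum_mono)
      also have "\<dots> \<le> exp (\<gamma> * card X)" by simp
      finally show ?thesis .
    qed
    ultimately show ?thesis by (intro exI[of _ R] conjI allI impI) simp_all
  qed
qed

section \<open>Numerical inequalities for the length of the sampling process\<close>

lemma ln_le_tangent:
  fixes x a :: real
  assumes "0 < x" "0 < a"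
  shows "ln x \<le> x / a + ln a - 1"
  using ln_le_minus_one[of "x / a"] assms by (simp add: ln_div)

text \<open>As \<open>q < 1/8\<close> gives \<open>l \<ge> 8/3\<close>, terms free of
  \<open>l\<close> may be multiplied by \<open>3/8 * l\<close>; dividing by \<open>l\<close> leaves
  \<open>main\<close>. Its constants come from \<open>A'\<close>: 1.00293 is 1 + 3/1024 rounded up,
  1.125 is 3 * 3/8, 6.958 is 2 + 3/8 * 13.2207 rounded up, and 3.0365 is 3.06 - 3/128 rounded
  down.\<close>

lemma log_cost_bound:
  fixes n J D q M :: real
  assumes q: "0 < q" "q < 1/8" and n: "0 < n" and J: "0 < J" and D: "1 \<le> D"
    and M: "M = 7/10 * q * n / D"
    and main: "1.00293 * J + 6.958 + 1.125 * ln D \<le> 3.0365 * M"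
  shows "144 * n\<^sup>2 * J * D * (2/q) powr J \<le> exp (3.06 * ln (2/q) * M)"
proof -
  define l where "l = ln (2/q)"
  have ln2: "2/3 \<le> ln (2::real)" "ln (2::real) \<le> 25/36" by (rule ln2_ge_two_thirds, rule ln2_le_25_over_36)
  have "ln (16::real) = ln (2 ^ 4)" by simp
  then have ln16: "ln (16::real) = 4 * ln 2" by (simp only: ln_realpow)
  have "ln 16 \<le> l" unfolding l_def using q by (simp add: field_simps)
  then have l: "8/3 \<le> l" using ln16 ln2 by simp
  have Mp: "0 < M" using q n D M by simp
  have n_eq: "n = M * D / (7/10 * q)" using q n D M by (simp add: field_simps)
  have "ln (5 * 2 :: real) = ln 5 + ln 2" by (rule ln_mult_pos) auto
  then have ln10: "ln (10::real) = ln 5 + ln 2" by simp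
  have lnn: "ln n = ln M + ln D - ln (7/5) + l"
    unfolding l_def n_eq using q Mp D by (simp add: ln_mult ln_div ln10)
  have "ln (32::real) = ln (2 ^ 5)" "ln (128::real) = ln (2 ^ 7)" by simp_all
  then have ln32: "ln (32::real) = 5 * ln 2" "ln (128::real) = 7 * ln 2" by (simp_all only: ln_realpow)
  have lnM: "ln M \<le> M / 32 + 5 * ln 2 - 1" using ln_le_tangent[OF Mp, of 32] ln32 by simp
  have lnJ: "ln J \<le> J / 128 + 7 * ln 2 - 1" using ln_le_tangent[OF J, of 128] ln32 by simp
  have "ln (144::real) = ln (128 * (9/8))" by simp
  also have "\<dots> = ln 128 + ln (9/8)" by (rule ln_mult_pos) auto
  finally have ln144: "ln (144::real) \<le> 7 * ln 2 + 1/8" using ln_le_minus_one[of "9/8::real"] ln32 by simp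
  have ln75: "2/7 \<le> ln (7/5::real)" using ln_le_minus_one[of "5/7::real"] by (simp add: ln_div)
  define A where "A = 2 * ln M + 3 * ln D - 2 * ln (7/5) + ln 144 + ln J"
  define A' where "A' = M / 16 + J / 128 + 3 * ln D + 13.2207"
  have Aub: "A \<le> A'"
  proof -
    have "A \<le> M / 16 + J / 128 + 3 * ln D + 24 * ln 2 + (- 3 + 1/8 - 4/7)"
      unfolding A_def using lnM lnJ ln144 ln75 by (simp add: field_simps)
    then show ?thesis using ln2 by (simp add: A'_def field_simps)
  qed
  have A'0: "0 \<le> A'" using Mp J D by (simp add: A'_def)
  have "J + 2 + 3/8 * A' \<le> 3.06 * M" using main Mp J by (simp add: A'_def field_simps)
  then have "(J + 2 + 3/8 * A') * l \<le> 3.06 * M * l" using l by (intro mult_right_mono) auto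
  moreover have "A' * 1 \<le> A' * (3/8 * l)" using A'0 l by (intro mult_left_mono) auto
  ultimately have "J * l + 2 * l + A \<le> 3.06 * M * l" using Aub by (simp add: algebra_simps)
  then have "ln 144 + 2 * ln n + ln J + ln D + J * l \<le> 3.06 * l * M"
    unfolding A_def lnn by (simp add: algebra_simps)
  then have "exp (ln 144 + 2 * ln n + ln J + ln D + J * l) \<le> exp (3.06 * l * M)" by simp
  moreover have "exp (ln 144 + 2 * ln n + ln J + ln D + J * l) = 144 * n\<^sup>2 * J * D * (2/q) powr J"
    using n J D q by (simp add: exp_add powr_def l_def power2_eq_square exp_double)
  ultimately show ?thesis unfolding l_def by simp
qed

text \<open>Here \<open>Y\<close> stands for max y 1. Since \<open>D\<close> is at most
  \<open>y / Y * w\<close>, the variable \<open>y\<close> cancels in the lower bound for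
  \<open>M\<close>, and \<open>Y \<le> 2 * s^2\<close> makes \<open>w\<close>, hence
  \<open>D\<close>, bounded by the absolute constant 2176 = 256 * 8 + 128.\<close>

lemma exponent_bound_sparse:
  fixes s r :: nat and y Y D M J :: real
  assumes r: "2 \<le> r" and s: "2 \<le> s" and y: "0 < y" and Y: "y \<le> Y" "1 \<le> Y" "Y \<le> 2 * real s ^ 2"
    and D: "1 \<le> D" "D \<le> 256 * y / (real s - 1)\<^sup>2 + 128 * y / Y"
    and M: "716.8 * real r ^ 2 * real s ^ 2 * y / D \<le> M"
    and J: "J \<le> 5.19 * Y + (4 * real s - 3) * ln (32 * D) + 1"
  shows "1.00293 * J + 6.958 + 1.125 * ln D \<le> 3.0365 * M"
proof -
  define a where "a = real s"
  have a: "2 \<le> a" using s by (simp add: a_def)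
  define w where "w = 256 * Y / (a - 1)\<^sup>2 + 128"
  have w0: "128 \<le> w" using Y by (simp add: w_def)
  have yw: "D \<le> y / Y * w" using D(2) Y by (simp add: w_def a_def algebra_simps)
  also have "\<dots> \<le> 1 * w" using Y y w0 by (intro mult_right_mono) auto
  finally have Dw: "D \<le> w" by simp
  have "a\<^sup>2 \<le> (2 * (a - 1))\<^sup>2" using a by (intro power_mono) auto
  then have "Y \<le> 8 * (a - 1)\<^sup>2" using Y(3) unfolding a_def[symmetric] by (simp add: power2_eq_square algebra_simps)
  then have "Y / (a - 1)\<^sup>2 \<le> 8" using a by (simp add: divide_le_eq)
  then have w2176: "w \<le> 2176" by (simp add: w_def)
  have ln2: "ln (2::real) \<le> 25/36" by (rule ln2_le_25_over_36)
  have "ln (2048::real) = ln (2 ^ 11)" "ln (32::real) = ln (2 ^ 5)" by simp_all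
  then have lnp: "ln (2048::real) = 11 * ln 2" "ln (32::real) = 5 * ln 2" by (simp_all only: ln_realpow)
  have "ln D \<le> ln (2048 * (17/16))" using D Dw w2176 by (subst ln_le_cancel_iff) auto
  also have "\<dots> = ln 2048 + ln (17/16)" by (rule ln_mult_pos) auto
  finally have lnD: "ln D \<le> 7.7014" using ln_le_minus_one[of "17/16::real"] ln2 lnp by simp
  have "ln (32 * D) = ln 32 + ln D" using D by (simp add: ln_mult)
  then have ln32D: "ln (32 * D) \<le> 11.1737" using lnD lnp ln2 by simp
  have "(4 * a - 3) * ln (32 * D) \<le> (4 * a - 3) * 11.1737" using ln32D a by (intro mult_left_mono) auto
  then have lhs: "1.00293 * J + 6.958 + 1.125 * ln D \<le> 5.21 * Y + 44.84 * a - 16.98"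
    using J lnD Y a unfolding a_def[symmetric] by simp
  have r2: "4 \<le> real r ^ 2" using power_mono[of 2 "real r" 2] r by simp
  have "2867.2 * a\<^sup>2 * Y / w \<le> M"
  proof -
    have "2867.2 * a\<^sup>2 * Y / w = 716.8 * 4 * a\<^sup>2 * y / (y / Y * w)" using y Y w0 by (simp add: field_simps)
    also have "\<dots> \<le> 716.8 * 4 * a\<^sup>2 * y / D" using yw D y Y w0 by (intro divide_left_mono mult_pos_pos divide_pos_pos) auto
    also have "\<dots> \<le> 716.8 * real r ^ 2 * a\<^sup>2 * y / D"
      using r2 y D by (intro divide_right_mono mult_right_mono mult_left_mono) auto
    finally show ?thesis using M by (simp add: a_def)
  qed
  \<comment> \<open>For \<open>s \<ge> 3\<close> the bound \<open>w \<le> 192 * Y\<close> is enough.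
    For \<open>s = 2\<close> it fails, and the quadratic in \<open>Y\<close> is bounded by its chord
    on the interval from 1 to 8.\<close>
  moreover have "(5.21 * Y + 44.84 * a - 16.98) * w \<le> 8706 * a\<^sup>2 * Y"
  proof (cases "s = 2")
    case True
    then have a2: "a = 2" by (simp add: a_def)
    have Y8: "Y \<le> 8" using Y a2 a_def by simp
    have "0 \<le> (Y - 1) * (8 - Y)" using Y Y8 by simp
    then have YY: "Y * Y \<le> 9 * Y - 8" by (simp add: algebra_simps)
    have "(5.21 * Y + 44.84 * a - 16.98) * w = 1333.76 * (Y * Y) + 19278.08 * Y + 9305.6"
      by (simp add: w_def a2 field_simps)
    also have "\<dots> \<le> 8706 * a\<^sup>2 * Y" using YY Y by (simp add: a2)
    finally show ?thesis .
  next
    case False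
    then have a3: "3 \<le> a" using s by (simp add: a_def)
    have "2\<^sup>2 \<le> (a - 1)\<^sup>2" using a3 by (intro power_mono) auto
    then have "256 * Y / (a - 1)\<^sup>2 \<le> 256 * Y / 4" using Y by (intro divide_left_mono) auto
    then have w192: "w \<le> 192 * Y" using Y by (simp add: w_def)
    have aa: "3 * a \<le> a\<^sup>2" using a3 by (simp add: power2_eq_square)
    have "5.21 * Y + 44.84 * a - 16.98 \<le> 45 * a\<^sup>2" using aa Y(3) a3 unfolding a_def[symmetric] by (simp add: field_simps)
    then have "(5.21 * Y + 44.84 * a - 16.98) * w \<le> 45 * a\<^sup>2 * (192 * Y)"
      using w0 w192 Y a by (intro mult_mono) auto
    then show ?thesis using Y a by (simp add: mult.assoc) (smt (verit) mult_nonneg_nonneg zero_le_power2)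
  qed
  then have "5.21 * Y + 44.84 * a - 16.98 \<le> 8706 * a\<^sup>2 * Y / w" using w0 by (simp add: field_simps)
  moreover have "8706 * a\<^sup>2 * Y / w \<le> 3.0365 * (2867.2 * a\<^sup>2 * Y / w)"
    using w0 Y by (simp add: field_simps)
  moreover have "3.0365 * (2867.2 * a\<^sup>2 * Y / w) \<le> 3.0365 * M"
    using \<open>2867.2 * a\<^sup>2 * Y / w \<le> M\<close> by (rule mult_left_mono) simp
  ultimately show ?thesis using lhs by (meson order_trans)
qed

text \<open>For large \<open>y\<close> the pair bound no longer keeps \<open>D\<close> bounded, so
  the vertex degree bound \<open>273 * r * s^2\<close> is used instead. It leaves \<open>M\<close>
  at least \<open>2.6256 * r * y\<close> (716.8 / 273), and \<open>s^2 \<le> y / 2\<close> absorbs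
  all terms without \<open>y\<close>.\<close>

lemma exponent_bound_dense:
  fixes s r :: nat and y D M J :: real
  assumes r: "2 \<le> r" and s: "2 \<le> s" and y: "2 * real s ^ 2 \<le> y"
    and D: "1 \<le> D" "D \<le> 273 * real r * real s ^ 2"
    and M: "716.8 * real r ^ 2 * real s ^ 2 * y / D \<le> M"
    and J: "J \<le> 5.19 * y + (4 * real s - 3) * ln (32 * D) + 1"
  shows "1.00293 * J + 6.958 + 1.125 * ln D \<le> 3.0365 * M"
proof -
  define a b where "a = real s" and "b = real r"
  have a: "2 \<le> a" and b: "2 \<le> b" using s r by (simp_all add: a_def b_def)
  have y': "2 * a\<^sup>2 \<le> y" using y by (simp add: a_def)
  have y0: "0 < y" using y' a by (smt (verit) zero_less_power)
  have ln2: "ln (2::real) \<le> 25/36" by (rule ln2_le_25_over_36)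
  have "ln (256::real) = ln (2 ^ 8)" "ln (32::real) = ln (2 ^ 5)" by simp_all
  then have lnp: "ln (256::real) = 8 * ln 2" "ln (32::real) = 5 * ln 2" by (simp_all only: ln_realpow)
  have "ln (273::real) = ln (256 * (273/256))" by simp
  also have "\<dots> = ln 256 + ln (273/256)" by (rule ln_mult_pos) auto
  finally have ln273: "ln (273::real) \<le> 5.622" using ln_le_minus_one[of "273/256::real"] ln2 lnp by simp
  have "ln D \<le> ln (273 * b * a\<^sup>2)" using D by (subst ln_le_cancel_iff) (auto simp: a_def b_def)
  also have "\<dots> = ln 273 + ln b + 2 * ln a" using a b by (simp add: ln_mult ln_realpow)
  finally have lnD: "ln D \<le> b / 2 + a + 4.7054"
    using ln273 ln_le_tangent[of b 2] ln_le_tangent[of a 2] a b ln2 by simp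
  have "ln (32 * D) = ln 32 + ln D" using D by (simp add: ln_mult)
  then have ln32D: "ln (32 * D) \<le> b / 2 + a + 8.1777" using lnD lnp ln2 by simp
  have mulJ: "(4 * a - 3) * ln (32 * D) \<le> (4 * a - 3) * (b / 2 + a + 8.1777)" using ln32D a by (intro mult_left_mono) auto
  have lhs: "1.00293 * J + 6.958 + 1.125 * ln D
      \<le> 5.21 * y + 1.00293 * ((4 * a - 3) * (b / 2 + a + 8.1777)) + 1.125 * (b / 2 + a + 4.7054) + 7.961"
  proof -
    define Q Q' where "Q = (4 * a - 3) * ln (32 * D)" and "Q' = (4 * a - 3) * (b / 2 + a + 8.1777)"
    have "Q \<le> Q'" "J \<le> 5.19 * y + Q + 1"
      using mulJ J by (simp_all add: Q_def Q'_def a_def)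
    then show ?thesis using lnD y0 unfolding Q'_def[symmetric] by (simp add: field_simps)
  qed
  have "2.6256 * b * y \<le> M"
  proof -
    have Dp: "D \<le> 273 * b * a\<^sup>2" using D by (simp add: a_def b_def)
    have "2.6256 * b * y \<le> 716.8 * b\<^sup>2 * a\<^sup>2 * y / (273 * b * a\<^sup>2)"
      using y0 a b by (simp add: field_simps power2_eq_square)
    also have "\<dots> \<le> 716.8 * b\<^sup>2 * a\<^sup>2 * y / D" using Dp D y0 by (intro divide_left_mono) auto
    also have "\<dots> \<le> M" using M unfolding a_def b_def .
    finally show ?thesis .
  qed
  then have b4: "3.0365 * (2.6256 * b * y) \<le> 3.0365 * M" by (rule mult_left_mono) simp
  have b3: "7.972 * (b * y) \<le> 3.0365 * (2.6256 * b * y)" using b y0 by simp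
  have "2 * y \<le> b * y" using b y0 by simp
  moreover have "2 * (b * a\<^sup>2) \<le> b * y" using mult_left_mono[OF y', of b] b by simp
  moreover have "0 < b * y" using b y0 by simp
  ultimately have b2: "5.21 * y + 10.73 * (b * a\<^sup>2) \<le> 7.972 * (b * y)" by simp
  have b1: "1.00293 * ((4 * a - 3) * (b / 2 + a + 8.1777)) + 1.125 * (b / 2 + a + 4.7054) + 7.961 \<le> 10.73 * (b * a\<^sup>2)"
  proof -
    \<comment> \<open>Shifting both variables to their minimum 2 leaves a polynomial with
      nonnegative coefficients.\<close>
    define g h where "g = a - 2" and "h = b - 2"
    have gh: "0 \<le> g" "0 \<le> h" "0 \<le> g * h" "0 \<le> g * g" "0 \<le> h * (g * g)" using a b by (auto simp: g_def h_def)
    have ab: "a = g + 2" "b = h + 2" by (auto simp: g_def h_def)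
    have "10.73 * (b * a\<^sup>2) - (1.00293 * ((4 * a - 3) * (b / 2 + a + 8.1777)) + 1.125 * (b / 2 + a + 4.7054) + 7.961)
        = 1073/100 * (h * (g * g)) + 2045707/50000 * (g * h) + 1594007/40000 * h + 436207/25000 * (g * g) + 8714636839/250000000 * g + 2631634339/200000000 * 1"
      unfolding ab by (simp add: field_simps power2_eq_square)
    also have "0 \<le> \<dots>" using gh by (intro add_nonneg_nonneg mult_nonneg_nonneg) auto
    finally show ?thesis by simp
  qed
  have "1.00293 * J + 6.958 + 1.125 * ln D \<le> 5.21 * y + 10.73 * (b * a\<^sup>2)"
    using lhs b1 by (simp only: add.assoc)
  then show ?thesis using b2 b3 b4 by (meson order_trans)
qed

section \<open>Degrees and two-level weights\<close>

context uniform_hypergraph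
begin

lemma uniform_induced: "I \<subseteq> X \<Longrightarrow> uniform_hypergraph I (induced G I) s"
  using finX uniform s_pos by unfold_locales (auto simp: induced_def intro: finite_subset)

lemma sum_link_degrees:
  assumes "finite L" "L \<subseteq> X"
  shows "(\<Sum>x\<in>X - L. d_nu G \<rho> (insert x L)) = real (s - card L) * d_nu G \<rho> L"
proof -
  have "(\<Sum>x\<in>X - L. d_nu G \<rho> (insert x L)) = (\<Sum>E\<in>G. \<Sum>x\<in>X - L. if insert x L \<subseteq> E then \<rho> E else 0)"
    by (simp add: d_if sum.swap[of _ "X - L"])
  also have "\<dots> = (\<Sum>E\<in>G. if L \<subseteq> E then real (s - card L) * \<rho> E else 0)"
  proof (intro sum.cong refl)
    fix E assume E: "E \<in> G"
    show "(\<Sum>x\<in>X - L. if insert x L \<subseteq> E then \<rho> E else 0) = (if L \<subseteq> E then real (s - card L) * \<rho> E else 0)"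
    proof (cases "L \<subseteq> E")
      case True
      have "(\<Sum>x\<in>X - L. if insert x L \<subseteq> E then \<rho> E else 0) = (\<Sum>x\<in>{x \<in> X - L. x \<in> E}. \<rho> E)"
        using True finX by (subst sum.inter_filter) auto
      also have "{x \<in> X - L. x \<in> E} = E - L" using edgeD[OF E] by auto
      also have "(\<Sum>x\<in>E - L. \<rho> E) = real (s - card L) * \<rho> E"
        using True edgeD[OF E] assms by (simp add: card_Diff_subset)
      finally show ?thesis using True by simp
    qed auto
  qed
  also have "\<dots> = real (s - card L) * d_nu G \<rho> L"
    by (simp add: d_if sum_distrib_left if_distrib cong: if_cong)
  finally show ?thesis .
qed

lemma sum_degrees: "(\<Sum>x\<in>X. d_nu G \<rho> {x}) = real s * e_nu G \<rho>"
  using sum_link_degrees[of "{}" \<rho>] by (simp add: d_nu_def e_nu_def)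

lemma sum_square_degrees_lower:
  assumes "e_nu G \<rho> = 1"
  shows "real s ^ 2 \<le> card X * (\<Sum>x\<in>X. (d_nu G \<rho> {x})\<^sup>2)"
  using sum_squared_le_sum_of_squares[of "\<lambda>x. d_nu G \<rho> {x}" X] sum_degrees[of \<rho>] assms by (simp add: mult.commute)

lemma sum_pair_degrees:
  "(\<Sum>x\<in>X. \<Sum>y\<in>X - {x}. h {x, y}) = 2 * (\<Sum>L\<in>{L. L \<subseteq> X \<and> card L = 2}. h L :: real)"
proof -
  define S where "S = (SIGMA x:X. X - {x})"
  have "(\<Sum>x\<in>X. \<Sum>y\<in>X - {x}. h {x, y}) = (\<Sum>(x, y)\<in>S. h {x, y})"
    unfolding S_def using finX by (subst sum.Sigma) auto
  also have "\<dots> = (\<Sum>L\<in>{L. L \<subseteq> X \<and> card L = 2}. \<Sum>z\<in>{z\<in>S. {fst z, snd z} = L}. h {fst z, snd z})"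
  proof (subst sum.group)
    show "finite S" unfolding S_def using finX by auto
    show "finite {L. L \<subseteq> X \<and> card L = 2}" using finX by simp
    show "(\<lambda>z. {fst z, snd z}) ` S \<subseteq> {L. L \<subseteq> X \<and> card L = 2}" unfolding S_def by auto
  qed (simp add: case_prod_beta)
  also have "\<dots> = (\<Sum>L\<in>{L. L \<subseteq> X \<and> card L = 2}. 2 * h L)"
  proof (intro sum.cong refl)
    fix L assume "L \<in> {L. L \<subseteq> X \<and> card L = 2}"
    then obtain a b where L: "L = {a, b}" "a \<noteq> b" "a \<in> X" "b \<in> X" by (auto simp: card_2_iff)
    have "{z\<in>S. {fst z, snd z} = L} = {(a, b), (b, a)}"
      using L by (auto simp: S_def doubleton_eq_iff)
    then show "(\<Sum>z\<in>{z\<in>S. {fst z, snd z} = L}. h {fst z, snd z}) = 2 * h L"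
      using L by (simp add: insert_commute)
  qed
  finally show ?thesis by (simp add: sum_distrib_left)
qed

text \<open>The pair degrees at a vertex add up to \<open>s - 1\<close> times its degree, so
  Cauchy-Schwarz over at most \<open>card X\<close> partners applies; the 2 counts each pair from
  both ends. This turns control of pairs into control of vertex degrees when pn is small.\<close>

lemma sum_square_degrees_le_pairs:
  "(real s - 1)\<^sup>2 * (\<Sum>x\<in>X. (d_nu G \<rho> {x})\<^sup>2)
    \<le> 2 * real (card X) * (\<Sum>L\<in>{L. L \<subseteq> X \<and> card L = 2}. (d_nu G \<rho> L)\<^sup>2)"
proof -
  have "(real s - 1)\<^sup>2 * (\<Sum>x\<in>X. (d_nu G \<rho> {x})\<^sup>2) = (\<Sum>x\<in>X. (\<Sum>y\<in>X - {x}. d_nu G \<rho> {x, y})\<^sup>2)"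
    unfolding sum_distrib_left
  proof (intro sum.cong refl)
    fix x assume "x \<in> X"
    then show "(real s - 1)\<^sup>2 * (d_nu G \<rho> {x})\<^sup>2 = (\<Sum>y\<in>X - {x}. d_nu G \<rho> {x, y})\<^sup>2"
      using sum_link_degrees[of "{x}" \<rho>] s_pos by (simp add: insert_commute power_mult_distrib of_nat_diff)
  qed
  also have "\<dots> \<le> (\<Sum>x\<in>X. real (card X) * (\<Sum>y\<in>X - {x}. (d_nu G \<rho> {x, y})\<^sup>2))"
  proof (rule sum_mono)
    fix x assume "x \<in> X"
    have "(\<Sum>y\<in>X - {x}. d_nu G \<rho> {x, y})\<^sup>2 \<le> (\<Sum>y\<in>X - {x}. (d_nu G \<rho> {x, y})\<^sup>2) * card (X - {x})"
      by (rule sum_squared_le_sum_of_squares)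
    also have "\<dots> \<le> (\<Sum>y\<in>X - {x}. (d_nu G \<rho> {x, y})\<^sup>2) * card X"
      using finX by (intro mult_left_mono sum_nonneg) (auto intro: card_mono)
    finally show "(\<Sum>y\<in>X - {x}. d_nu G \<rho> {x, y})\<^sup>2 \<le> real (card X) * (\<Sum>y\<in>X - {x}. (d_nu G \<rho> {x, y})\<^sup>2)"
      by (simp add: mult.commute)
  qed
  also have "\<dots> = real (card X) * (\<Sum>x\<in>X. \<Sum>y\<in>X - {x}. (d_nu G \<rho> {x, y})\<^sup>2)"
    by (simp add: sum_distrib_left)
  also have "\<dots> = 2 * real (card X) * (\<Sum>L\<in>{L. L \<subseteq> X \<and> card L = 2}. (d_nu G \<rho> L)\<^sup>2)"
    unfolding sum_pair_degrees[of "\<lambda>L. (d_nu G \<rho> L)\<^sup>2"] by simp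
  finally show ?thesis .
qed

lemma sum_singletons: "(\<Sum>L\<in>{L. L \<subseteq> X \<and> card L = 1}. h L) = (\<Sum>x\<in>X. h {x})"
proof -
  have "{L. L \<subseteq> X \<and> card L = 1} = (\<lambda>x. {x}) ` X" by (auto simp: card_1_singleton_iff)
  then show ?thesis by (simp add: sum.reindex)
qed

lemma nesub_split: "nesub X = {L. L \<subseteq> X \<and> card L = 1} \<union> {L. L \<subseteq> X \<and> 2 \<le> card L}"
proof -
  have "L \<noteq> {} \<longleftrightarrow> card L = 1 \<or> 2 \<le> card L" if "L \<subseteq> X" for L
    using finite_subset[OF that finX] by (cases "card L") auto
  then show ?thesis unfolding nesub_def by auto
qed

text \<open>Raising the weight from \<open>p\<close> to \<open>b\<close> shrinks the terms with |L|
  \<ge> 2 by at least (p/b)^2. Singletons are kept apart because \<open>Lambda\<close> does not see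
  them.\<close>

lemma energy_const_le:
  assumes p: "0 < p" "p \<le> b"
  shows "energy X G (\<lambda>_. b) \<rho> \<le> (\<Sum>x\<in>X. (d_nu G \<rho> {x})\<^sup>2) / b
     + (p / b)\<^sup>2 * (\<Sum>L\<in>{L. L \<subseteq> X \<and> 2 \<le> card L}. (d_nu G \<rho> L)\<^sup>2 / p ^ card L)"
proof -
  let ?h = "\<lambda>L. (d_nu G \<rho> L)\<^sup>2 / b ^ card L"
  have "energy X G (\<lambda>_. b) \<rho> = sum ?h {L. L \<subseteq> X \<and> card L = 1} + sum ?h {L. L \<subseteq> X \<and> 2 \<le> card L}"
    unfolding energy_def nesub_split wt_def using finX by (subst sum.union_disjoint) auto
  also have "sum ?h {L. L \<subseteq> X \<and> card L = 1} = (\<Sum>x\<in>X. (d_nu G \<rho> {x})\<^sup>2) / b"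
    by (subst sum_singletons) (simp add: sum_divide_distrib)
  also have "sum ?h {L. L \<subseteq> X \<and> 2 \<le> card L}
      \<le> (\<Sum>L\<in>{L. L \<subseteq> X \<and> 2 \<le> card L}. (p / b)\<^sup>2 * ((d_nu G \<rho> L)\<^sup>2 / p ^ card L))"
  proof (rule sum_mono)
    fix L assume "L \<in> {L. L \<subseteq> X \<and> 2 \<le> card L}"
    then have "(p / b) ^ card L \<le> (p / b) ^ 2" using p by (intro power_decreasing) auto
    then have "(p / b) ^ card L * ((d_nu G \<rho> L)\<^sup>2 / p ^ card L) \<le> (p / b)\<^sup>2 * ((d_nu G \<rho> L)\<^sup>2 / p ^ card L)"
      using p by (intro mult_right_mono) auto
    then show "?h L \<le> (p / b)\<^sup>2 * ((d_nu G \<rho> L)\<^sup>2 / p ^ card L)"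
      using p by (simp add: power_divide)
  qed
  finally show ?thesis by (simp add: sum_distrib_left)
qed

lemma d_nu_large: "s < card L \<Longrightarrow> d_nu G \<rho> L = 0"
proof -
  assume "s < card L"
  then have "{E \<in> G. L \<subseteq> E} = {}" using edgeD card_mono by (metis (mono_tags, lifting) Collect_empty_eq leD)
  then show ?thesis unfolding d_nu_def by (simp only: sum.empty)
qed

text \<open>An explicit cover: edges inside \<open>I\<close> are covered by the equilibrium
  potential of \<open>I\<close> at weight \<open>t\<close>, all others by singletons outside
  \<open>I\<close>. Passing from \<open>t\<close> to \<open>u + c\<close> costs one factor per
  element of \<open>L\<close>, hence at most \<open>s\<close> of them.\<close>

lemma capacity_two_level:
  fixes u t c :: real
  assumes I: "I \<subseteq> X" and u: "0 < u" and t: "0 < t" "t \<le> u + c" and c: "0 \<le> c"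
  shows "capacity G (\<lambda>y. u + (if y \<in> I then c else 0))
     \<le> card X * u + ((u + c) / t) ^ s * capacity (induced G I) (\<lambda>_. t)"
proof -
  interpret GI: uniform_hypergraph I "induced G I" s by (rule uniform_induced[OF I])
  define m where "m y = u + (if y \<in> I then c else 0)" for y
  define d where "d = d_nu (induced G I) (eqm (induced G I) (\<lambda>_. t))"
  have tp: "\<forall>x\<in>I. 0 < t" using t by simp
  have d0: "0 \<le> d L" for L unfolding d_def using GI.eqm_nonneg[OF tp] by (rule GI.d_nonneg)
  define W where "W L = (if L \<subseteq> I then d L / wt (\<lambda>_. t) L else if card L = 1 then 1 else 0)" for L
  have W0: "0 \<le> W L" for L unfolding W_def wt_def using d0 t by auto
  have m: "\<forall>x\<in>X. 0 < m x" using u c by (auto simp: m_def)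
  have cover: "1 \<le> (\<Sum>L\<in>nesub E. W L)" if E: "E \<in> G" for E
  proof (cases "E \<subseteq> I")
    case True
    then have "1 \<le> potential (induced G I) (\<lambda>_. t) (eqm (induced G I) (\<lambda>_. t)) E"
      using GI.eqm_equilibrium[OF tp] E by (auto simp: equilibrium_def induced_def)
    also have "\<dots> = (\<Sum>L\<in>nesub E. W L)"
      unfolding potential_def d_def[symmetric] using True by (intro sum.cong refl) (auto simp: W_def nesub_def)
    finally show ?thesis .
  next
    case False
    then obtain x where x: "x \<in> E" "x \<notin> I" by blast
    have "1 = W {x}" using x by (simp add: W_def)
    also have "\<dots> \<le> (\<Sum>L\<in>nesub E. W L)"
      using x W0 edgeD[OF E] by (intro member_le_sum) (auto simp: nesub_def)
    finally show ?thesis .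
  qed
  have "capacity G m \<le> (\<Sum>L\<in>nesub X. (W L)\<^sup>2 * wt m L)" by (rule capacity_le_cover[OF m cover])
  also have "\<dots> = (\<Sum>L\<in>nesub I. (W L)\<^sup>2 * wt m L) + (\<Sum>L\<in>nesub X - nesub I. (W L)\<^sup>2 * wt m L)"
    using I fin_nesub by (subst sum.subset_diff[of "nesub I"]) (auto simp: nesub_def)
  also have "(\<Sum>L\<in>nesub X - nesub I. (W L)\<^sup>2 * wt m L) \<le> card X * u"
  proof -
    have "(\<Sum>L\<in>nesub X - nesub I. (W L)\<^sup>2 * wt m L) = (\<Sum>L\<in>{L \<in> nesub X - nesub I. card L = 1}. (W L)\<^sup>2 * wt m L)"
      using fin_nesub by (intro sum.mono_neutral_right) (auto simp: W_def nesub_def)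
    also have "\<dots> = (\<Sum>L\<in>(\<lambda>x. {x}) ` (X - I). (W L)\<^sup>2 * wt m L)"
      by (intro sum.cong refl) (auto simp: nesub_def card_1_singleton_iff)
    also have "\<dots> = (\<Sum>x\<in>X - I. u)"
      by (subst sum.reindex) (auto simp: W_def wt_def m_def)
    also have "\<dots> \<le> card X * u" using u finX by (auto intro!: mult_right_mono card_mono)
    finally show ?thesis .
  qed
  also have "(\<Sum>L\<in>nesub I. (W L)\<^sup>2 * wt m L) \<le> (\<Sum>L\<in>nesub I. ((u + c) / t) ^ s * ((d L)\<^sup>2 / wt (\<lambda>_. t) L))"
  proof (rule sum_mono)
    fix L assume L: "L \<in> nesub I"
    have wm: "wt m L = (u + c) ^ card L" unfolding wt_def using L by (simp add: m_def nesub_def subset_iff)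
    have "(W L)\<^sup>2 * wt m L = ((u + c) / t) ^ card L * ((d L)\<^sup>2 / wt (\<lambda>_. t) L)"
      using L t wm by (simp add: W_def nesub_def wt_def power_divide power2_eq_square)
    also have "\<dots> \<le> ((u + c) / t) ^ s * ((d L)\<^sup>2 / wt (\<lambda>_. t) L)"
    proof (cases "card L \<le> s")
      case True
      then show ?thesis using t by (intro mult_right_mono power_increasing) (auto simp: wt_def)
    next
      case False
      then have "d L = 0" unfolding d_def by (intro GI.d_nu_large) auto
      then show ?thesis by simp
    qed
    finally show "(W L)\<^sup>2 * wt m L \<le> ((u + c) / t) ^ s * ((d L)\<^sup>2 / wt (\<lambda>_. t) L)" .
  qed
  also have "\<dots> = ((u + c) / t) ^ s * capacity (induced G I) (\<lambda>_. t)"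
    using GI.energy_eqm[OF tp] unfolding energy_def d_def by (simp only: sum_distrib_left[symmetric])
  finally show ?thesis unfolding m_def by simp
qed

end

section \<open>The branching step\<close>

text \<open>Each step takes the smaller of the decreases by \<Delta> and by the factor 1 + e, so
  both step conditions hold; whichever is taken raises one of the two terms of the last bound by
  1.\<close>

lemma decreasing_weights:
  fixes b \<Delta> e :: real
  assumes b: "0 < b" and \<Delta>: "0 < \<Delta>" and e: "0 < e"
  obtains u :: "nat \<Rightarrow> real" where "u 0 = b" "\<And>i. 0 < u i" "\<And>i. u (Suc i) \<le> u i"
    "\<And>i. u i \<le> (1 + e) * u (Suc i)" "\<And>i. u i - u (Suc i) \<le> \<Delta>"
    "\<And>i. real i \<le> (b - u i) / \<Delta> + ln (b / u i) / ln (1 + e)"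
proof -
  define u where "u = rec_nat b (\<lambda>_ x. max (x - \<Delta>) (x / (1 + e)))"
  have u0: "u 0 = b" and uS: "u (Suc i) = max (u i - \<Delta>) (u i / (1 + e))" for i
    by (simp_all add: u_def)
  have pos: "0 < u i" for i by (induction i) (use b e in \<open>auto simp: u0 uS less_max_iff_disj\<close>)
  have dec: "u (Suc i) \<le> u i" for i using pos[of i] e \<Delta> by (simp add: uS field_simps)
  have ratio: "u i \<le> (1 + e) * u (Suc i)" for i
  proof -
    have "u i = (1 + e) * (u i / (1 + e))" using e by simp
    also have "\<dots> \<le> (1 + e) * u (Suc i)" using e by (intro mult_left_mono) (auto simp: uS)
    finally show ?thesis .
  qed
  have le: "ln 1 < ln (1 + e)" using e by (subst ln_less_cancel_iff) auto
  have steps: "real i \<le> (b - u i) / \<Delta> + ln (b / u i) / ln (1 + e)" for i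
  proof (induction i)
    case 0
    show ?case using b by (simp add: u0)
  next
    case (Suc i)
    have lnu: "ln (b / u j) = ln b - ln (u j)" for j using b pos[of j] by (simp add: ln_div)
    have ln_dec: "ln (u (Suc i)) \<le> ln (u i)" using dec pos by simp
    have "1 \<le> (u i - u (Suc i)) / \<Delta> + (ln (u i) - ln (u (Suc i))) / ln (1 + e)"
    proof (cases "u (Suc i) = u i - \<Delta>")
      case True
      have "0 \<le> (ln (u i) - ln (u (Suc i))) / ln (1 + e)" using ln_dec le by simp
      moreover have "(u i - u (Suc i)) / \<Delta> = 1" using True \<Delta> by simp
      ultimately show ?thesis by linarith
    next
      case False
      then have "u (Suc i) = u i / (1 + e)" unfolding uS by linarith
      then have "ln (u (Suc i)) = ln (u i) - ln (1 + e)" using pos[of i] e by (simp add: ln_div)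
      then have "(ln (u i) - ln (u (Suc i))) / ln (1 + e) = 1" using le by simp
      moreover have "0 \<le> (u i - u (Suc i)) / \<Delta>" using dec[of i] \<Delta> by simp
      ultimately show ?thesis by linarith
    qed
    then show ?case using Suc unfolding lnu by (simp add: diff_divide_distrib)
  qed
  show ?thesis by (rule that[of u]) (use u0 pos dec ratio steps \<Delta> in \<open>auto simp: uS\<close>)
qed

text \<open>The origin of 3.06: per unit of qN and with l = ln(2/q), the list of sets costs 3.06 l
  and the traces cost (1 + l)/2, while at least 4l * 15/16 is available. With l \<ge> 8/3 this just
  fits.\<close>

lemma branching_exponent:
  fixes q x N :: real
  assumes q: "0 < q" "q < 1/8" and N: "0 \<le> N" and x: "x \<le> exp (3.06 * ln (2/q) * (q * N))"
  shows "x * exp (q/2 * N * (1 + ln (1 / (q/2)))) \<le> exp (4 * q * ln (2/q) * (1 - q/2) * N)"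
proof -
  define l where "l = ln (2/q)"
  have ln2: "2/3 \<le> ln (2::real)" by (rule ln2_ge_two_thirds)
  have "ln (16::real) = ln (2 ^ 4)" by simp
  then have ln16: "ln (16::real) = 4 * ln 2" by (simp only: ln_realpow)
  have "ln 16 \<le> l" unfolding l_def using q by (simp add: field_simps)
  then have l: "8/3 \<le> l" using ln16 ln2 by simp
  have "4 * l * (15/16) \<le> 4 * l * (1 - q/2)" using q l by (intro mult_left_mono) auto
  moreover have "3.06 * l + (1 + l) / 2 \<le> 4 * l * (15/16)" using l by (simp add: field_simps)
  ultimately have "3.06 * l + (1 + l) / 2 \<le> 4 * l * (1 - q/2)" by (rule order_trans[rotated])
  then have "(3.06 * l + (1 + l) / 2) * (q * N) \<le> (4 * l * (1 - q/2)) * (q * N)"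
    using q N by (intro mult_right_mono) auto
  then have le: "3.06 * l * (q * N) + q/2 * N * (1 + l) \<le> 4 * q * l * (1 - q/2) * N"
    by (simp add: algebra_simps)
  have "x * exp (q/2 * N * (1 + l)) \<le> exp (3.06 * l * (q * N)) * exp (q/2 * N * (1 + l))"
    using x by (intro mult_right_mono) (auto simp: l_def)
  also have "\<dots> \<le> exp (4 * q * l * (1 - q/2) * N)" using le by (simp add: exp_add[symmetric])
  finally show ?thesis by (simp add: l_def)
qed

lemma exp_quarter: "exp (1/4::real) \<le> 1.285"
proof (rule power_le_imp_le_base[of _ 3])
  have "exp (1/4::real) ^ Suc 3 = exp 1" by (simp add: exp_of_nat_mult[symmetric])
  also have "\<dots> \<le> 2.72" using e_less_272 by simp
  also have "\<dots> \<le> 1.285 ^ Suc 3" by (simp add: power_numeral_reduce)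
  finally show "exp (1/4::real) ^ Suc 3 \<le> 1.285 ^ Suc 3" .
qed simp

context uniform_hypergraph
begin

text \<open>The given measure has energy at most \<open>D / (b * N)\<close>, so the capacity at
  weight \<open>b\<close> is at least \<open>Z = b * N / D\<close>. For an \<open>I\<close> of tiny
  capacity, the non-hit terms of the sampling bound explain less than 0.942 \<open>Z\<close>; the
  rest must come from hits, which gives the fraction \<delta> of sample lists.\<close>

lemma spread_step:
  fixes p q :: real and r n :: nat
  assumes s: "2 \<le> s" and r: "2 \<le> r" and q: "0 < q" "q < 1/8"
    and p: "0 < p" "p \<le> q / (2^10 * real r^2 * real s^2)" and n: "card X \<le> n"
    and \<mu>: "\<And>E. E \<in> G \<Longrightarrow> 0 \<le> \<mu> E" "e_nu G \<mu> = 1"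
    and pairs: "(\<Sum>L\<in>{L. L \<subseteq> X \<and> 2 \<le> card L}. (d_nu G \<mu> L)\<^sup>2 / p ^ card L) \<le> 128 / (p * n)"
    and degs: "(\<Sum>x\<in>X. (d_nu G \<mu> {x})\<^sup>2) \<le> 257 * real r * real s ^ 2 / n"
  shows "\<exists>PP. finite PP \<and>
       (\<forall>P\<in>PP. P \<subseteq> X \<and> P \<noteq> {} \<and> card PP * exp (q/2 * card P * (1 + ln (1 / (q/2)))) \<le> exp (4 * q * ln (2/q) * (1 - q/2) * card P)) \<and>
       (\<forall>I. I \<subseteq> X \<and> capacity (induced G I) (\<lambda>_. p/2) \<le> 2 * p^4 * n * (q/2)^(4 * s) \<longrightarrow> (\<exists>P\<in>PP. card (I \<inter> P) < q/2 * card P))"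
proof -
  define \<sigma> where "\<sigma> = (\<Sum>x\<in>X. (d_nu G \<mu> {x})\<^sup>2)"
  define S2 where "S2 = (\<Sum>L\<in>{L. L \<subseteq> X \<and> 2 \<le> card L}. (d_nu G \<mu> L)\<^sup>2 / p ^ card L)"
  define N where "N = real n"
  define a where "a = real s"
  define c where "c = real r"
  have a: "2 \<le> a" and c: "2 \<le> c" using s r by (auto simp: a_def c_def)
  have "G \<noteq> {}" using \<mu>(2) by (auto simp: e_nu_def)
  then obtain E where "E \<in> G" by blast
  then have cX: "s \<le> card X" using edgeD[of E] finX card_mono by metis
  then have N: "2 \<le> N" "real (card X) \<le> N" using s n by (auto simp: N_def)
  have N0: "0 < N" using N by simp
  have S2: "S2 \<le> 128 / (p * N)" using pairs by (simp add: S2_def N_def)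
  have \<sigma>1: "\<sigma> * N \<le> 257 * c * a\<^sup>2" using degs N0 by (simp add: \<sigma>_def N_def c_def a_def field_simps)
  have \<sigma>0: "0 \<le> \<sigma>" unfolding \<sigma>_def by (intro sum_nonneg) auto
  have "a\<^sup>2 \<le> card X * \<sigma>" unfolding a_def \<sigma>_def by (rule sum_square_degrees_lower[OF \<mu>(2)])
  also have "\<dots> \<le> N * \<sigma>" using N \<sigma>0 by (intro mult_right_mono) auto
  finally have \<sigma>2: "a\<^sup>2 \<le> \<sigma> * N" by (simp add: mult.commute)
  have \<sigma>3: "(a - 1)\<^sup>2 * \<sigma> \<le> 256 * p"
  proof -
    have "(\<Sum>L\<in>{L. L \<subseteq> X \<and> card L = 2}. (d_nu G \<mu> L)\<^sup>2) = p\<^sup>2 * (\<Sum>L\<in>{L. L \<subseteq> X \<and> card L = 2}. (d_nu G \<mu> L)\<^sup>2 / p ^ card L)"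
      using p by (simp add: sum_distrib_left)
    also have "\<dots> \<le> p\<^sup>2 * S2" unfolding S2_def using finX p by (intro mult_left_mono sum_mono2) auto
    also have "\<dots> \<le> p\<^sup>2 * (128 / (p * N))" using S2 by (intro mult_left_mono) auto
    also have "\<dots> = 128 * p / N" using p by (simp add: power2_eq_square)
    finally have *: "(\<Sum>L\<in>{L. L \<subseteq> X \<and> card L = 2}. (d_nu G \<mu> L)\<^sup>2) \<le> 128 * p / N" .
    have "(a - 1)\<^sup>2 * \<sigma> \<le> 2 * real (card X) * (\<Sum>L\<in>{L. L \<subseteq> X \<and> card L = 2}. (d_nu G \<mu> L)\<^sup>2)"
      unfolding a_def \<sigma>_def by (rule sum_square_degrees_le_pairs)
    also have "\<dots> \<le> 2 * N * (128 * p / N)" using * N by (intro mult_mono sum_nonneg) auto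
    finally show ?thesis using N0 by simp
  qed
  define y where "y = p * N"
  have y0: "0 < y" using p N0 by (simp add: y_def)
  have a1: "1 \<le> (a - 1)\<^sup>2" using a power_mono[of 1 "a - 1" 2] by simp
  have a2: "4 \<le> a\<^sup>2" using a power_mono[of 2 a 2] by simp
  have \<sigma>4: "\<sigma> * N \<le> 256 * y / (a - 1)\<^sup>2"
  proof -
    have "(a - 1)\<^sup>2 * \<sigma> * N \<le> 256 * p * N" using \<sigma>3 N0 by (intro mult_right_mono) auto
    moreover have "0 < (a - 1)\<^sup>2" using a1 by linarith
    ultimately show ?thesis by (simp add: y_def pos_le_divide_eq mult_ac)
  qed
  have y64: "1/64 \<le> y"
  proof -
    have "256 * y / (a - 1)\<^sup>2 \<le> 256 * y / 1" using a1 y0 by (intro divide_left_mono) auto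
    then show ?thesis using \<sigma>2 \<sigma>4 a2 by linarith
  qed
  \<comment> \<open>If \<open>p * N < 1\<close>, raising the weight to \<open>1 / N\<close> shrinks
    the pair part of the energy so much that \<open>D\<close> becomes proportional to
    \<open>y\<close>, which keeps \<open>M\<close> bounded below. Since \<open>y \<ge> 1/64\<close>,
    the weight grows by a factor of at most 64.\<close>
  define b where "b = max p (1 / N)"
  define Y where "Y = b * N"
  have b: "0 < b" "p \<le> b" using p by (auto simp: b_def)
  have Y: "Y = max y 1" unfolding Y_def b_def y_def using N0 by (auto simp: max_def field_simps)
  have Yb: "1 \<le> Y" "y \<le> Y" using Y by auto
  have yY: "y / Y = p / b" using N0 by (simp add: y_def Y_def)
  have "Y \<le> 64 * y" using Y y64 by auto
  then have b64: "b \<le> 64 * p" unfolding Y_def y_def using N0 by (simp flip: mult.assoc)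
  have pq: "1024 * c\<^sup>2 * a\<^sup>2 * p \<le> q" using p(2) a c by (simp add: a_def c_def field_simps)
  have c2: "4 \<le> c\<^sup>2" using c power_mono[of 2 c 2] by simp
  have "4 * 4 \<le> c\<^sup>2 * a\<^sup>2" using c2 a2 by (intro mult_mono) auto
  then have "16 * p \<le> c\<^sup>2 * a\<^sup>2 * p" using p by (intro mult_right_mono) auto
  then have pq14: "16384 * p \<le> q" using pq by simp
  then have "16384 * p * N \<le> q * N" using N0 by (intro mult_right_mono) auto
  then have qN: "256 \<le> q * N" using y64 by (simp add: y_def)
  define D where "D = \<sigma> * N + 128 * y / Y"
  have "0 \<le> 128 * y / Y" using y0 Yb by simp
  then have D1: "4 \<le> D" using \<sigma>2 a2 unfolding D_def by linarith
  have DA: "D \<le> 256 * y / (a - 1)\<^sup>2 + 128 * y / Y" using \<sigma>4 by (simp add: D_def)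
  have ca: "8 \<le> c * a\<^sup>2" using mult_mono[of 2 c 4 "a\<^sup>2"] c a2 by simp
  have DB: "D \<le> 273 * c * a\<^sup>2"
  proof -
    have "y / Y \<le> 1" using Yb y0 by simp
    then show ?thesis using \<sigma>1 ca by (simp add: D_def)
  qed
  have bpos: "\<forall>x\<in>X. 0 < b" using b by simp
  have energy: "energy X G (\<lambda>_. b) \<mu> \<le> D / (b * N)"
  proof -
    have "energy X G (\<lambda>_. b) \<mu> \<le> \<sigma> / b + (p / b)\<^sup>2 * S2"
      unfolding \<sigma>_def S2_def by (rule energy_const_le[OF p(1) b(2)])
    also have "\<dots> \<le> \<sigma> / b + (p / b)\<^sup>2 * (128 / (p * N))" using S2 by (intro add_left_mono mult_left_mono) auto
    also have "\<dots> = D / (b * N)" unfolding D_def times_divide_eq_right[symmetric] yY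
      using b p N0 by (simp add: field_simps power2_eq_square)
    finally show ?thesis .
  qed
  define C0 where "C0 = capacity G (\<lambda>_. b)"
  have C0_nonneg: "0 \<le> C0" unfolding C0_def by (rule capacity_nonneg[OF bpos])
  have C0: "b * N / D \<le> C0"
  proof -
    have "1 \<le> C0 * energy X G (\<lambda>_. b) \<mu>" using capacity_ge_ratio[where \<sigma> = \<mu>, OF bpos \<mu>(1)] \<mu>(2) by (simp add: C0_def)
    also have "\<dots> \<le> C0 * (D / (b * N))" using energy C0_nonneg by (rule mult_left_mono)
    finally show ?thesis using b N0 D1 by (simp add: field_simps)
  qed
  have "C0 \<le> card X * b" unfolding C0_def using capacity_le_sum[OF bpos] by simp
  then have "b * N / D \<le> card X * b" using C0 by simp
  then have ND: "N / D \<le> card X" using b D1 by (simp add: field_simps)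
  \<comment> \<open>The vertices outside the density condition may use up to
    \<open>F * b * m0\<close>; as 0.7 * 1.285 < 0.9, this is at most 0.9 of the capacity.\<close>
  define m0 where "m0 = 7/10 * (N / D)"
  have ND0: "0 < N / D" using N0 D1 by simp
  have m0: "0 < m0" "m0 \<le> card X" using ND ND0 by (auto simp: m0_def)
  \<comment> \<open>The ratio \<open>e\<close> is chosen with \<open>(s - 1) * e = 1/4\<close>, so
    linearising costs at most exp(1/4), which is below 1.285.\<close>
  define F e \<kappa> :: real where "F = 1.285" and "e = 1 / (4 * (a - 1))" and "\<kappa> = q / 2"
  have e0: "0 < e" using a by (simp add: e_def)
  have Fe: "(1 + e) ^ (s - 1) \<le> F"
  proof -
    have "(1 + e) ^ (s - 1) \<le> exp e ^ (s - 1)" using e0 by (intro power_mono exp_ge_add_one_self) auto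
    also have "\<dots> = exp (real (s - 1) * e)" by (rule exp_of_nat_mult[symmetric])
    also have "real (s - 1) * e = 1/4" using a s by (simp add: e_def a_def of_nat_diff)
    finally show ?thesis using exp_quarter by (simp add: F_def)
  qed
  have \<kappa>: "0 < \<kappa>" "\<kappa> \<le> 1" using q by (auto simp: \<kappa>_def)
  define k0 where "k0 = nat \<lceil>\<kappa> * card X\<rceil>"
  have kX: "0 < \<kappa> * card X" using \<kappa> cX s by simp
  have k0: "\<kappa> * card X \<le> real k0" "real k0 < \<kappa> * card X + 1" using kX unfolding k0_def by linarith+
  have k0p: "0 < real k0" using k0 kX by simp
  \<comment> \<open>The largest decrement for which the sampled increment
    \<open>2 * F * \<Delta> * k0 / \<kappa>\<close> is at most 1/2.\<close>
  define \<Delta> where "\<Delta> = \<kappa> / (4 * F * k0)"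
  have \<Delta>: "0 < \<Delta>" using \<kappa> k0p by (simp add: \<Delta>_def F_def)
  obtain u :: "nat \<Rightarrow> real" where u: "u 0 = b" "\<And>i. 0 < u i" "\<And>i. u (Suc i) \<le> u i"
    "\<And>i. u i \<le> (1 + e) * u (Suc i)" "\<And>i. u i - u (Suc i) \<le> \<Delta>"
    "\<And>i. real i \<le> (b - u i) / \<Delta> + ln (b / u i) / ln (1 + e)"
    using decreasing_weights[OF b(1) \<Delta> e0] by blast
  \<comment> \<open>The number of steps that brings the weight down to \<open>b / (32 * D)\<close>:
    the first term bounds the steps of size \<Delta>, the second the geometric ones, as
    \<open>4 * a - 3\<close> bounds \<open>1 / ln (1 + e)\<close>.\<close>
  define T where "T = b / \<Delta> + (4 * a - 3) * ln (32 * D)"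
  have lnD0: "0 \<le> ln (32 * D)" using D1 by simp
  have T0: "0 \<le> T" unfolding T_def using b \<Delta> a lnD0 by simp
  define J where "J = nat \<lfloor>T\<rfloor> + 1"
  have J: "T < real J" "real J \<le> T + 1" using T0 unfolding J_def by linarith+
  have uJ: "u J \<le> b / (32 * D)"
  proof (rule ccontr)
    assume "\<not> u J \<le> b / (32 * D)"
    then have "b / (32 * D) < u J" by simp
    then have less: "b / u J < 32 * D" using u(2)[of J] D1 by (simp add: field_simps)
    have "ln (b / u J) \<le> ln (32 * D)" using less b u(2)[of J] D1 by (subst ln_le_cancel_iff) auto
    moreover have ge: "1 / (4 * a - 3) \<le> ln (1 + e)"
    proof -
      have "1 - 1 / (1 + e) \<le> ln (1 + e)"
        using ln_le_minus_one[of "1 / (1 + e)"] e0 by (simp add: ln_div)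
      moreover have "1 - 1 / (1 + e) = 1 / (4 * a - 3)" using a by (simp add: e_def field_simps)
      ultimately show ?thesis by simp
    qed
    moreover have "0 < 1 / (4 * a - 3)" using a by simp
    ultimately have "ln (b / u J) / ln (1 + e) \<le> ln (32 * D) / (1 / (4 * a - 3))"
      using lnD0 by (intro frac_le) auto
    moreover have "(b - u J) / \<Delta> \<le> b / \<Delta>" using u(2)[of J] \<Delta> by (intro divide_right_mono) auto
    ultimately have "real J \<le> T" using u(6)[of J] by (simp add: T_def mult.commute)
    then show False using J by simp
  qed
  have uJb: "u J \<le> b"
  proof -
    have "b / (32 * D) \<le> b / 1" using b D1 by (intro divide_left_mono) auto
    then show ?thesis using uJ by simp
  qed
  interpret sp: sampling_process X G s u \<kappa> m0 F e k0 J
  proof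
    fix i
    have "2 * F * (u i - u (Suc i)) * k0 / \<kappa> \<le> 2 * F * \<Delta> * k0 / \<kappa>"
      using u(5)[of i] \<kappa> k0p by (intro divide_right_mono mult_right_mono mult_left_mono) (auto simp: F_def)
    also have "\<dots> = 1/2" using \<kappa> k0p by (simp add: \<Delta>_def F_def)
    finally show "2 * F * (u i - u (Suc i)) * k0 / \<kappa> \<le> 1/2" .
  qed (use u e0 Fe \<kappa> m0 k0 in auto)
  have k0_up: "real k0 \<le> \<kappa> * N * (1 + 1/128)"
  proof -
    have "real k0 \<le> \<kappa> * N + 1" using k0 mult_left_mono[OF N(2), of \<kappa>] \<kappa> by linarith
    then show ?thesis using qN by (simp add: \<kappa>_def)
  qed
  have bD: "b / \<Delta> \<le> 5.19 * Y"
  proof -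
    have "b / \<Delta> = 5.14 * b * (k0 / \<kappa>)" using \<kappa> k0p by (simp add: \<Delta>_def F_def)
    also have "\<dots> \<le> 5.14 * b * (N * (1 + 1/128))" using k0_up \<kappa> b by (intro mult_left_mono) (auto simp: field_simps)
    also have "\<dots> \<le> 5.19 * Y" using b N0 by (simp add: Y_def)
    finally show ?thesis .
  qed
  define M where "M = 7/10 * q * N / D"
  have Jle: "real J \<le> 5.19 * Y + (4 * a - 3) * ln (32 * D) + 1" using J(2) bD unfolding T_def by linarith
  have Mge: "716.8 * c\<^sup>2 * a\<^sup>2 * y / D \<le> M"
  proof -
    have "7/10 * (1024 * c\<^sup>2 * a\<^sup>2 * p) * N \<le> 7/10 * q * N" using pq N0 by (intro mult_right_mono mult_left_mono) auto
    then show ?thesis unfolding M_def y_def using D1 by (intro divide_right_mono) auto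
  qed
  have main: "1.00293 * real J + 6.958 + 1.125 * ln D \<le> 3.0365 * M"
  proof (cases "Y \<le> 2 * a\<^sup>2")
    case True
    show ?thesis
      using exponent_bound_sparse[OF r s y0 Yb(2,1), of D M "real J"] True D1 DA Mge Jle by (simp add: a_def c_def)
  next
    case False
    then have "Y = y" using Y a2 by auto
    then show ?thesis
      using exponent_bound_dense[OF r s, of y D M "real J"] False D1 DB Mge Jle by (simp add: a_def c_def)
  qed
  have cost: "144 * N\<^sup>2 * real J * D * (2/q) powr (real J) \<le> exp (3.06 * ln (2/q) * M)"
    by (rule log_cost_bound[OF q N0 _ _ M_def main]) (use D1 J T0 in auto)
  \<comment> \<open>Below, hits must contribute at least 0.058 \<open>Z\<close> while
    \<open>K\<close> is at most 3.6 \<open>b * N\<close>; 72 exceeds the quotient 3.6 /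
    0.058.\<close>
  define \<delta> where "\<delta> = \<kappa> ^ J / (72 * D)"
  have \<delta>0: "0 < \<delta>" using \<kappa> D1 by (simp add: \<delta>_def)
  have \<kappa>J: "\<kappa> ^ J \<le> 1" using \<kappa> by (intro power_le_one) auto
  then have \<delta>1: "\<delta> \<le> 1" using D1 by (simp add: \<delta>_def)
  define B where "B = {I. I \<subseteq> X \<and> capacity (induced G I) (\<lambda>_. p/2) \<le> 2 * p^4 * n * (q/2)^(4 * s)}"
  have finB: "finite B" by (rule finite_subset[of _ "Pow X"]) (auto simp: B_def finX)
  have hit: "\<delta> * card X ^ J \<le> card (sp.hit_lists I [])" if I: "I \<in> B" for I
  proof -
    have IX: "I \<subseteq> X" and bad: "capacity (induced G I) (\<lambda>_. p/2) \<le> 2 * p^4 * N * (q/2)^(4 * s)"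
      using I by (auto simp: B_def N_def)
    define K where "K = card X * u 0 + 2 * F / \<kappa> * u 0 * k0"
    define Hh where "Hh = real (card (sp.hit_lists I []))"
    define w where "w = 2 * F / \<kappa> * (u 0 - u J)"
    define Z where "Z = b * N / D"
    have Z0: "0 < Z" using b N0 D1 by (simp add: Z_def)
    have F\<kappa>: "1 \<le> 2 * F / \<kappa>" using \<kappa> by (simp add: F_def)
    have w: "0 \<le> w" "b \<le> u J + w" "u J + w \<le> 2 * F / \<kappa> * b"
    proof -
      show "0 \<le> w" using F\<kappa> uJb unfolding w_def u(1) by (intro mult_nonneg_nonneg) auto
      have "1 * (b - u J) \<le> w" unfolding w_def u(1) using F\<kappa> uJb by (intro mult_right_mono) auto
      then show "b \<le> u J + w" by simp
      have "1 * u J \<le> 2 * F / \<kappa> * u J" using F\<kappa> u(2)[of J] by (intro mult_right_mono) auto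
      then show "u J + w \<le> 2 * F / \<kappa> * b" unfolding w_def u(1) right_diff_distrib by linarith
    qed
    have main1: "C0 \<le> capacity G (\<lambda>y. u J + (if y \<in> I then w else 0)) + K * Hh / k0 ^ J + F * (b - u J) * m0"
      using sp.hit_lists_bound[OF IX, of K] unfolding C0_def K_def w_def Hh_def u(1) by simp
    have two: "capacity G (\<lambda>y. u J + (if y \<in> I then w else 0)) \<le> card X * u J + ((u J + w) / (p/2)) ^ s * capacity (induced G I) (\<lambda>_. p/2)"
      by (rule capacity_two_level[OF IX u(2)]) (use p b w in auto)
    have t1: "card X * u J \<le> Z / 32"
    proof -
      have "card X * u J \<le> N * (b / (32 * D))" using N uJ u(2)[of J] by (intro mult_mono) auto
      then show ?thesis by (simp add: Z_def mult.commute)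
    qed
    have t2: "((u J + w) / (p/2)) ^ s * capacity (induced G I) (\<lambda>_. p/2) \<le> Z / 100"
    proof -
      \<comment> \<open>Here 5.14 / q is \<open>2 * F / \<kappa>\<close>; the factor 64 from
        \<open>b\<close> and the 2 from \<open>p/2\<close> give 128 * 5.14 < 658.\<close>
      have "(u J + w) / (p/2) \<le> 658 / q"
      proof -
        have "u J + w \<le> 5.14 / q * b" using w(3) by (simp add: F_def \<kappa>_def)
        also have "\<dots> \<le> 5.14 / q * (64 * p)" using b64 q by (intro mult_left_mono) auto
        finally show ?thesis using p q by (simp add: field_simps)
      qed
      then have "((u J + w) / (p/2)) ^ s \<le> (658 / q) ^ s" using w b p by (intro power_mono) auto
      then have "((u J + w) / (p/2)) ^ s * capacity (induced G I) (\<lambda>_. p/2) \<le> (658 / q) ^ s * (2 * p^4 * N * (q/2)^(4 * s))"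
        using bad uniform_hypergraph.capacity_nonneg[OF uniform_induced[OF IX], of "\<lambda>_. p/2"] p q
        by (intro mult_mono) auto
      \<comment> \<open>The exponent \<open>4 * s\<close> is spent here: per element of an edge,
        \<open>(q/2)^4\<close> outweighs the weight ratio \<open>658 / q\<close>.\<close>
      also have "\<dots> = 2 * p^4 * N * ((658 / q) * (q/2)^4) ^ s" unfolding power_mult power_mult_distrib by (rule mult.left_commute)
      also have "(658 / q) * (q/2)^4 = 658/16 * q^3" using q by (simp add: power_divide power_numeral_reduce)
      also have "2 * p^4 * N * (658/16 * q^3) ^ s \<le> 2 * p^4 * N * 1"
      proof -
        have "q^3 \<le> (1/8)^3" using q by (intro power_mono) auto
        then have "658/16 * q^3 \<le> 1" by (simp add: power_numeral_reduce)
        then show ?thesis using q p N0 by (intro mult_left_mono power_le_one) auto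
      qed
      also have "\<dots> \<le> Z / 100"
      proof -
        have "p * D \<le> p * (273 * c * a\<^sup>2)" using DB p by (intro mult_left_mono) auto
        also have "\<dots> = 273 * (c * a\<^sup>2 * p)" by simp
        also have "\<dots> \<le> (1024 * c) * (c * a\<^sup>2 * p)" using p c by (intro mult_right_mono) auto
        also have "\<dots> = 1024 * c\<^sup>2 * a\<^sup>2 * p" by (simp add: power2_eq_square)
        finally have "p * D \<le> 1" using pq q by simp
        moreover have "p * p \<le> 1/16384 * 1" using pq14 q p by (intro mult_mono) auto
        ultimately have "(p * p) * (p * D) \<le> (1/16384) * 1" using p D1 by (intro mult_mono) auto
        then have "200 * ((p * p) * (p * D)) * (p * N) \<le> 1 * (b * N)" using b p N0 D1 by (intro mult_mono) auto
        then show ?thesis unfolding Z_def using D1 by (simp add: field_simps power_numeral_reduce)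
      qed
      finally show ?thesis .
    qed
    have t3: "F * (b - u J) * m0 \<le> 0.9 * Z"
    proof -
      have "F * (b - u J) * m0 \<le> F * b * m0" using u(2)[of J] m0 by (intro mult_right_mono mult_left_mono) (auto simp: F_def)
      also have "\<dots> \<le> 0.9 * Z" using Z0 by (simp add: F_def m0_def Z_def)
      finally show ?thesis .
    qed
    \<comment> \<open>What remains of \<open>Z\<close> after the shares 1/32, 1/100 and 0.9.\<close>
    have KH: "0.058 * Z \<le> K * Hh / k0 ^ J"
      using main1 two t1 t2 t3 C0 Z0 by (simp add: Z_def[symmetric])
    have K: "K \<le> 3.6 * (b * N)"
    proof -
      have "K = b * (card X + 2.57 * (k0 / \<kappa>))" unfolding K_def u(1) F_def by (simp add: algebra_simps)
      also have "\<dots> \<le> b * (N + 2.57 * (N * (1 + 1/128)))"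
        using k0_up \<kappa> b N by (intro mult_left_mono add_mono) (auto simp: field_simps)
      also have "\<dots> \<le> 3.6 * (b * N)" using b N0 by (simp add: algebra_simps)
      finally show ?thesis .
    qed
    have "0.058 * Z \<le> 3.6 * (b * N) * (Hh / k0 ^ J)"
    proof -
      have "K * (Hh / k0 ^ J) \<le> 3.6 * (b * N) * (Hh / k0 ^ J)" using K by (intro mult_right_mono) (auto simp: Hh_def)
      then show ?thesis using KH unfolding times_divide_eq_right by (rule order_trans[rotated])
    qed
    then have "0.058 * k0 ^ J \<le> 3.6 * D * Hh"
      using b N0 D1 k0p by (simp add: Z_def field_simps)
    moreover have "(\<kappa> * card X) ^ J \<le> real k0 ^ J" using k0 kX by (intro power_mono) auto
    moreover have "0 \<le> D * Hh" using D1 by (simp add: Hh_def)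
    ultimately have "(\<kappa> * card X) ^ J \<le> 72 * (D * Hh)" by simp
    then show ?thesis using D1 by (simp add: \<delta>_def Hh_def power_mult_distrib field_simps)
  qed
  obtain PP where PP: "finite PP" "\<And>P. P \<in> PP \<Longrightarrow> P \<subseteq> X \<and> m0 \<le> card P"
    "\<And>I. I \<in> B \<Longrightarrow> \<exists>P\<in>PP. card (I \<inter> P) < \<kappa> * card P"
    "card PP \<le> (ln (card B) / \<delta> + 1) * (J * card X)"
    using sp.sparse_level_family[OF finB _ \<delta>0 \<delta>1 hit] by (metis (no_types, lifting) B_def mem_Collect_eq)
  have cardPP: "card PP \<le> exp (3.06 * ln (2/q) * M)"
  proof -
    have "ln (card B) \<le> N"
    proof (cases "B = {}")
      case False
      have "card B \<le> card (Pow X)" using finX by (intro card_mono) (auto simp: B_def)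
      then have "real (card B) \<le> 2 ^ card X" using finX by (simp add: card_Pow flip: of_nat_le_iff)
      then have "ln (card B) \<le> ln (2 ^ card X)" using False finB by (subst ln_le_cancel_iff) (auto simp: card_gt_0_iff)
      also have "\<dots> = card X * ln 2" by (simp add: ln_realpow)
      also have "\<dots> \<le> real (card X) * 1" using ln2_le_25_over_36 by (intro mult_left_mono) auto
      finally show ?thesis using N by simp
    qed (use N0 in simp)
    then have "ln (card B) / \<delta> \<le> N / \<delta>" using \<delta>0 by (intro divide_right_mono) auto
    also have "N / \<delta> = 72 * (N * D * (2/q) ^ J)" unfolding \<delta>_def \<kappa>_def by (simp add: power_divide field_simps)
    finally have l1: "ln (card B) / \<delta> \<le> 72 * (N * D * (2/q) ^ J)" .
    have "1 \<le> (2/q) ^ J" using q by (intro one_le_power) auto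
    then have "1 * 1 \<le> (N * D) * (2/q) ^ J" using N D1 mult_mono[of 1 N 1 D] by (intro mult_mono) auto
    then have "ln (card B) / \<delta> + 1 \<le> 144 * (N * D * (2/q) ^ J)" using l1 by simp
    then have "(ln (card B) / \<delta> + 1) * (J * card X) \<le> 144 * (N * D * (2/q) ^ J) * (J * N)"
      using N D1 q by (intro mult_mono) (auto intro: mult_left_mono)
    also have "\<dots> = 144 * N\<^sup>2 * real J * D * (2/q) powr (real J)"
      using q by (simp add: powr_realpow power2_eq_square)
    finally show ?thesis using PP(4) cost by linarith
  qed
  have "card PP * exp (q/2 * card P * (1 + ln (1 / (q/2)))) \<le> exp (4 * q * ln (2/q) * (1 - q/2) * card P)" if "P \<in> PP" for P
  proof (rule branching_exponent[OF q])
    have lq: "0 \<le> ln (2/q)" using q by simp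
    have "M = q * m0" by (simp add: M_def m0_def)
    also have "\<dots> \<le> q * card P" using PP(2)[OF that] q by (intro mult_left_mono) auto
    finally have "3.06 * ln (2/q) * M \<le> 3.06 * ln (2/q) * (q * card P)" using lq by (intro mult_left_mono) auto
    then show "card PP \<le> exp (3.06 * ln (2/q) * (q * card P))" using cardPP by (meson exp_le_cancel_iff order_trans)
  qed simp
  moreover have "P \<noteq> {}" if "P \<in> PP" for P using PP(2)[OF that] m0 by auto
  moreover have "\<exists>P\<in>PP. card (I \<inter> P) < q/2 * card P"
    if "I \<subseteq> X \<and> capacity (induced G I) (\<lambda>_. p/2) \<le> 2 * p^4 * n * (q/2)^(4 * s)" for I
    using PP(3)[of I] that by (simp add: B_def \<kappa>_def)
  ultimately show ?thesis using PP(1,2) by (intro exI[of _ PP]) simp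
qed

end

section \<open>Janson measures and projections\<close>

lemma d_nu_linear: "d_nu G (\<lambda>E. a * f E + b * g E) L = a * d_nu G f L + b * d_nu G g L"
  by (simp add: d_nu_def sum.distrib sum_distrib_left)

lemma e_nu_linear: "e_nu G (\<lambda>E. a * f E + b * g E) = a * e_nu G f + b * e_nu G g"
  by (simp add: e_nu_def sum.distrib sum_distrib_left)

lemma d_nu_scale: "d_nu G (\<lambda>E. a * f E) L = a * d_nu G f L"
  by (simp add: d_nu_def sum_distrib_left)

lemma e_nu_scale: "e_nu G (\<lambda>E. a * f E) = a * e_nu G f"
  by (simp add: e_nu_def sum_distrib_left)

lemma d_nu_not_subset: "\<not> L \<subseteq> \<Union>G \<Longrightarrow> d_nu G \<nu> L = 0"
  unfolding d_nu_def by (rule sum.neutral) auto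

lemma Lambda_superset:
  assumes "finite U" "\<Union>G \<subseteq> U"
  shows "Lambda p G \<nu> = (\<Sum>L\<in>{L. L \<subseteq> U \<and> 2 \<le> card L}. (d_nu G \<nu> L)\<^sup>2 / p ^ card L)"
  unfolding Lambda_def
proof (rule sum.mono_neutral_left)
  show "\<forall>L\<in>{L. L \<subseteq> U \<and> 2 \<le> card L} - {L. L \<subseteq> \<Union>G \<and> 2 \<le> card L}. (d_nu G \<nu> L)\<^sup>2 / p ^ card L = 0"
    using d_nu_not_subset[of _ G \<nu>] by fastforce
qed (use assms in auto)

lemma janson_measure:
  assumes "janson p R G" "0 < R" "0 < p"
  obtains \<nu> where "\<And>E. E \<in> G \<Longrightarrow> 0 \<le> \<nu> E" "e_nu G \<nu> = 1" "Lambda p G \<nu> < 1 / R"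
proof -
  obtain \<nu> where \<nu>: "\<And>E. E \<in> G \<Longrightarrow> 0 \<le> \<nu> E" "Lambda p G \<nu> < (e_nu G \<nu>)\<^sup>2 / R"
    using assms by (auto simp: janson_def)
  have "0 \<le> Lambda p G \<nu>" unfolding Lambda_def using assms by (intro sum_nonneg) auto
  then have ne: "e_nu G \<nu> \<noteq> 0" using \<nu>(2) by auto
  have "0 \<le> e_nu G \<nu>" unfolding e_nu_def using \<nu>(1) by (rule sum_nonneg)
  with ne have e: "0 < e_nu G \<nu>" by simp
  define a where "a = 1 / e_nu G \<nu>"
  have "Lambda p G (\<lambda>E. a * \<nu> E) = a\<^sup>2 * Lambda p G \<nu>"
    by (simp add: Lambda_def d_nu_scale power_mult_distrib sum_distrib_left)
  also have "\<dots> < a\<^sup>2 * ((e_nu G \<nu>)\<^sup>2 / R)" using \<nu>(2) e by (intro mult_strict_left_mono) (auto simp: a_def)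
  also have "\<dots> = 1 / R" using e by (simp add: a_def power_divide)
  finally show ?thesis
    using that[of "\<lambda>E. a * \<nu> E"] \<nu>(1) e unfolding e_nu_scale by (simp add: a_def)
qed

lemma card_fibre_le_2:
  assumes "finite V" and half: "\<forall>L. L \<subseteq> V \<longrightarrow> real (card (\<pi> ` L)) \<ge> real (card L) / 2"
    and "L \<subseteq> V" "\<pi> ` L \<subseteq> {u}"
  shows "card L \<le> 2"
proof -
  have "card (\<pi> ` L) \<le> card {u}" using assms(4) by (intro card_mono) auto
  moreover have "real (card L) / 2 \<le> real (card (\<pi> ` L))" using half assms(3) by blast
  ultimately show ?thesis by simp
qed

text \<open>Fibres have at most two points. So an injective lift of \<open>L'\<close> is determined
  by the set of those \<open>u\<close> in \<open>L'\<close> over which it uses the chosen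
  representative.\<close>

lemma card_injective_lifts_le:
  assumes finV: "finite V" and half: "\<forall>L. L \<subseteq> V \<longrightarrow> real (card (\<pi> ` L)) \<ge> real (card L) / 2"
    and finL: "finite L'"
  shows "card {L. L \<subseteq> V \<and> \<pi> ` L = L' \<and> card L = card L'} \<le> 2 ^ card L'"
proof -
  let ?S = "{L. L \<subseteq> V \<and> \<pi> ` L = L' \<and> card L = card L'}"
  define rep where "rep u = (SOME z. z \<in> V \<and> \<pi> z = u)" for u
  define tr where "tr L = {u \<in> L'. rep u \<in> L}" for L
  have inj: "inj_on \<pi> L" if "L \<in> ?S" for L
    using that finite_subset[OF _ finV] by (intro eq_card_imp_inj_on) auto
  have sub: "L1 \<subseteq> L2" if L: "L1 \<in> ?S" "L2 \<in> ?S" and eq: "tr L1 = tr L2" for L1 L2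
  proof
    fix x assume x: "x \<in> L1"
    define u where "u = \<pi> x"
    have xV: "x \<in> V" and uL: "u \<in> L'" using x L(1) by (auto simp: u_def)
    have rep: "rep u \<in> V \<and> \<pi> (rep u) = u"
      unfolding rep_def by (rule someI[of _ x]) (simp add: xV u_def)
    show "x \<in> L2"
    proof (cases "x = rep u")
      case True
      then have "u \<in> tr L1" using x uL by (simp add: tr_def)
      then show ?thesis using True eq by (auto simp: tr_def)
    next
      case False
      have "rep u \<notin> L1" using inj[OF L(1)] x False rep by (auto simp: inj_on_def u_def)
      then have "u \<notin> tr L2" using eq by (auto simp: tr_def)
      then have r2: "rep u \<notin> L2" using uL by (simp add: tr_def)
      have "u \<in> \<pi> ` L2" using uL L(2) by auto
      then obtain x' where x': "x' \<in> L2" "\<pi> x' = u" by auto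
      have "card {rep u, x, x'} \<le> 2"
        by (rule card_fibre_le_2[OF finV half, of _ u]) (use rep xV x' L(2) in \<open>auto simp: u_def\<close>)
      then have "x = x'" using False r2 x' by (auto simp: card_insert_if split: if_splits)
      then show ?thesis using x' by simp
    qed
  qed
  have "inj_on tr ?S"
    by (rule inj_onI) (intro subset_antisym sub, simp_all)
  moreover have "tr ` ?S \<subseteq> Pow L'" by (auto simp: tr_def)
  ultimately have "card ?S \<le> card (Pow L')" using finL by (intro card_inj_on_le) auto
  then show ?thesis using finL by (simp add: card_Pow)
qed

context uniform_hypergraph
begin

text \<open>Since \<pi> is injective on edges, an edge whose image contains \<open>L'\<close>
  contains exactly one lift of \<open>L'\<close>.\<close>

lemma sum_lifts:
  assumes inj: "\<And>E. E \<in> G \<Longrightarrow> card (\<pi> ` E) = card E"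
  shows "(\<Sum>L\<in>{L. L \<subseteq> X \<and> \<pi> ` L = L' \<and> card L = card L'}. d_nu G \<nu> L) = (\<Sum>E\<in>{E\<in>G. L' \<subseteq> \<pi> ` E}. \<nu> E)"
proof -
  let ?S = "{L. L \<subseteq> X \<and> \<pi> ` L = L' \<and> card L = card L'}"
  have finS: "finite ?S" using finX by simp
  have "(\<Sum>L\<in>?S. d_nu G \<nu> L) = (\<Sum>E\<in>G. \<Sum>L\<in>?S. if L \<subseteq> E then \<nu> E else 0)"
    by (simp add: d_if sum.swap[of _ ?S])
  also have "\<dots> = (\<Sum>E\<in>G. if L' \<subseteq> \<pi> ` E then \<nu> E else 0)"
  proof (intro sum.cong refl)
    fix E assume E: "E \<in> G"
    have inj: "inj_on \<pi> E" using inj[OF E] edgeD[OF E] by (intro eq_card_imp_inj_on) auto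
    show "(\<Sum>L\<in>?S. if L \<subseteq> E then \<nu> E else 0) = (if L' \<subseteq> \<pi> ` E then \<nu> E else 0)"
    proof (cases "L' \<subseteq> \<pi> ` E")
      case True
      define L0 where "L0 = {x\<in>E. \<pi> x \<in> L'}"
      have im: "\<pi> ` L0 = L'" using True by (auto simp: L0_def)
      have "inj_on \<pi> L0" using inj by (rule inj_on_subset) (auto simp: L0_def)
      then have c: "card L0 = card L'" using card_image im by metis
      have "{L\<in>?S. L \<subseteq> E} = {L0}"
      proof (intro equalityI subsetI)
        fix L assume L: "L \<in> {L\<in>?S. L \<subseteq> E}"
        have "L = L0"
        proof (intro equalityI subsetI)
          fix x assume "x \<in> L0"
          then have x: "x \<in> E" "\<pi> x \<in> \<pi> ` L" using L by (auto simp: L0_def)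
          then obtain z where "z \<in> L" "\<pi> z = \<pi> x" by auto
          then show "x \<in> L" using inj L x by (metis (mono_tags, lifting) inj_on_def mem_Collect_eq subsetD)
        qed (use L in \<open>auto simp: L0_def\<close>)
        then show "L \<in> {L0}" by simp
      next
        fix L assume "L \<in> {L0}"
        then show "L \<in> {L\<in>?S. L \<subseteq> E}" using im c edgeD[OF E] by (auto simp: L0_def)
      qed
      then have "(\<Sum>L\<in>?S. if L \<subseteq> E then \<nu> E else 0) = (\<Sum>L\<in>{L0}. \<nu> E)"
        unfolding sum.inter_filter[OF finS, symmetric] by simp
      then show ?thesis using True by simp
    next
      case False
      then have "\<not> L \<subseteq> E" if "L \<in> ?S" for L using that by auto
      then have "(\<Sum>L\<in>?S. if L \<subseteq> E then \<nu> E else 0) = 0" by (intro sum.neutral) auto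
      then show ?thesis using False by simp
    qed
  qed
  also have "\<dots> = (\<Sum>E\<in>{E\<in>G. L' \<subseteq> \<pi> ` E}. \<nu> E)" by (simp add: sum.inter_filter finG)
  finally show ?thesis .
qed

text \<open>A set on which \<pi> is not injective lies in no edge, so its degree and hence
  \<open>h\<close> vanish. The remaining sets are grouped by their images.\<close>

lemma sum_over_lifts:
  assumes finU: "finite U" and im: "\<pi> ` X \<subseteq> U" and inj: "\<And>E. E \<in> G \<Longrightarrow> card (\<pi> ` E) = card E"
    and Z: "\<And>L. L \<subseteq> X \<Longrightarrow> d_nu G \<nu> L = 0 \<Longrightarrow> h L = 0"
  shows "(\<Sum>L\<in>{L. L \<subseteq> X \<and> k \<le> card L}. h L)
    = (\<Sum>L'\<in>{L'. L' \<subseteq> U \<and> k \<le> card L'}. \<Sum>L\<in>{L. L \<subseteq> X \<and> \<pi> ` L = L' \<and> card L = card L'}. h L :: real)"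
proof -
  let ?A = "{L. L \<subseteq> X \<and> k \<le> card L \<and> card (\<pi> ` L) = card L}"
  let ?B = "{L'. L' \<subseteq> U \<and> k \<le> card L'}"
  have zero: "h L = 0" if L: "L \<subseteq> X" "card (\<pi> ` L) \<noteq> card L" for L
  proof (rule Z[OF L(1)])
    have "\<not> L \<subseteq> E" if E: "E \<in> G" for E
    proof
      assume "L \<subseteq> E"
      moreover have "inj_on \<pi> E" using inj[OF E] edgeD[OF E] by (intro eq_card_imp_inj_on) auto
      ultimately show False using L(2) card_image inj_on_subset by blast
    qed
    then show "d_nu G \<nu> L = 0" unfolding d_nu_def by (intro sum.neutral) auto
  qed
  have "(\<Sum>L\<in>{L. L \<subseteq> X \<and> k \<le> card L}. h L) = sum h ?A"
    using finX zero by (intro sum.mono_neutral_right) auto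
  also have "\<dots> = (\<Sum>L'\<in>?B. \<Sum>L\<in>{L\<in>?A. \<pi> ` L = L'}. h L)"
    using finX finU im by (intro sum.group[symmetric]) auto
  also have "\<dots> = (\<Sum>L'\<in>?B. \<Sum>L\<in>{L. L \<subseteq> X \<and> \<pi> ` L = L' \<and> card L = card L'}. h L)"
    by (intro sum.cong refl) auto
  finally show ?thesis .
qed

lemma sum_nested_degrees:
  "(\<Sum>E\<in>G. \<nu> E * (\<Sum>L\<in>{L. L \<subseteq> E \<and> k \<le> card L}. h L)) = (\<Sum>L\<in>{L. L \<subseteq> X \<and> k \<le> card L}. h L * d_nu G \<nu> L)"
proof -
  have "(\<Sum>E\<in>G. \<nu> E * (\<Sum>L\<in>{L. L \<subseteq> E \<and> k \<le> card L}. h L))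
      = (\<Sum>E\<in>G. \<Sum>L\<in>{L. L \<subseteq> X \<and> k \<le> card L}. if L \<subseteq> E then \<nu> E * h L else 0)"
  proof (intro sum.cong refl)
    fix E assume "E \<in> G"
    then have "{L. L \<subseteq> E \<and> k \<le> card L} = {L \<in> {L. L \<subseteq> X \<and> k \<le> card L}. L \<subseteq> E}" using edgeD[of E] by auto
    then show "\<nu> E * (\<Sum>L\<in>{L. L \<subseteq> E \<and> k \<le> card L}. h L) = (\<Sum>L\<in>{L. L \<subseteq> X \<and> k \<le> card L}. if L \<subseteq> E then \<nu> E * h L else 0)"
      using finX by (simp only: sum_distrib_left, subst sum.inter_filter) auto
  qed
  also have "\<dots> = (\<Sum>L\<in>{L. L \<subseteq> X \<and> k \<le> card L}. \<Sum>E\<in>G. if L \<subseteq> E then \<nu> E * h L else 0)" by (rule sum.swap)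
  also have "\<dots> = (\<Sum>L\<in>{L. L \<subseteq> X \<and> k \<le> card L}. h L * d_nu G \<nu> L)"
    by (intro sum.cong refl) (auto simp: d_if sum_distrib_left intro!: sum.cong)
  finally show ?thesis .
qed

end

section \<open>Measures on the original hypergraph obtained from its projections\<close>

lemma sum_squares_le_square_sum:
  fixes f :: "'c \<Rightarrow> real"
  assumes "finite A" "\<And>x. x \<in> A \<Longrightarrow> 0 \<le> f x"
  shows "(\<Sum>x\<in>A. (f x)\<^sup>2) \<le> (\<Sum>x\<in>A. f x)\<^sup>2"
proof -
  have "(\<Sum>x\<in>A. f x * f x) \<le> (\<Sum>x\<in>A. f x * sum f A)"
    using assms by (intro sum_mono mult_left_mono member_le_sum) auto
  then show ?thesis by (simp add: power2_eq_square sum_distrib_right)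
qed

text \<open>The conditions on \<nu>F are scaled by \<open>R'\<close>. For \<open>R' > 0\<close> they
  describe a normalised measure with \<Lambda> at most 1 / R'; for \<open>R' = 0\<close> they hold
  for the zero function, so both cases share one argument.\<close>

locale janson_setting =
  fixes s r n :: nat and p q R R' :: real
    and F :: "'b set set" and U :: "'b set"
    and H :: "'a set set" and V :: "'a set"
    and \<pi> :: "'a \<Rightarrow> 'b" and v :: 'b and \<nu>F :: "'b set \<Rightarrow> real"
  assumes spos: "0 < s" and r2: "2 \<le> r" and q: "0 < q" "q < 1/8"
    and p: "0 < p" "p \<le> q / (2^10 * real r^2 * real s^2)"
    and R_def: "R = p * real n / 2^6"
    and R': "0 \<le> R'" "R' \<le> R / 16"
    and finU: "finite U" and F: "F \<subseteq> {E. E \<subseteq> U \<and> card E = s + 1}"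
    and finV: "finite V" and cardV: "card V = n" and npos: "0 < n"
    and Hunif: "H \<subseteq> {E. E \<subseteq> V \<and> card E = s}"
    and half: "\<forall>L. L \<subseteq> V \<longrightarrow> real (card (\<pi> ` L)) \<ge> real (card L) / 2"
    and injH: "\<forall>E\<in>H. card (\<pi> ` E) = card E"
    and vU: "v \<notin> U"
    and \<nu>F: "\<And>E. E \<in> F \<Longrightarrow> 0 \<le> \<nu>F E" "R' * e_nu F \<nu>F = R'" "R' * Lambda p F \<nu>F \<le> 1"
begin

text \<open>The paper's pi maps into U; here its values are unrestricted, so the image is adjoined
  (it may even contain v).\<close>
definition UU :: "'b set" where "UU = U \<union> \<pi> ` V"

text \<open>The potential of \<nu>F on \<open>E\<close> with respect to the form \<Lambda>. Its
  average under a measure on edges is the mixed term that appears when this measure is combined with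
  \<nu>F.\<close>

definition cross :: "'b set \<Rightarrow> real" where
  "cross E = (\<Sum>L\<in>{L. L \<subseteq> E \<and> 2 \<le> card L}. d_nu F \<nu>F L / p ^ card L)"

text \<open>The threshold lies below 1 to leave room in the mixture: the mixed term uses 14x of an
  admissible 15x, and the energy of the projected measure needs the rest. It is still far enough
  above the average 1/4 for Markov's inequality to keep mass 5/7.\<close>

definition G :: "'a set set" where
  "G = {E \<in> H. R' * cross (\<pi> ` E) \<le> 7/8}"

lemma finUU: "finite UU" by (simp add: UU_def finU finV)

lemma GH: "G \<subseteq> H" by (auto simp: G_def)

lemma injG: "E \<in> G \<Longrightarrow> card (\<pi> ` E) = card E" using injH GH by blast

sublocale H: uniform_hypergraph V H s
  using finV Hunif spos by unfold_locales

sublocale G: uniform_hypergraph V G s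
  using finV Hunif GH spos by unfold_locales auto

lemma Rpos: "0 < R" using p npos by (simp add: R_def)

lemma LambdaF: "Lambda p F \<nu>F = (\<Sum>L\<in>{L. L \<subseteq> UU \<and> 2 \<le> card L}. (d_nu F \<nu>F L)\<^sup>2 / p ^ card L)"
  using F by (intro Lambda_superset finUU) (auto simp: UU_def)

text \<open>Each projected edge is lifted to one chosen preimage; then the measure is restricted to
  \<open>G\<close> and renormalised. Markov's inequality with threshold 7/8 and average 1/4 discards
  at most 2/7, so degrees grow by at most 7/5, and 49/25 * 64 < 128 gives the final
  constant.\<close>

lemma pullback:
  assumes Y: "Y \<subseteq> V" and jan: "janson p R (proj \<pi> (induced H Y))"
  obtains \<mu> where "\<And>E. E \<in> G \<Longrightarrow> 0 \<le> \<mu> E" "\<And>E. E \<in> G \<Longrightarrow> \<not> E \<subseteq> Y \<Longrightarrow> \<mu> E = 0" "e_nu G \<mu> = 1"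
    "(\<Sum>L\<in>{L. L \<subseteq> V \<and> 2 \<le> card L}. (d_nu G \<mu> L)\<^sup>2 / p ^ card L) \<le> 128 / (p * n)"
proof -
  define Q where "Q = proj \<pi> (induced H Y)"
  obtain \<mu>0 where \<mu>0: "\<And>E. E \<in> Q \<Longrightarrow> 0 \<le> \<mu>0 E" "e_nu Q \<mu>0 = 1" "Lambda p Q \<mu>0 < 1 / R"
    using janson_measure[OF jan Rpos p(1)] unfolding Q_def by metis
  interpret Q: uniform_hypergraph UU Q s
  proof
    show "Q \<subseteq> {E. E \<subseteq> UU \<and> card E = s}"
    proof
      fix B assume "B \<in> Q"
      then obtain E where E: "E \<in> H" "B = \<pi> ` E" by (auto simp: Q_def proj_def induced_def)
      then show "B \<in> {E. E \<subseteq> UU \<and> card E = s}"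
        using injH H.edgeD[OF E(1)] by (auto simp: UU_def)
    qed
  qed (use finUU spos in auto)
  have LQ: "Lambda p Q \<mu>0 = (\<Sum>L\<in>{L. L \<subseteq> UU \<and> 2 \<le> card L}. (d_nu Q \<mu>0 L)\<^sup>2 / p ^ card L)"
    using Q.edgeD by (intro Lambda_superset finUU) auto
  define g where "g B = (SOME E. E \<in> induced H Y \<and> \<pi> ` E = B)" for B
  have g: "g B \<in> induced H Y \<and> \<pi> ` g B = B" if "B \<in> Q" for B
  proof -
    have "\<exists>E. E \<in> induced H Y \<and> \<pi> ` E = B" using that by (auto simp: Q_def proj_def)
    then show ?thesis unfolding g_def by (rule someI_ex)
  qed
  have injg: "inj_on g Q" by (rule inj_on_inverseI[of _ "image \<pi>"]) (use g in blast)
  have gH: "g ` Q \<subseteq> H" using g by (auto simp: induced_def)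
  define \<mu>1 where "\<mu>1 E = (if E \<in> g ` Q then \<mu>0 (\<pi> ` E) else 0)" for E
  have \<mu>1_nonneg: "0 \<le> \<mu>1 E" for E using \<mu>0(1) g by (auto simp: \<mu>1_def)
  have transport: "(\<Sum>E\<in>H. \<mu>1 E * f (\<pi> ` E)) = (\<Sum>B\<in>Q. \<mu>0 B * f B)" for f :: "'b set \<Rightarrow> real"
  proof -
    have "(\<Sum>E\<in>H. \<mu>1 E * f (\<pi> ` E)) = (\<Sum>E\<in>g ` Q. \<mu>0 (\<pi> ` E) * f (\<pi> ` E))"
      using gH H.finG by (intro sum.mono_neutral_cong_right) (auto simp: \<mu>1_def)
    also have "\<dots> = (\<Sum>B\<in>Q. \<mu>0 B * f B)"
      unfolding sum.reindex[OF injg] using g by (intro sum.cong) auto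
    finally show ?thesis .
  qed
  have mass: "(\<Sum>E\<in>H. \<mu>1 E) = 1" using transport[of "\<lambda>_. 1"] \<mu>0(2) by (simp add: e_nu_def)
  have deg: "(\<Sum>E\<in>{E\<in>H. L' \<subseteq> \<pi> ` E}. \<mu>1 E) = d_nu Q \<mu>0 L'" for L'
  proof -
    have "(\<Sum>E\<in>{E\<in>H. L' \<subseteq> \<pi> ` E}. \<mu>1 E) = (\<Sum>E\<in>H. \<mu>1 E * (if L' \<subseteq> \<pi> ` E then 1 else 0))"
      unfolding sum.inter_filter[OF H.finG] by (intro sum.cong) auto
    also have "\<dots> = (\<Sum>B\<in>Q. \<mu>0 B * (if L' \<subseteq> B then 1 else 0))" by (rule transport)
    also have "\<dots> = d_nu Q \<mu>0 L'" unfolding Q.d_if by (intro sum.cong) auto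
    finally show ?thesis .
  qed
  have cross_avg: "(\<Sum>E\<in>H. \<mu>1 E * (R' * cross (\<pi> ` E))) \<le> 1/4"
  proof -
    let ?S = "{L. L \<subseteq> UU \<and> 2 \<le> card L}"
    let ?a = "\<lambda>L. d_nu F \<nu>F L" let ?b = "\<lambda>L. d_nu Q \<mu>0 L"
    have "(\<Sum>E\<in>H. \<mu>1 E * (R' * cross (\<pi> ` E))) = R' * (\<Sum>B\<in>Q. \<mu>0 B * cross B)"
      using transport[of "\<lambda>B. R' * cross B"] by (simp add: sum_distrib_left algebra_simps)
    also have "(\<Sum>B\<in>Q. \<mu>0 B * cross B) = (\<Sum>L\<in>?S. ?a L / p ^ card L * ?b L)"
      unfolding cross_def by (rule Q.sum_nested_degrees)
    also have "\<dots> \<le> (\<Sum>L\<in>?S. 1/8 * ((?a L)\<^sup>2 / p ^ card L) + 2 * ((?b L)\<^sup>2 / p ^ card L))"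
    proof (rule sum_mono)
      fix L
      \<comment> \<open>The 4 balances the two energies: after multiplication by \<open>R'\<close>
        they are at most 1 and 1/16, so both halves of the bound become 1/8.\<close>
      have "0 \<le> (?a L - 4 * ?b L)\<^sup>2" by simp
      then have "?a L * ?b L \<le> 1/8 * (?a L)\<^sup>2 + 2 * (?b L)\<^sup>2" by (simp add: power2_eq_square algebra_simps)
      then have "?a L * ?b L / p ^ card L \<le> (1/8 * (?a L)\<^sup>2 + 2 * (?b L)\<^sup>2) / p ^ card L"
        using p by (intro divide_right_mono) auto
      then show "?a L / p ^ card L * ?b L \<le> 1/8 * ((?a L)\<^sup>2 / p ^ card L) + 2 * ((?b L)\<^sup>2 / p ^ card L)"
        by (simp add: add_divide_distrib)
    qed
    also have "\<dots> = 1/8 * Lambda p F \<nu>F + 2 * Lambda p Q \<mu>0"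
      unfolding LambdaF LQ by (simp add: sum.distrib sum_distrib_left)
    finally have "(\<Sum>E\<in>H. \<mu>1 E * (R' * cross (\<pi> ` E))) \<le> R' * (1/8 * Lambda p F \<nu>F + 2 * Lambda p Q \<mu>0)"
      using R' by (simp add: mult_left_mono)
    also have "\<dots> = 1/8 * (R' * Lambda p F \<nu>F) + 2 * (R' * Lambda p Q \<mu>0)" by (simp add: algebra_simps)
    finally have "(\<Sum>E\<in>H. \<mu>1 E * (R' * cross (\<pi> ` E))) \<le> 1/8 * (R' * Lambda p F \<nu>F) + 2 * (R' * Lambda p Q \<mu>0)" .
    moreover have "R' * Lambda p Q \<mu>0 \<le> R' * (1 / R)" using \<mu>0(3) R' by (intro mult_left_mono) auto
    moreover have "R' * (1 / R) \<le> 1/16" using R' Rpos by (simp add: field_simps)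
    ultimately show ?thesis using \<nu>F(3) by linarith
  qed
  define m where "m = e_nu G \<mu>1"
  have m: "5/7 \<le> m"
  proof -
    have "7/8 * (\<Sum>E\<in>H - G. \<mu>1 E) \<le> (\<Sum>E\<in>H - G. \<mu>1 E * (R' * cross (\<pi> ` E)))"
      unfolding sum_distrib_left
    proof (rule sum_mono)
      fix E assume "E \<in> H - G"
      then have "7/8 \<le> R' * cross (\<pi> ` E)" by (auto simp: G_def)
      then show "7/8 * \<mu>1 E \<le> \<mu>1 E * (R' * cross (\<pi> ` E))"
        using \<mu>1_nonneg[of E] by (metis mult.commute mult_left_mono)
    qed
    also have "\<dots> \<le> (\<Sum>E\<in>H. \<mu>1 E * (R' * cross (\<pi> ` E)))"
    proof (rule sum_mono2)
      fix E
      have "0 \<le> cross (\<pi> ` E)" unfolding cross_def d_nu_def using p \<nu>F(1) by (intro sum_nonneg divide_nonneg_nonneg) auto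
      then show "0 \<le> \<mu>1 E * (R' * cross (\<pi> ` E))" using R' \<mu>1_nonneg[of E] by simp
    qed (use H.finG in auto)
    finally have "(\<Sum>E\<in>H - G. \<mu>1 E) \<le> 2/7" using cross_avg by simp
    moreover have "(\<Sum>E\<in>H. \<mu>1 E) = (\<Sum>E\<in>H - G. \<mu>1 E) + m"
      unfolding m_def e_nu_def using GH H.finG by (rule sum.subset_diff)
    ultimately show ?thesis using mass by simp
  qed
  define \<mu> where "\<mu> E = 1 / m * \<mu>1 E" for E
  have "(\<Sum>L\<in>{L. L \<subseteq> V \<and> 2 \<le> card L}. (d_nu G \<mu> L)\<^sup>2 / p ^ card L)
      \<le> (\<Sum>L\<in>{L. L \<subseteq> V \<and> 2 \<le> card L}. 49/25 * ((d_nu H \<mu>1 L)\<^sup>2 / p ^ card L))"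
  proof (rule sum_mono)
    fix L
    have "d_nu G \<mu> L = 1 / m * d_nu G \<mu>1 L" unfolding \<mu>_def by (rule d_nu_scale)
    also have "\<dots> \<le> 7/5 * d_nu H \<mu>1 L"
    proof (rule mult_mono)
      show "1 / m \<le> 7/5" using m by (simp add: field_simps)
      show "d_nu G \<mu>1 L \<le> d_nu H \<mu>1 L" unfolding d_nu_def using GH H.finG \<mu>1_nonneg by (intro sum_mono2) auto
    qed (use \<mu>1_nonneg G.d_nonneg in auto)
    finally have le: "d_nu G \<mu> L \<le> 7/5 * d_nu H \<mu>1 L" .
    have "0 \<le> d_nu G \<mu> L" using \<mu>1_nonneg m by (intro G.d_nonneg) (auto simp: \<mu>_def)
    with le have "(d_nu G \<mu> L)\<^sup>2 \<le> (7/5 * d_nu H \<mu>1 L)\<^sup>2" by (intro power_mono)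
    then have "(d_nu G \<mu> L)\<^sup>2 / p ^ card L \<le> (7/5 * d_nu H \<mu>1 L)\<^sup>2 / p ^ card L" using p by (intro divide_right_mono) auto
    also have "\<dots> = 49/25 * ((d_nu H \<mu>1 L)\<^sup>2 / p ^ card L)" by (simp add: power_mult_distrib power_divide)
    finally show "(d_nu G \<mu> L)\<^sup>2 / p ^ card L \<le> 49/25 * ((d_nu H \<mu>1 L)\<^sup>2 / p ^ card L)" .
  qed
  also have "\<dots> = 49/25 * (\<Sum>L\<in>{L. L \<subseteq> V \<and> 2 \<le> card L}. (d_nu H \<mu>1 L)\<^sup>2 / p ^ card L)"
    by (rule sum_distrib_left[symmetric])
  also have "(\<Sum>L\<in>{L. L \<subseteq> V \<and> 2 \<le> card L}. (d_nu H \<mu>1 L)\<^sup>2 / p ^ card L)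
     = (\<Sum>L'\<in>{L'. L' \<subseteq> UU \<and> 2 \<le> card L'}. \<Sum>L\<in>{L. L \<subseteq> V \<and> \<pi> ` L = L' \<and> card L = card L'}. (d_nu H \<mu>1 L)\<^sup>2 / p ^ card L)"
    by (rule H.sum_over_lifts[OF finUU, where \<nu> = \<mu>1]) (use injH in \<open>auto simp: UU_def\<close>)
  \<comment> \<open>Splitting the degree of \<open>L'\<close> among its lifts only lowers the sum of
    squares. Lifting thus loses no power of 2; projecting does, in
    \<open>pushed_energy_le\<close>.\<close>
  also have "\<dots> \<le> (\<Sum>L'\<in>{L'. L' \<subseteq> UU \<and> 2 \<le> card L'}. (d_nu Q \<mu>0 L')\<^sup>2 / p ^ card L')"
  proof (rule sum_mono)
    fix L' :: "'b set"
    let ?S = "{L. L \<subseteq> V \<and> \<pi> ` L = L' \<and> card L = card L'}"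
    have "(\<Sum>L\<in>?S. (d_nu H \<mu>1 L)\<^sup>2) \<le> (\<Sum>L\<in>?S. d_nu H \<mu>1 L)\<^sup>2"
      using finV H.d_nonneg[of \<mu>1] \<mu>1_nonneg by (intro sum_squares_le_square_sum) auto
    also have "(\<Sum>L\<in>?S. d_nu H \<mu>1 L) = d_nu Q \<mu>0 L'"
      using H.sum_lifts[of \<pi>, where L' = L' and \<nu> = \<mu>1] injH deg by simp
    finally have "(\<Sum>L\<in>?S. (d_nu H \<mu>1 L)\<^sup>2) / p ^ card L' \<le> (d_nu Q \<mu>0 L')\<^sup>2 / p ^ card L'"
      using p by (intro divide_right_mono) auto
    then show "(\<Sum>L\<in>?S. (d_nu H \<mu>1 L)\<^sup>2 / p ^ card L) \<le> (d_nu Q \<mu>0 L')\<^sup>2 / p ^ card L'"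
      by (simp add: sum_divide_distrib)
  qed
  also have "\<dots> = Lambda p Q \<mu>0" by (rule LQ[symmetric])
  finally have "(\<Sum>L\<in>{L. L \<subseteq> V \<and> 2 \<le> card L}. (d_nu G \<mu> L)\<^sup>2 / p ^ card L) \<le> 49/25 * (1 / R)"
    using \<mu>0(3) by simp
  also have "\<dots> \<le> 128 / (p * n)" using p npos by (simp add: R_def field_simps)
  finally have bound: "(\<Sum>L\<in>{L. L \<subseteq> V \<and> 2 \<le> card L}. (d_nu G \<mu> L)\<^sup>2 / p ^ card L) \<le> 128 / (p * n)" .
  show ?thesis
  proof (rule that[OF _ _ _ bound])
    show "0 \<le> \<mu> E" for E using \<mu>1_nonneg[of E] m by (simp add: \<mu>_def)
    show "\<mu> E = 0" if "\<not> E \<subseteq> Y" for E using that g by (auto simp: \<mu>_def \<mu>1_def induced_def)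
    have "e_nu G \<mu> = 1 / m * m" unfolding \<mu>_def m_def by (rule e_nu_scale)
    then show "e_nu G \<mu> = 1" using m by simp
  qed
qed

definition terminal :: "'a set \<Rightarrow> bool" where
  "terminal X \<longleftrightarrow> (\<exists>Y. Y \<subseteq> X \<and> real (card Y) \<ge> real (card X) - real n / (2^8 * real r)
     \<and> \<not> janson p R (proj \<pi> (induced H Y)))"

text \<open>Vertices whose accumulated degree is already large are removed before the next measure is
  chosen; non-terminality allows this as long as few vertices are removed.\<close>
lemma accumulated_measure:
  assumes X: "X \<subseteq> V" and nt: "\<not> terminal X"
  shows "k \<le> n \<Longrightarrow> \<exists>\<mu>. (\<forall>E\<in>G. 0 \<le> \<mu> E) \<and> (\<forall>E\<in>G. \<not> E \<subseteq> X \<longrightarrow> \<mu> E = 0) \<and> e_nu G \<mu> = real k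
    \<and> (\<Sum>L\<in>{L. L \<subseteq> V \<and> 2 \<le> card L}. (d_nu G \<mu> L)\<^sup>2 / p ^ card L) \<le> (real k)\<^sup>2 * (128 / (p * n))
    \<and> (\<forall>x\<in>V. d_nu G \<mu> {x} \<le> 256 * real r * real s + 1)"
proof (induction k)
  case 0
  show ?case by (rule exI[of _ "\<lambda>_. 0"]) (simp add: e_nu_def d_nu_def)
next
  case (Suc k)
  let ?S = "{L. L \<subseteq> V \<and> 2 \<le> card L}" let ?B = "128 / (p * n)"
  \<comment> \<open>The degrees sum to at most \<open>s * n\<close>, so at most
    \<open>s * n / T = n / (2^8 * r)\<close> vertices reach \<open>T\<close>, exactly the number
    that \<open>terminal\<close> allows to be deleted.\<close>
  define T where "T = 256 * real r * real s"
  have T0: "0 < T" using r2 spos by (simp add: T_def)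
  obtain \<mu> where \<mu>: "\<forall>E\<in>G. 0 \<le> \<mu> E" "\<forall>E\<in>G. \<not> E \<subseteq> X \<longrightarrow> \<mu> E = 0" "e_nu G \<mu> = real k"
    "(\<Sum>L\<in>?S. (d_nu G \<mu> L)\<^sup>2 / p ^ card L) \<le> (real k)\<^sup>2 * ?B" "\<forall>x\<in>V. d_nu G \<mu> {x} \<le> T + 1"
    using Suc unfolding T_def by auto
  have d\<mu>0: "0 \<le> d_nu G \<mu> L" for L using \<mu>(1) by (intro G.d_nonneg) auto
  define W where "W = {x\<in>X. T \<le> d_nu G \<mu> {x}}"
  have WX: "W \<subseteq> X" and finX: "finite X" using X finV finite_subset by (auto simp: W_def)
  have finW: "finite W" using WX finX finite_subset by blast
  have "T * card W = (\<Sum>x\<in>W. T)" by simp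
  also have "\<dots> \<le> (\<Sum>x\<in>W. d_nu G \<mu> {x})" by (rule sum_mono) (simp add: W_def)
  also have "\<dots> \<le> (\<Sum>x\<in>V. d_nu G \<mu> {x})" using WX X finV d\<mu>0 by (intro sum_mono2) auto
  also have "\<dots> = real s * real k" using G.sum_degrees[of \<mu>] \<mu>(3) by simp
  also have "\<dots> \<le> s * real n" using Suc.prems by (intro mult_left_mono) auto
  finally have "T * card W \<le> s * real n" .
  then have "256 * real r * card W \<le> n" using spos by (simp add: T_def mult_ac)
  then have cW: "card W \<le> n / (2^8 * real r)" using r2 by (simp add: field_simps)
  have "card (X - W) = card X - card W" using WX finW by (simp add: card_Diff_subset)
  then have "real (card (X - W)) \<ge> real (card X) - n / (2^8 * real r)" using cW by linarith
  then have jan: "janson p R (proj \<pi> (induced H (X - W)))" using nt unfolding terminal_def by auto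
  have XW: "X - W \<subseteq> V" using X by auto
  obtain \<mu>' where \<mu>': "\<And>E. E \<in> G \<Longrightarrow> 0 \<le> \<mu>' E" "\<And>E. E \<in> G \<Longrightarrow> \<not> E \<subseteq> X - W \<Longrightarrow> \<mu>' E = 0"
    "e_nu G \<mu>' = 1" "(\<Sum>L\<in>?S. (d_nu G \<mu>' L)\<^sup>2 / p ^ card L) \<le> ?B"
    by (rule pullback[OF XW jan]) blast
  define \<omega> where "\<omega> E = 1 * \<mu> E + 1 * \<mu>' E" for E
  have d\<omega>: "d_nu G \<omega> L = d_nu G \<mu> L + d_nu G \<mu>' L" for L unfolding \<omega>_def d_nu_linear by simp
  have e\<omega>: "e_nu G \<omega> = real (Suc k)" unfolding \<omega>_def e_nu_linear using \<mu>(3) \<mu>'(3) by simp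
  have sq: "(\<Sum>L\<in>?S. (d_nu G \<omega> L)\<^sup>2 / p ^ card L) \<le> (real (Suc k))\<^sup>2 * ?B"
  proof (cases "k = 0")
    case True
    then have "\<forall>E\<in>G. \<mu> E = 0" using \<mu>(1,3) G.finG by (simp add: e_nu_def sum_nonneg_eq_0_iff)
    then have "d_nu G \<mu> L = 0" for L by (simp add: d_nu_def)
    then show ?thesis using \<mu>'(4) True by (simp add: d\<omega>)
  next
    case False
    then have k: "0 < real k" by simp
    have "(\<Sum>L\<in>?S. (d_nu G \<omega> L)\<^sup>2 / p ^ card L)
        \<le> (\<Sum>L\<in>?S. (1 + 1 / k) * ((d_nu G \<mu> L)\<^sup>2 / p ^ card L) + (1 + k) * ((d_nu G \<mu>' L)\<^sup>2 / p ^ card L))"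
    proof (rule sum_mono)
      fix L
      define x y where "x = d_nu G \<mu> L" and "y = d_nu G \<mu>' L"
      \<comment> \<open>The split in the ratio k : 1 reproduces the triangle inequality for the
        quadratic form, so k measures of energy at most \<open>?B\<close> add up to at most k^2
        \<open>?B\<close>.\<close>
      have "0 \<le> (x - k * y)\<^sup>2 / k" using k by simp
      also have "\<dots> = x\<^sup>2 / k - 2 * x * y + k * y\<^sup>2" using k by (simp add: power2_eq_square field_simps)
      finally have "(x + y)\<^sup>2 \<le> (1 + 1 / k) * x\<^sup>2 + (1 + k) * y\<^sup>2" by (simp add: power2_eq_square algebra_simps)
      then have "(x + y)\<^sup>2 / p ^ card L \<le> ((1 + 1 / k) * x\<^sup>2 + (1 + k) * y\<^sup>2) / p ^ card L" using p by (intro divide_right_mono) auto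
      then show "(d_nu G \<omega> L)\<^sup>2 / p ^ card L \<le> (1 + 1 / k) * ((d_nu G \<mu> L)\<^sup>2 / p ^ card L) + (1 + k) * ((d_nu G \<mu>' L)\<^sup>2 / p ^ card L)"
        unfolding d\<omega> x_def y_def by (simp add: add_divide_distrib)
    qed
    also have "\<dots> = (1 + 1 / k) * (\<Sum>L\<in>?S. (d_nu G \<mu> L)\<^sup>2 / p ^ card L) + (1 + k) * (\<Sum>L\<in>?S. (d_nu G \<mu>' L)\<^sup>2 / p ^ card L)"
      unfolding sum.distrib sum_distrib_left ..
    also have "\<dots> \<le> (1 + 1 / k) * ((real k)\<^sup>2 * ?B) + (1 + k) * ?B"
      using \<mu>(4) \<mu>'(4) k by (intro add_mono mult_left_mono) auto
    also have "\<dots> = (real (Suc k))\<^sup>2 * ?B" using k by (simp add: power2_eq_square algebra_simps add_divide_distrib)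
    finally show ?thesis .
  qed
  have deg: "d_nu G \<omega> {x} \<le> T + 1" if x: "x \<in> V" for x
  proof (cases "d_nu G \<mu> {x} < T")
    case True
    moreover have "d_nu G \<mu>' {x} \<le> 1" using G.d_le_e[of \<mu>' "{x}"] \<mu>'(1,3) by simp
    ultimately show ?thesis by (simp add: d\<omega>)
  next
    case False
    have "\<mu>' E = 0" if E: "E \<in> {E\<in>G. {x} \<subseteq> E}" for E
    proof (rule \<mu>'(2))
      have "x \<notin> X - W" using False by (auto simp: W_def)
      then show "\<not> E \<subseteq> X - W" using E by auto
    qed (use E in auto)
    then have "d_nu G \<mu>' {x} = 0" unfolding d_nu_def by (rule sum.neutral[OF ballI])
    then show ?thesis using \<mu>(5) x by (simp add: d\<omega>)
  qed
  have nn: "\<forall>E\<in>G. 0 \<le> \<omega> E" using \<mu>(1) \<mu>'(1) by (simp add: \<omega>_def)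
  have sp: "\<forall>E\<in>G. \<not> E \<subseteq> X \<longrightarrow> \<omega> E = 0"
  proof (intro ballI impI)
    fix E assume E: "E \<in> G" "\<not> E \<subseteq> X"
    then have "\<not> E \<subseteq> X - W" by auto
    then show "\<omega> E = 0" using \<mu>(2) \<mu>'(2) E by (simp add: \<omega>_def)
  qed
  show ?case
    by (intro exI[of _ \<omega>] conjI) (rule nn, rule sp, rule e\<omega>, rule sq, use deg in \<open>simp add: T_def\<close>)
qed

lemma d_nu_induced:
  assumes "\<forall>E\<in>G. \<not> E \<subseteq> X \<longrightarrow> \<mu> E = 0"
  shows "d_nu (induced G X) \<mu> L = d_nu G \<mu> L" "e_nu (induced G X) \<mu> = e_nu G \<mu>"
  unfolding d_nu_def e_nu_def using assms G.finG
  by (auto intro!: sum.mono_neutral_left simp: induced_def)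

text \<open>After division by \<open>n\<close> the sum of squared degrees is at most the largest
  degree, \<open>(256 * r * s + 1) / n\<close>, times the total degree \<open>s\<close>. A single
  measure from the Janson property gives no such bound, since \<Lambda> ignores singletons.\<close>

lemma spread_measure:
  assumes X: "X \<subseteq> V" and nt: "\<not> terminal X"
  obtains \<mu> where "\<And>E. E \<in> induced G X \<Longrightarrow> 0 \<le> \<mu> E" "e_nu (induced G X) \<mu> = 1"
    "(\<Sum>L\<in>{L. L \<subseteq> X \<and> 2 \<le> card L}. (d_nu (induced G X) \<mu> L)\<^sup>2 / p ^ card L) \<le> 128 / (p * n)"
    "(\<Sum>x\<in>X. (d_nu (induced G X) \<mu> {x})\<^sup>2) \<le> 257 * real r * real s ^ 2 / n"
proof -
  let ?S = "{L. L \<subseteq> V \<and> 2 \<le> card L}"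
  obtain \<mu> where \<mu>: "\<forall>E\<in>G. 0 \<le> \<mu> E" "\<forall>E\<in>G. \<not> E \<subseteq> X \<longrightarrow> \<mu> E = 0" "e_nu G \<mu> = real n"
    "(\<Sum>L\<in>?S. (d_nu G \<mu> L)\<^sup>2 / p ^ card L) \<le> (real n)\<^sup>2 * (128 / (p * n))"
    "\<forall>x\<in>V. d_nu G \<mu> {x} \<le> 256 * real r * real s + 1"
    using accumulated_measure[OF X nt order_refl] by (elim exE conjE) (rule that)
  define \<omega> where "\<omega> E = 1 / n * \<mu> E" for E
  have n0: "0 < real n" using npos by simp
  have sp: "\<forall>E\<in>G. \<not> E \<subseteq> X \<longrightarrow> \<omega> E = 0" using \<mu>(2) by (simp add: \<omega>_def)
  note ind = d_nu_induced[OF sp]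
  have d\<omega>: "d_nu G \<omega> L = 1 / n * d_nu G \<mu> L" for L unfolding \<omega>_def by (rule d_nu_scale)
  have d0: "0 \<le> d_nu G \<mu> L" for L using \<mu>(1) by (intro G.d_nonneg) auto
  show ?thesis
  proof (rule that[of \<omega>])
    show "0 \<le> \<omega> E" if "E \<in> induced G X" for E using that \<mu>(1) by (simp add: \<omega>_def induced_def)
    have "e_nu G \<omega> = 1 / n * e_nu G \<mu>" unfolding \<omega>_def by (rule e_nu_scale)
    then show "e_nu (induced G X) \<omega> = 1" using \<mu>(3) n0 ind by simp
    have "(\<Sum>L\<in>{L. L \<subseteq> X \<and> 2 \<le> card L}. (d_nu G \<omega> L)\<^sup>2 / p ^ card L) \<le> (\<Sum>L\<in>?S. (d_nu G \<omega> L)\<^sup>2 / p ^ card L)"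
      using X finV p by (intro sum_mono2) auto
    also have "\<dots> = (1 / n)\<^sup>2 * (\<Sum>L\<in>?S. (d_nu G \<mu> L)\<^sup>2 / p ^ card L)"
      unfolding d\<omega> sum_distrib_left power_mult_distrib by simp
    also have "\<dots> \<le> (1 / n)\<^sup>2 * ((real n)\<^sup>2 * (128 / (p * n)))" using \<mu>(4) by (intro mult_left_mono) auto
    also have "\<dots> = 128 / (p * n)" using n0 by (simp add: power2_eq_square)
    finally show "(\<Sum>L\<in>{L. L \<subseteq> X \<and> 2 \<le> card L}. (d_nu (induced G X) \<omega> L)\<^sup>2 / p ^ card L) \<le> 128 / (p * n)"
      unfolding ind .
    have "(\<Sum>x\<in>X. (d_nu G \<omega> {x})\<^sup>2) \<le> (\<Sum>x\<in>V. (d_nu G \<omega> {x})\<^sup>2)" using X finV by (intro sum_mono2) auto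
    also have "\<dots> = (\<Sum>x\<in>V. (1 / n)\<^sup>2 * (d_nu G \<mu> {x} * d_nu G \<mu> {x}))"
      unfolding d\<omega> power_mult_distrib power2_eq_square[of "d_nu G \<mu> _"] ..
    also have "\<dots> \<le> (\<Sum>x\<in>V. (1 / n)\<^sup>2 * ((256 * real r * real s + 1) * d_nu G \<mu> {x}))"
      using \<mu>(5) d0 by (intro sum_mono mult_left_mono mult_right_mono) auto
    also have "\<dots> = (1 / n)\<^sup>2 * ((256 * real r * real s + 1) * (\<Sum>x\<in>V. d_nu G \<mu> {x}))"
      by (simp add: sum_distrib_left)
    also have "\<dots> = (256 * real r * real s + 1) * real s / n"
      unfolding G.sum_degrees \<mu>(3) using n0 by (simp add: power2_eq_square)
    also have "\<dots> \<le> 257 * real r * real s ^ 2 / n"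
    proof (rule divide_right_mono)
      have "1 * 1 \<le> real r * real s" using r2 spos by (intro mult_mono) auto
      then have "(256 * real r * real s + 1) * real s \<le> (257 * real r * real s) * real s" by (intro mult_right_mono) auto
      then show "(256 * real r * real s + 1) * real s \<le> 257 * real r * real s ^ 2" by (simp add: power2_eq_square mult.assoc)
    qed simp
    finally show "(\<Sum>x\<in>X. (d_nu (induced G X) \<omega> {x})\<^sup>2) \<le> 257 * real r * real s ^ 2 / n" unfolding ind .
  qed
qed

end

section \<open>Failure of the Janson property forces small capacity\<close>

context janson_setting
begin

lemma cross_insert:
  assumes "finite B"
  shows "cross (insert v B) = cross B"
  unfolding cross_def
proof (rule sum.mono_neutral_right)
  have "d_nu F \<nu>F L = 0" if "v \<in> L" for L
    using that vU F by (intro d_nu_not_subset) auto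
  then show "\<forall>L\<in>{L. L \<subseteq> insert v B \<and> 2 \<le> card L} - {L. L \<subseteq> B \<and> 2 \<le> card L}. d_nu F \<nu>F L / p ^ card L = 0"
    by auto
qed (use assms in auto)

text \<open>Every set avoiding \<open>v\<close> occurs at most twice, with and without
  \<open>v\<close>, at cost at most 1/p each; this gives 2/p and brings in the vertex degrees. A
  degree in the image is a sum over at most 2^|L'| lifts, and Cauchy-Schwarz turns that count into
  the weight p/2.\<close>

lemma pushed_energy_le:
  assumes I: "I \<subseteq> V" and C: "(\<Sum>L\<in>nesub I. (d_nu (induced G I) \<nu> L)\<^sup>2 / (p/2) ^ card L) \<le> C"
    and b: "\<And>L. b L = (\<Sum>E\<in>{E \<in> induced G I. L - {v} \<subseteq> \<pi> ` E}. \<nu> E)"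
  shows "(\<Sum>L\<in>{L. L \<subseteq> insert v UU \<and> 2 \<le> card L}. (b L)\<^sup>2 / p ^ card L) \<le> 2 / p * C"
proof -
  interpret K: uniform_hypergraph I "induced G I" s by (rule G.uniform_induced[OF I])
  have finI: "finite I" using I finV finite_subset by blast
  have "1 * 1 \<le> real r ^ 2 * real s ^ 2" using r2 spos by (intro mult_mono one_le_power) auto
  then have "q / (2^10 * real r^2 * real s^2) \<le> q / 1" using q by (intro divide_left_mono) auto
  then have p1: "p \<le> 1" using p q by simp
  define f where "f L = (b L)\<^sup>2 / p ^ card L" for L
  define B where "B = {L. L \<subseteq> UU - {v} \<and> 1 \<le> card L}"
  have finB: "finite B" using finUU by (simp add: B_def)
  have f0: "0 \<le> f L" for L using p by (simp add: f_def)
  have bv: "b (insert v L) = b L" for L unfolding b by simp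
  have "sum f {L. L \<subseteq> insert v UU \<and> 2 \<le> card L} \<le> sum f (B \<union> insert v ` B)"
  proof (rule sum_mono2)
    show "{L. L \<subseteq> insert v UU \<and> 2 \<le> card L} \<subseteq> B \<union> insert v ` B"
    proof
      fix L assume L: "L \<in> {L. L \<subseteq> insert v UU \<and> 2 \<le> card L}"
      then have fL: "finite L" using finUU by (metis finite_insert finite_subset mem_Collect_eq)
      have "L - {v} \<in> B" using L fL by (auto simp: B_def card_Diff_singleton_if)
      moreover have "L = L - {v} \<or> L = insert v (L - {v})" by auto
      ultimately show "L \<in> B \<union> insert v ` B" by (metis UnI1 UnI2 image_eqI)
    qed
  qed (use finB f0 in auto)
  also have "\<dots> \<le> sum f B + sum f (insert v ` B)"
    using sum_Un2[of B "insert v ` B" f] finB f0 sum.union_inter[of B "insert v ` B" f]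
      sum_nonneg[of "B \<inter> insert v ` B" f] by simp
  also have "sum f (insert v ` B) = (\<Sum>L\<in>B. f (insert v L))"
    by (subst sum.reindex) (auto simp: inj_on_def B_def insert_eq_iff)
  also have "sum f B + (\<Sum>L\<in>B. f (insert v L)) \<le> (\<Sum>L\<in>B. 2 / p * f L)"
    unfolding sum.distrib[symmetric]
  proof (rule sum_mono)
    fix L assume "L \<in> B"
    then have "finite L" "v \<notin> L" using finUU by (auto simp: B_def intro: finite_subset)
    then have "f (insert v L) = 1 / p * f L" unfolding f_def bv by simp
    moreover have "1 * f L \<le> 1 / p * f L" using f0 p p1 by (intro mult_right_mono) auto
    moreover have "2 / p * f L = 1 / p * f L + 1 / p * f L" by (simp add: field_simps)
    ultimately show "f L + f (insert v L) \<le> 2 / p * f L" by simp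
  qed
  also have "\<dots> = 2 / p * sum f B" by (rule sum_distrib_left[symmetric])
  also have "\<dots> \<le> 2 / p * C"
  proof (rule mult_left_mono)
    have "sum f B \<le> (\<Sum>L'\<in>{L'. L' \<subseteq> UU \<and> 1 \<le> card L'}.
        \<Sum>L\<in>{L. L \<subseteq> I \<and> \<pi> ` L = L' \<and> card L = card L'}. (d_nu (induced G I) \<nu> L)\<^sup>2 / (p/2) ^ card L)"
    proof (rule order_trans[OF sum_mono sum_mono2])
      fix L' assume L': "L' \<in> B"
      let ?S = "{L. L \<subseteq> I \<and> \<pi> ` L = L' \<and> card L = card L'}"
      have fL': "finite L'" using L' finUU by (auto simp: B_def intro: finite_subset)
      have vL': "L' - {v} = L'" using L' by (auto simp: B_def)
      have half': "\<forall>L. L \<subseteq> I \<longrightarrow> real (card (\<pi> ` L)) \<ge> real (card L) / 2" using half I by blast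
      have "b L' = (\<Sum>L\<in>?S. d_nu (induced G I) \<nu> L)"
        unfolding b vL' by (rule K.sum_lifts[symmetric]) (use injG in \<open>auto simp: induced_def\<close>)
      then have "(b L')\<^sup>2 \<le> (\<Sum>L\<in>?S. (d_nu (induced G I) \<nu> L)\<^sup>2) * card ?S"
        by (simp only: sum_squared_le_sum_of_squares)
      also have "\<dots> \<le> (\<Sum>L\<in>?S. (d_nu (induced G I) \<nu> L)\<^sup>2) * real (2 ^ card L')"
        using card_injective_lifts_le[OF finI half' fL'] by (intro mult_left_mono of_nat_mono sum_nonneg) auto
      finally have "f L' \<le> (\<Sum>L\<in>?S. (d_nu (induced G I) \<nu> L)\<^sup>2) * 2 ^ card L' / p ^ card L'"
        unfolding f_def using p by (intro divide_right_mono) auto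
      also have "\<dots> = (\<Sum>L\<in>?S. (d_nu (induced G I) \<nu> L)\<^sup>2 / (p/2) ^ card L)"
        by (simp add: sum_distrib_right sum_divide_distrib power_divide)
      finally show "f L' \<le> (\<Sum>L\<in>?S. (d_nu (induced G I) \<nu> L)\<^sup>2 / (p/2) ^ card L)" .
    qed (use finUU p in \<open>auto simp: B_def intro!: sum_nonneg\<close>)
    also have "\<dots> = (\<Sum>L\<in>{L. L \<subseteq> I \<and> 1 \<le> card L}. (d_nu (induced G I) \<nu> L)\<^sup>2 / (p/2) ^ card L)"
      by (rule K.sum_over_lifts[OF finUU, where \<nu> = \<nu>, symmetric])
        (use I injG in \<open>auto simp: UU_def induced_def\<close>)
    also have "{L. L \<subseteq> I \<and> 1 \<le> card L} = nesub I"
      using finI by (auto simp: nesub_def Suc_le_eq card_gt_0_iff intro: finite_subset)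
    finally show "sum f B \<le> C" using C by simp
  qed (use p in simp)
  finally show ?thesis unfolding f_def .
qed

text \<open>If the capacity is large, the weights R' and 8 \<eta> R are used to mix the given measure on F with
  the projected equilibrium measure.\<close>
lemma not_janson_capacity:
  assumes I: "I \<subseteq> V" and \<eta>: "\<eta> = p^4 * (q/2)^(4 * s)"
    and bad: "\<not> janson p (R' + \<eta> * R) (proj_v \<pi> v (induced H I) \<union> F)"
  shows "capacity (induced G I) (\<lambda>_. p/2) \<le> 2 * p^4 * n * (q/2)^(4 * s)"
proof (rule ccontr)
  define C where "C = capacity (induced G I) (\<lambda>_. p/2)"
  assume "\<not> capacity (induced G I) (\<lambda>_. p/2) \<le> 2 * p^4 * n * (q/2)^(4 * s)"
  then have big: "2 * p^4 * n * (q/2)^(4 * s) < C" by (simp add: C_def)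
  have eps: "0 < 2 * p^4 * n * (q/2)^(4 * s)" using p q npos by simp
  then have C0: "0 < C" using big by (rule less_trans)
  interpret K: uniform_hypergraph I "induced G I" s by (rule G.uniform_induced[OF I])
  have half_pos: "\<forall>x\<in>I. 0 < p/2" using p by simp
  define \<nu> where "\<nu> E = 1 / C * eqm (induced G I) (\<lambda>_. p/2) E" for E
  have \<nu>0: "0 \<le> \<nu> E" if "E \<in> induced G I" for E
    using K.eqm_nonneg[OF half_pos that] C0 by (simp add: \<nu>_def)
  have e\<nu>: "e_nu (induced G I) \<nu> = 1"
    unfolding \<nu>_def e_nu_scale using C0 by (simp add: C_def capacity_def)
  have en: "(\<Sum>L\<in>nesub I. (d_nu (induced G I) \<nu> L)\<^sup>2 / (p/2) ^ card L) \<le> 1 / C"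
  proof -
    have "(\<Sum>L\<in>nesub I. (d_nu (induced G I) \<nu> L)\<^sup>2 / (p/2) ^ card L)
        = (1 / C)\<^sup>2 * energy I (induced G I) (\<lambda>_. p/2) (eqm (induced G I) (\<lambda>_. p/2))"
      unfolding \<nu>_def d_nu_scale energy_def power_mult_distrib wt_def by (simp add: sum_distrib_left)
    also have "\<dots> = 1 / C" unfolding K.energy_eqm[OF half_pos] C_def[symmetric] using C0 by (simp add: power2_eq_square)
    finally show ?thesis by simp
  qed
  define x where "x = \<eta> * R"
  have x0: "0 < x" using p q Rpos by (simp add: x_def \<eta>)
  \<comment> \<open>With \<open>n = 64 * R / p\<close> the capacity threshold becomes
    \<open>128 * x / p\<close>, exactly what makes the energy \<open>64 * x\<^sup>2 * S3\<close> of
    the projected part smaller than \<open>x\<close>.\<close>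
  have xe: "2 * p^4 * n * (q/2)^(4 * s) = 128 * x / p"
    unfolding x_def \<eta> R_def using p by (simp add: field_simps)
  define T where "T = proj_v \<pi> v (induced H I) \<union> F"
  have finT: "finite T"
    unfolding T_def proj_v_def induced_def using H.finG finite_subset[OF F] finU by auto
  have TU: "\<Union>T \<subseteq> insert v UU" unfolding T_def proj_v_def induced_def UU_def using F I by auto
  have FU: "\<Union>F \<subseteq> insert v UU" using F by (auto simp: UU_def)
  have finW: "finite (insert v UU)" using finUU by simp
  define \<omega>F where "\<omega>F B = (if B \<in> F then \<nu>F B else 0)" for B
  define push where "push B = (\<Sum>E\<in>induced G I. if insert v (\<pi> ` E) = B then \<nu> E else 0)" for B
  have imT: "insert v (\<pi> ` E) \<in> T" if "E \<in> induced G I" for E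
    using that GH by (auto simp: T_def proj_v_def induced_def)
  have push: "(\<Sum>B\<in>T. push B * g B) = (\<Sum>E\<in>induced G I. \<nu> E * g (insert v (\<pi> ` E)))" for g :: "'b set \<Rightarrow> real"
  proof -
    have "(\<Sum>B\<in>T. push B * g B) = (\<Sum>B\<in>T. \<Sum>E\<in>induced G I. if insert v (\<pi> ` E) = B then \<nu> E * g B else 0)"
      unfolding push_def sum_distrib_right by (intro sum.cong refl) auto
    also have "\<dots> = (\<Sum>E\<in>induced G I. \<Sum>B\<in>T. if insert v (\<pi> ` E) = B then \<nu> E * g B else 0)" by (rule sum.swap)
    also have "\<dots> = (\<Sum>E\<in>induced G I. \<nu> E * g (insert v (\<pi> ` E)))"
      using imT finT by (intro sum.cong refl) simp
    finally show ?thesis .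
  qed
  have dF: "d_nu T \<omega>F L = d_nu F \<nu>F L" for L
    unfolding d_nu_def \<omega>F_def using finT by (intro sum.mono_neutral_cong_right) (auto simp: T_def)
  have eF: "e_nu T \<omega>F = e_nu F \<nu>F"
    unfolding e_nu_def \<omega>F_def using finT by (intro sum.mono_neutral_cong_right) (auto simp: T_def)
  define b where "b L = (\<Sum>E\<in>{E \<in> induced G I. L - {v} \<subseteq> \<pi> ` E}. \<nu> E)" for L
  have b_if: "b L = (\<Sum>E\<in>induced G I. \<nu> E * (if L \<subseteq> insert v (\<pi> ` E) then 1 else 0))" for L
    unfolding b_def sum.inter_filter[OF K.finG] by (intro sum.cong refl) auto
  have dP: "d_nu T push L = b L" for L
  proof -
    have "d_nu T push L = (\<Sum>B\<in>T. push B * (if L \<subseteq> B then 1 else 0))"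
      unfolding d_nu_def sum.inter_filter[OF finT] by (intro sum.cong refl) auto
    then show ?thesis unfolding push b_if .
  qed
  have eP: "e_nu T push = 1" using push[of "\<lambda>_. 1"] e\<nu> by (simp add: e_nu_def)
  define \<omega> where "\<omega> B = R' * \<omega>F B + (8 * x) * push B" for B
  have d\<omega>: "d_nu T \<omega> L = R' * d_nu F \<nu>F L + (8 * x) * b L" for L
    unfolding \<omega>_def d_nu_linear dF dP ..
  have e\<omega>: "e_nu T \<omega> = R' + 8 * x" unfolding \<omega>_def e_nu_linear eF eP using \<nu>F(2) by simp
  have \<omega>0: "0 \<le> \<omega> B" for B
    using R' \<nu>F(1) x0 \<nu>0 unfolding \<omega>_def \<omega>F_def push_def
    by (intro add_nonneg_nonneg mult_nonneg_nonneg sum_nonneg) auto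
  let ?S = "{L. L \<subseteq> insert v UU \<and> 2 \<le> card L}"
  define S1 S2 S3 where "S1 = (\<Sum>L\<in>?S. (d_nu F \<nu>F L)\<^sup>2 / p ^ card L)"
    and "S2 = (\<Sum>L\<in>?S. d_nu F \<nu>F L / p ^ card L * b L)" and "S3 = (\<Sum>L\<in>?S. (b L)\<^sup>2 / p ^ card L)"
  have "Lambda p T \<omega> = (\<Sum>L\<in>?S. (R' * d_nu F \<nu>F L + (8 * x) * b L)\<^sup>2 / p ^ card L)"
    unfolding Lambda_superset[OF finW TU] d\<omega> ..
  also have "\<dots> = (\<Sum>L\<in>?S. R'\<^sup>2 * ((d_nu F \<nu>F L)\<^sup>2 / p ^ card L) + 16 * x * R' * (d_nu F \<nu>F L / p ^ card L * b L)
      + 64 * x\<^sup>2 * ((b L)\<^sup>2 / p ^ card L))"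
    by (intro sum.cong refl) (simp add: power2_eq_square algebra_simps add_divide_distrib)
  also have "\<dots> = R'\<^sup>2 * S1 + 16 * x * R' * S2 + 64 * x\<^sup>2 * S3"
    unfolding S1_def S2_def S3_def sum.distrib sum_distrib_left ..
  finally have L: "Lambda p T \<omega> = R'\<^sup>2 * S1 + 16 * x * R' * S2 + 64 * x\<^sup>2 * S3" .
  have "S1 = Lambda p F \<nu>F" unfolding S1_def by (rule Lambda_superset[OF finW FU, symmetric])
  then have "R' * (R' * S1) \<le> R' * 1" using \<nu>F(3) R' by (intro mult_left_mono) auto
  then have t1: "R'\<^sup>2 * S1 \<le> R'" by (simp add: power2_eq_square)
  have "R' * S2 \<le> 7/8"
  proof -
    have "S2 = (\<Sum>L\<in>?S. \<Sum>E\<in>induced G I. if L \<subseteq> insert v (\<pi> ` E) then \<nu> E * (d_nu F \<nu>F L / p ^ card L) else 0)"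
      unfolding S2_def b_if sum_distrib_left by (intro sum.cong refl) simp
    also have "\<dots> = (\<Sum>E\<in>induced G I. \<Sum>L\<in>?S. if L \<subseteq> insert v (\<pi> ` E) then \<nu> E * (d_nu F \<nu>F L / p ^ card L) else 0)"
      by (rule sum.swap)
    also have "\<dots> = (\<Sum>E\<in>induced G I. \<nu> E * cross (\<pi> ` E))"
    proof (intro sum.cong refl)
      fix E assume E: "E \<in> induced G I"
      have EI: "E \<subseteq> V" "finite E" using K.edgeD[OF E] I by auto
      then have "insert v (\<pi> ` E) \<subseteq> insert v UU" by (auto simp: UU_def)
      then have eq: "{L \<in> ?S. L \<subseteq> insert v (\<pi> ` E)} = {L. L \<subseteq> insert v (\<pi> ` E) \<and> 2 \<le> card L}" by blast
      have finS: "finite ?S" using finUU by simp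
      have "(\<Sum>L\<in>?S. if L \<subseteq> insert v (\<pi> ` E) then \<nu> E * (d_nu F \<nu>F L / p ^ card L) else 0) = \<nu> E * cross (insert v (\<pi> ` E))"
        unfolding sum.inter_filter[OF finS, symmetric] eq cross_def by (rule sum_distrib_left[symmetric])
      then show "(\<Sum>L\<in>?S. if L \<subseteq> insert v (\<pi> ` E) then \<nu> E * (d_nu F \<nu>F L / p ^ card L) else 0) = \<nu> E * cross (\<pi> ` E)"
        using cross_insert EI by simp
    qed
    finally have "R' * S2 = (\<Sum>E\<in>induced G I. \<nu> E * (R' * cross (\<pi> ` E)))"
      by (simp add: sum_distrib_left algebra_simps)
    also have "\<dots> \<le> (\<Sum>E\<in>induced G I. \<nu> E * (7/8))"
      using \<nu>0 by (intro sum_mono mult_left_mono) (auto simp: induced_def G_def)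
    also have "\<dots> = 7/8" using e\<nu> unfolding e_nu_def sum_distrib_right[symmetric] by simp
    finally show ?thesis .
  qed
  then have "16 * x * (R' * S2) \<le> 16 * x * (7/8)" using x0 by (intro mult_left_mono) auto
  then have t2: "16 * x * R' * S2 \<le> 14 * x" by (simp add: mult.assoc)
  have "S3 \<le> 2 / p * (1 / C)" unfolding S3_def by (rule pushed_energy_le[OF I en b_def])
  also have "\<dots> < 2 / p * (1 / (128 * x / p))"
    using big eps C0 p unfolding xe by (intro mult_strict_left_mono divide_strict_left_mono mult_pos_pos) auto
  also have "\<dots> = 1 / (64 * x)" using p by simp
  finally have "64 * x\<^sup>2 * S3 < 64 * x\<^sup>2 * (1 / (64 * x))" using x0 by (intro mult_strict_left_mono) auto
  then have t3: "64 * x\<^sup>2 * S3 < x" using x0 by (simp add: power2_eq_square)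
  have "Lambda p T \<omega> < R' + 15 * x" unfolding L using t1 t2 t3 by linarith
  also have "\<dots> \<le> (R' + 8 * x)\<^sup>2 / (R' + x)"
  proof -
    \<comment> \<open>Both sides contain 16 R' x, so 15x is the most that can be allowed uniformly
      in R'; the remaining comparison is 15 x^2 against 64 x^2.\<close>
    have "(R' + 15 * x) * (R' + x) \<le> (R' + 8 * x)\<^sup>2" by (simp add: power2_eq_square algebra_simps)
    then show ?thesis using R' x0 by (simp add: pos_le_divide_eq)
  qed
  finally have "Lambda p T \<omega> < (e_nu T \<omega>)\<^sup>2 / (R' + x)" by (simp add: e\<omega>)
  then have "janson p (R' + x) T" unfolding janson_def using \<omega>0 R' x0 by auto
  then show False using bad by (simp add: T_def x_def)
qed

definition bad_set :: "'a set \<Rightarrow> bool" where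
  "bad_set I \<longleftrightarrow> capacity (induced G I) (\<lambda>_. p/2) \<le> 2 * p^4 * n * (q/2)^(4 * s)"

text \<open>The spacing 1/(4(s - 1)) of the sampling process has no meaning for
  \<open>s = 1\<close>, but a single set serves: the vertices that are edges of \<open>G\<close>. If
  they were few, deleting them would leave a set whose pulled back measure has no edge to live on.
  The measure with mass 1 on each edge inside \<open>I\<close> shows that the capacity of
  \<open>I\<close> is at least p/2 times \<open>card (I \<inter> A)\<close>.\<close>

lemma linear_step:
  assumes s1: "s = 1" and X: "X \<subseteq> V" and nt: "\<not> terminal X"
  shows "\<exists>PP. finite PP \<and>
       (\<forall>P\<in>PP. P \<subseteq> X \<and> P \<noteq> {} \<and> card PP * exp (q/2 * card P * (1 + ln (1 / (q/2)))) \<le> exp (4 * q * ln (2/q) * (1 - q/2) * card P)) \<and>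
       (\<forall>I. I \<subseteq> X \<and> bad_set I \<longrightarrow> (\<exists>P\<in>PP. card (I \<inter> P) < q/2 * card P))"
proof -
  define A where "A = {x\<in>X. {x} \<in> G}"
  have finX: "finite X" using X finV finite_subset by blast
  have AX: "A \<subseteq> X" and finA: "finite A" using finX by (auto simp: A_def)
  have n0: "0 < real n" using npos by simp
  have r0: "0 < real r" using r2 by simp
  have cA: "n / (2^8 * real r) < card A"
  proof (rule ccontr)
    assume "\<not> n / (2^8 * real r) < card A"
    moreover have "card (X - A) = card X - card A" using AX finA by (simp add: card_Diff_subset)
    ultimately have "real (card (X - A)) \<ge> real (card X) - n / (2^8 * real r)" by linarith
    then have jan: "janson p R (proj \<pi> (induced H (X - A)))" using nt unfolding terminal_def by auto
    have XA: "X - A \<subseteq> V" using X by auto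
    obtain \<mu> where \<mu>: "\<And>E. E \<in> G \<Longrightarrow> \<not> E \<subseteq> X - A \<Longrightarrow> \<mu> E = 0" "e_nu G \<mu> = 1"
      by (rule pullback[OF XA jan]) blast
    have "\<mu> E = 0" if E: "E \<in> G" for E
    proof (rule \<mu>(1)[OF E])
      obtain z where "E = {z}" using G.edgeD[OF E] s1 by (auto simp: card_1_singleton_iff)
      then show "\<not> E \<subseteq> X - A" using E by (auto simp: A_def)
    qed
    then have "e_nu G \<mu> = 0" by (simp add: e_nu_def)
    then show False using \<mu>(2) by simp
  qed
  have Apos: "0 < real (card A)" using cA r0 n0 by (smt (verit) divide_pos_pos mult_pos_pos zero_less_power)
  have sparse: "card (I \<inter> A) < q/2 * card A" if I: "I \<subseteq> X" and bad: "bad_set I" for I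
  proof -
    have IV: "I \<subseteq> V" using I X by auto
    interpret K: uniform_hypergraph I "induced G I" s by (rule G.uniform_induced[OF IV])
    define C where "C = capacity (induced G I) (\<lambda>_. p/2)"
    define k where "k = real (card (I \<inter> A))"
    have eqI: "induced G I = (\<lambda>x. {x}) ` (I \<inter> A)"
    proof (intro equalityI subsetI)
      fix E assume E: "E \<in> induced G I"
      obtain z where "E = {z}" using K.edgeD[OF E] s1 by (auto simp: card_1_singleton_iff)
      then show "E \<in> (\<lambda>x. {x}) ` (I \<inter> A)" using E I by (auto simp: induced_def A_def)
    qed (auto simp: induced_def A_def)
    have e: "e_nu (induced G I) (\<lambda>_. 1) = k"
      unfolding e_nu_def k_def eqI by (subst sum.reindex) auto
    have hp: "\<forall>x\<in>I. 0 < p/2" using p by simp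
    have d1: "d_nu (induced G I) (\<lambda>_. 1) {x} \<le> 1" "0 \<le> d_nu (induced G I) (\<lambda>_. 1) {x}" for x
    proof -
      have "{E \<in> induced G I. {x} \<subseteq> E} \<subseteq> {{x}}" unfolding eqI by auto
      then have "card {E \<in> induced G I. {x} \<subseteq> E} \<le> card {{x}}" by (intro card_mono) auto
      then show "d_nu (induced G I) (\<lambda>_. 1) {x} \<le> 1" by (simp add: d_nu_def)
    qed (simp add: d_nu_def)
    have "energy I (induced G I) (\<lambda>_. p/2) (\<lambda>_. 1) \<le> k / (p/2)"
    proof -
      have zero: "(\<Sum>L\<in>{L. L \<subseteq> I \<and> 2 \<le> card L}. (d_nu (induced G I) (\<lambda>_. 1) L)\<^sup>2 / (p/2) ^ card L) = 0"
        using K.d_nu_large s1 by (intro sum.neutral) auto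
      have "(\<Sum>x\<in>I. (d_nu (induced G I) (\<lambda>_. 1) {x})\<^sup>2) \<le> (\<Sum>x\<in>I. d_nu (induced G I) (\<lambda>_. 1) {x})"
        using d1 by (intro sum_mono) (simp add: power2_eq_square mult_left_le)
      also have "\<dots> = k" using K.sum_degrees[of "\<lambda>_. 1"] e s1 by simp
      finally have "(\<Sum>x\<in>I. (d_nu (induced G I) (\<lambda>_. 1) {x})\<^sup>2) / (p/2) \<le> k / (p/2)"
        using p by (intro divide_right_mono) auto
      then show ?thesis using K.energy_const_le[of "p/2" "p/2" "\<lambda>_. 1"] p zero by simp
    qed
    moreover have C0: "0 \<le> C" unfolding C_def by (rule K.capacity_nonneg[OF hp])
    ultimately have "C * energy I (induced G I) (\<lambda>_. p/2) (\<lambda>_. 1) \<le> C * (k / (p/2))" by (rule mult_left_mono)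
    moreover have "k\<^sup>2 \<le> C * energy I (induced G I) (\<lambda>_. p/2) (\<lambda>_. 1)"
      using K.capacity_ge_ratio[OF hp, of "\<lambda>_. 1"] e by (simp add: C_def)
    ultimately have "k * k \<le> k * (C * (2 / p))" by (simp add: power2_eq_square mult_ac)
    moreover have k0: "0 \<le> k" by (simp add: k_def)
    ultimately have "k \<le> C * (2 / p)" using C0 p by (cases "k = 0") (simp, metis less_le mult_le_cancel_left_pos)
    also have "\<dots> \<le> 2 * p^4 * n * (q/2)^4 * (2 / p)"
      using bad p s1 unfolding bad_set_def C_def by (intro mult_right_mono) auto
    also have "\<dots> = (q/2) * (n / (2^8 * real r)) * ((q/2)^3 * p^2 * (1024 * (real r * p)))"
      using p r0 by (simp add: field_simps power_numeral_reduce)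
    also have "\<dots> \<le> (q/2) * (n / (2^8 * real r)) * 1"
    proof (intro mult_left_mono)
      have pq: "1024 * real r ^ 2 * p \<le> q" using p s1 r0 by (simp add: field_simps)
      have "real r * p \<le> real r ^ 2 * p" using r2 p by (simp add: power2_eq_square)
      then have rp: "1024 * (real r * p) \<le> 1" using pq q by simp
      have "1 * p \<le> real r * p" using r2 p by (intro mult_right_mono) auto
      then have p1: "p \<le> 1" using rp by simp
      have "(q/2)^3 * p^2 \<le> 1 * 1" using q p p1 by (intro mult_mono power_le_one) auto
      then have "(q/2)^3 * p^2 * (1024 * (real r * p)) \<le> 1 * 1" using rp p q by (intro mult_mono) auto
      then show "(q/2)^3 * p^2 * (1024 * (real r * p)) \<le> 1" by simp
    qed (use q in auto)
    also have "\<dots> < (q/2) * card A" using cA q unfolding mult_1_right by (intro mult_strict_left_mono) auto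
    finally show ?thesis by (simp add: k_def)
  qed
  have "1 * exp (q/2 * card A * (1 + ln (1 / (q/2)))) \<le> exp (4 * q * ln (2/q) * (1 - q/2) * card A)"
    by (rule branching_exponent[OF q]) (use q in auto)
  then show ?thesis using AX Apos sparse by (intro exI[of _ "{A}"]) auto
qed

lemma branching_step:
  assumes X: "X \<subseteq> V" and nt: "\<not> terminal X"
  shows "\<exists>PP. finite PP \<and>
       (\<forall>P\<in>PP. P \<subseteq> X \<and> P \<noteq> {} \<and> card PP * exp (q/2 * card P * (1 + ln (1 / (q/2)))) \<le> exp (4 * q * ln (2/q) * (1 - q/2) * card P)) \<and>
       (\<forall>I. I \<subseteq> X \<and> bad_set I \<longrightarrow> (\<exists>P\<in>PP. card (I \<inter> P) < q/2 * card P))"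
proof (cases "s = 1")
  case True
  then show ?thesis using linear_step[OF _ X nt] by simp
next
  case False
  then have s2: "2 \<le> s" using spos by simp
  interpret K: uniform_hypergraph X "induced G X" s by (rule G.uniform_induced[OF X])
  obtain \<mu> where \<mu>: "\<And>E. E \<in> induced G X \<Longrightarrow> 0 \<le> \<mu> E" "e_nu (induced G X) \<mu> = 1"
    "(\<Sum>L\<in>{L. L \<subseteq> X \<and> 2 \<le> card L}. (d_nu (induced G X) \<mu> L)\<^sup>2 / p ^ card L) \<le> 128 / (p * n)"
    "(\<Sum>x\<in>X. (d_nu (induced G X) \<mu> {x})\<^sup>2) \<le> 257 * real r * real s ^ 2 / n"
    by (rule spread_measure[OF X nt]) blast
  have cX: "card X \<le> n" using X finV cardV card_mono by metis
  have "induced (induced G X) I = induced G I" if "I \<subseteq> X" for I using that by (auto simp: induced_def)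
  then have *: "(I \<subseteq> X \<and> capacity (induced (induced G X) I) (\<lambda>_. p/2) \<le> 2 * p^4 * n * (q/2)^(4 * s)) = (I \<subseteq> X \<and> bad_set I)" for I
    by (auto simp: bad_set_def)
  show ?thesis using K.spread_step[OF s2 r2 q p cX \<mu>] unfolding * .
qed

end

theorem theorem5p4:
  fixes s r n :: nat and p q R R' \<eta> :: real
    and F :: "'b set set" and U :: "'b set"
    and H :: "'a set set" and V :: "'a set"
    and \<pi> :: "'a \<Rightarrow> 'b" and v :: 'b
  assumes "n \<ge> s" and "r \<ge> 2"
    and "0 < q" and "q < 1/8"
    and "0 < p" and "p \<le> q / (2^10 * real r^2 * real s^2)"
    and "R = p * real n / 2^6"
    and "0 \<le> R'" and "R' \<le> R / 16"
    and "\<eta> = p^4 * (q/2)^(4 * s)"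
    and "finite U" and "F \<subseteq> {E. E \<subseteq> U \<and> card E = s + 1}" and "janson p R' F"
    and "finite V" and "card V = n" and "H \<subseteq> {E. E \<subseteq> V \<and> card E = s}"
    and "\<forall>L. L \<subseteq> V \<longrightarrow> real (card (\<pi> ` L)) \<ge> real (card L) / 2"
    and "\<forall>E\<in>H. card (\<pi> ` E) = card E"
    and "v \<notin> U"
  shows "\<exists>\<X>. \<X> \<subseteq> Pow V \<and> real (card \<X>) \<le> 4 * (2/q) powr (4 * q * real n)
    \<and> (\<forall>I. I \<subseteq> V \<longrightarrow> \<not> janson p (R' + \<eta> * R) (proj_v \<pi> v (induced H I) \<union> F)
            \<longrightarrow> (\<exists>X\<in>\<X>. I \<subseteq> X))
    \<and> (\<forall>X\<in>\<X>. real (card X) \<ge> real n / (8 * real r) \<longrightarrow>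
         (\<exists>Y. Y \<subseteq> X \<and> real (card Y) \<ge> real (card X) - real n / (2^8 * real r)
              \<and> \<not> janson p R (proj \<pi> (induced H Y))))"
proof -
  \<comment> \<open>For \<open>s = 0\<close> the upper bound on \<open>p\<close> is a division by
    zero, hence 0, against \<open>0 < p\<close>.\<close>
  have s0: "0 < s" using assms(5,6) by (cases "s = 0") auto
  obtain \<nu>F where \<nu>F: "\<And>E. E \<in> F \<Longrightarrow> 0 \<le> \<nu>F E" "R' * e_nu F \<nu>F = R'" "R' * Lambda p F \<nu>F \<le> 1"
  proof (cases "R' = 0")
    case True
    \<comment> \<open>Being Janson for \<open>R' = 0\<close> provides no measure on
      \<open>F\<close>; the zero function meets the scaled conditions.\<close>
    then show ?thesis using that[of "\<lambda>_. 0"] by simp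
  next
    case False
    then have R': "0 < R'" using assms(8) by simp
    obtain \<nu> where \<nu>: "\<And>E. E \<in> F \<Longrightarrow> 0 \<le> \<nu> E" "e_nu F \<nu> = 1" "Lambda p F \<nu> < 1 / R'"
      by (rule janson_measure[OF assms(13) R' assms(5)]) blast
    have "R' * Lambda p F \<nu> \<le> R' * (1 / R')" using \<nu>(3) R' by (intro mult_left_mono) auto
    then show ?thesis using that[of \<nu>] \<nu>(1,2) R' by simp
  qed
  interpret janson_setting s r n p q R R' F U H V \<pi> v \<nu>F
    by unfold_locales (use assms s0 \<nu>F in auto)
  have \<tau>: "0 < q/2" "q/2 < 1" and \<gamma>: "0 \<le> 4 * q * ln (2/q)" using q by auto
  obtain \<X> where X: "\<X> \<subseteq> Pow V" "\<forall>Z\<in>\<X>. terminal Z" "\<forall>I. I \<subseteq> V \<and> bad_set I \<longrightarrow> (\<exists>Z\<in>\<X>. I \<subseteq> Z)"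
    "card \<X> \<le> exp (4 * q * ln (2/q) * card V)"
  proof -
    have "\<exists>\<C>. \<C> \<subseteq> Pow V \<and> (\<forall>Z\<in>\<C>. terminal Z) \<and> (\<forall>I. I \<subseteq> V \<and> bad_set I \<longrightarrow> (\<exists>Z\<in>\<C>. I \<subseteq> Z)) \<and>
        card \<C> \<le> exp (4 * q * ln (2/q) * card V)"
      by (rule container_recursion[where \<tau> = "q/2", OF finV \<tau> \<gamma> branching_step order_refl])
    then show ?thesis by (elim exE conjE) (rule that)
  qed
  have "real (card \<X>) \<le> 1 * (2/q) powr (4 * q * real n)"
    using X(4) q by (simp add: cardV powr_def mult_ac)
  also have "\<dots> \<le> 4 * (2/q) powr (4 * q * real n)" by (intro mult_right_mono) auto
  finally have card: "real (card \<X>) \<le> 4 * (2/q) powr (4 * q * real n)" .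
  have cover: "\<exists>X\<in>\<X>. I \<subseteq> X" if "I \<subseteq> V" "\<not> janson p (R' + \<eta> * R) (proj_v \<pi> v (induced H I) \<union> F)" for I
    using X(3) that not_janson_capacity[OF that(1) assms(10) that(2)] by (simp add: bad_set_def)
  show ?thesis
    by (rule exI[of _ \<X>]) (use X(1,2) card cover in \<open>simp add: terminal_def\<close>)
qed

end
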